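(* Let $p$ be a prime. (1) Let $G=\mathbb{Z}_p[\zeta]\rtimes\langle s\rangle$ be the pro-$p$ group of maximal class, where $\zeta$ is a primitive $p$-th root of unity over $\mathbb{Q}_p$, $s$ has order $p$, and $s$ acts on $\mathbb{Z}_p[\zeta]$ by multiplication by $\zeta$. Then $\Delta_{\mathrm{virt}}(G)$ has diameter $2$. (2) Let $G=V\rtimes Q_8$, where $V$ is a free $\mathbb{Z}_p$-module of rank $4$ with basis $\{\mathds{1},i,j,k\}$ and the quaternion group $Q_8=\{\pm1,\pm i,\pm j,\pm k\}$ acts on $V$ by multiplication. Then $\mathrm{diam}(\Delta_{\mathrm{virt}}(G))=2$. (3) The proper virtually generating graph of the wreath product $\mathbb{Z}_2\wr D_4$ has diameter $3$.
   Context: For a topological group $G$, the virtually generating graph $\Gamma_{\mathrm{virt}}(G)$ has vertex set $G$, and two elements $x,y$ are adjacent if and only if the closed subgroup $\langle x,y\rangle$ they topologically generate is open in $G$. A vertex $x$ is isolated if there is no $y\in G$ with $\langle x,y\rangle$ open. The proper virtually generating graph $\Delta_{\mathrm{virt}}(G)$ is obtained from $\Gamma_{\mathrm{virt}}(G)$ by removing its isolated vertices. A statement about the diameter includes that the graph is connected. In (2), the action of $Q_8$ on $V$ is the $\mathbb{Z}_p$-linear action induced by left multiplication of $Q_8$ on the set $\{\pm \mathds{1},\pm i,\pm j,\pm k\}\subset V$ (quaternion multiplication). In (3), $D_4=\langle (1,2,3,4),(1,3)\rangle\le S_4$ is the dihedral group of order $8$ in its natural action on $4$ points, and $\mathbb{Z}_2\wr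 D_4=\mathbb{Z}_2^4\rtimes D_4$ with $D_4$ permuting the coordinates; $\mathbb{Z}_2$ denotes the $2$-adic integers. *)

theory Defs
  imports
    "HOL-Analysis.Product_Topology"
    "HOL-Algebra.Elementary_Groups"
    "HOL-Algebra.Multiplicative_Group"
    "HOL-Algebra.Product_Groups"
    "HOL-Algebra.Sym_Groups"
    "HOL-Algebra.Finite_Extensions"
    "HOL-Number_Theory.Residues"
    "Graph_Theory.Shortest_Path"
    "Graph_Theory.Digraph_Component"
begin

section \<open>Graphs\<close>

text \<open>The distance is the infimum of the lengths of walks, hence \<open>\<infinity>\<close> between different
  components; so a finite diameter entails that the graph is connected
  (see \<open>graph_diameter_finite_imp_reachable\<close>).\<close>

definition graph_dist :: "('a, 'b) pre_digraph \<Rightarrow> 'a \<Rightarrow> 'a \<Rightarrow> ereal" where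
  "graph_dist D u v = wf_digraph.\<mu> D (\<lambda>_. 1) u v"

definition graph_diameter :: "('a, 'b) pre_digraph \<Rightarrow> ereal" where
  "graph_diameter D = (SUP u\<in>verts D. SUP v\<in>verts D. graph_dist D u v)"

lemma graph_diameter_finite_imp_reachable:
  assumes "wf_digraph D" "graph_diameter D < \<infinity>" "u \<in> verts D" "v \<in> verts D"
  shows "u \<rightarrow>\<^sup>*\<^bsub>D\<^esub> v"
proof (rule ccontr)
  assume "\<not> u \<rightarrow>\<^sup>*\<^bsub>D\<^esub> v"
  then have "graph_dist D u v = \<infinity>"
    unfolding graph_dist_def using assms(1) wf_digraph.shortest_path_inf by metis
  moreover have "graph_dist D u v \<le> (SUP v\<in>verts D. graph_dist D u v)"
    using assms(4) by (rule SUP_upper)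
  moreover have "(SUP v\<in>verts D. graph_dist D u v) \<le> graph_diameter D"
    unfolding graph_diameter_def using assms(3) by (rule SUP_upper)
  ultimately show False
    using assms(2) by (auto simp: less_le)
qed

text \<open>A topological group is given by a group \<open>G\<close> together with a topology \<open>T\<close> on its carrier.
  Loops, which occur at elements generating an open subgroup by themselves, are irrelevant for
  distances.\<close>

definition virt_gen_graph ::
    "('a, 'm) monoid_scheme \<Rightarrow> 'a topology \<Rightarrow> ('a, 'a \<times> 'a) pre_digraph" where
  "virt_gen_graph G T =
     \<lparr>verts = carrier G,
      arcs = {(x, y). x \<in> carrier G \<and> y \<in> carrier G \<and>
                openin T (T closure_of generate G {x, y})},
      tail = fst, head = snd\<rparr>"

definition virt_isolated :: "('a, 'm) monoid_scheme \<Rightarrow> 'a topology \<Rightarrow> 'a \<Rightarrow> bool" where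
  "virt_isolated G T x \<longleftrightarrow> \<not> (\<exists>y\<in>carrier G. openin T (T closure_of generate G {x, y}))"

definition proper_virt_gen_graph ::
    "('a, 'm) monoid_scheme \<Rightarrow> 'a topology \<Rightarrow> ('a, 'a \<times> 'a) pre_digraph" where
  "proper_virt_gen_graph G T =
     induce_subgraph (virt_gen_graph G T) {x \<in> carrier G. \<not> virt_isolated G T x}"

lemma wf_digraph_virt_gen_graph: "wf_digraph (virt_gen_graph G T)"
  by unfold_locales (auto simp: virt_gen_graph_def)

lemma wf_digraph_proper_virt_gen_graph: "wf_digraph (proper_virt_gen_graph G T)"
  unfolding proper_virt_gen_graph_def
  by (intro wf_digraph.wellformed_induce_subgraph wf_digraph_virt_gen_graph)


section \<open>Split extensions of p-adic lattices by finite groups\<close>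

definition semidirect ::
    "('a, 'm) monoid_scheme \<Rightarrow> ('b, 'n) monoid_scheme \<Rightarrow> ('b \<Rightarrow> 'a \<Rightarrow> 'a) \<Rightarrow> ('a \<times> 'b) monoid" where
  "semidirect N H act =
     \<lparr>carrier = carrier N \<times> carrier H,
      monoid.mult = (\<lambda>(a, g) (b, h). (a \<otimes>\<^bsub>N\<^esub> act g b, g \<otimes>\<^bsub>H\<^esub> h)),
      one = (\<one>\<^bsub>N\<^esub>, \<one>\<^bsub>H\<^esub>)\<rparr>"

text \<open>The topology on an abelian group \<open>N\<close>, written multiplicatively, in which the cosets of the
  subgroups of \<open>p\<^sup>n\<close>-th powers form a basis. On a free module of finite rank over the p-adic
  integers this is the product topology.\<close>

definition padic_topology :: "nat \<Rightarrow> ('a, 'm) monoid_scheme \<Rightarrow> 'a topology" where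
  "padic_topology p N = topology (\<lambda>U. U \<subseteq> carrier N \<and>
     (\<forall>x\<in>U. \<exists>n::nat. \<forall>y\<in>carrier N. x \<otimes>\<^bsub>N\<^esub> (y [^]\<^bsub>N\<^esub> (p ^ n)) \<in> U))"

lemma openin_padic_topology:
  assumes "monoid N"
  shows "openin (padic_topology p N) U \<longleftrightarrow> U \<subseteq> carrier N \<and>
     (\<forall>x\<in>U. \<exists>n::nat. \<forall>y\<in>carrier N. x \<otimes>\<^bsub>N\<^esub> (y [^]\<^bsub>N\<^esub> (p ^ n)) \<in> U)"
proof -
  interpret monoid N by fact
  have mono: "\<forall>y\<in>carrier N. x \<otimes>\<^bsub>N\<^esub> (y [^]\<^bsub>N\<^esub> (p ^ m)) \<in> U"
    if "\<forall>y\<in>carrier N. x \<otimes>\<^bsub>N\<^esub> (y [^]\<^bsub>N\<^esub> (p ^ n)) \<in> U" and "n \<le> m" for n m :: nat and x U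
  proof
    fix y assume y: "y \<in> carrier N"
    have "y [^]\<^bsub>N\<^esub> (p ^ m) = (y [^]\<^bsub>N\<^esub> (p ^ (m - n))) [^]\<^bsub>N\<^esub> (p ^ n)"
      using y \<open>n \<le> m\<close> by (simp add: nat_pow_pow power_add [symmetric])
    then show "x \<otimes>\<^bsub>N\<^esub> (y [^]\<^bsub>N\<^esub> (p ^ m)) \<in> U"
      using that(1) y by simp
  qed
  have "istopology (\<lambda>U. U \<subseteq> carrier N \<and>
     (\<forall>x\<in>U. \<exists>n::nat. \<forall>y\<in>carrier N. x \<otimes>\<^bsub>N\<^esub> (y [^]\<^bsub>N\<^esub> (p ^ n)) \<in> U))" (is "istopology ?P")
    unfolding istopology_def
  proof (intro conjI allI impI)
    fix S T assume S: "?P S" and T: "?P T"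
    show "\<forall>x\<in>S \<inter> T. \<exists>n::nat. \<forall>y\<in>carrier N. x \<otimes>\<^bsub>N\<^esub> (y [^]\<^bsub>N\<^esub> (p ^ n)) \<in> S \<inter> T"
    proof
      fix x assume x: "x \<in> S \<inter> T"
      obtain n m :: nat where
        "\<forall>y\<in>carrier N. x \<otimes>\<^bsub>N\<^esub> (y [^]\<^bsub>N\<^esub> (p ^ n)) \<in> S"
        "\<forall>y\<in>carrier N. x \<otimes>\<^bsub>N\<^esub> (y [^]\<^bsub>N\<^esub> (p ^ m)) \<in> T"
        using S T x by blast
      then have "\<forall>y\<in>carrier N. x \<otimes>\<^bsub>N\<^esub> (y [^]\<^bsub>N\<^esub> (p ^ max n m)) \<in> S \<inter> T"
        using mono [of x n S "max n m"] mono [of x m T "max n m"] by simp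
      then show "\<exists>n::nat. \<forall>y\<in>carrier N. x \<otimes>\<^bsub>N\<^esub> (y [^]\<^bsub>N\<^esub> (p ^ n)) \<in> S \<inter> T"
        by blast
    qed
    show "S \<inter> T \<subseteq> carrier N" using S by blast
  next
    fix K assume K: "\<forall>S\<in>K. ?P S"
    then show "\<Union>K \<subseteq> carrier N" by blast
    show "\<forall>x\<in>\<Union>K. \<exists>n::nat. \<forall>y\<in>carrier N. x \<otimes>\<^bsub>N\<^esub> (y [^]\<^bsub>N\<^esub> (p ^ n)) \<in> \<Union>K"
    proof
      fix x assume "x \<in> \<Union>K"
      then obtain S where S: "S \<in> K" "x \<in> S" by blast
      then obtain n :: nat where "\<forall>y\<in>carrier N. x \<otimes>\<^bsub>N\<^esub> (y [^]\<^bsub>N\<^esub> (p ^ n)) \<in> S"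
        using K by blast
      then show "\<exists>n::nat. \<forall>y\<in>carrier N. x \<otimes>\<^bsub>N\<^esub> (y [^]\<^bsub>N\<^esub> (p ^ n)) \<in> \<Union>K"
        using S by blast
    qed
  qed
  then show ?thesis
    unfolding padic_topology_def by (simp add: topology_inverse')
qed

definition lattice_extension_topology ::
    "nat \<Rightarrow> ('a, 'm) monoid_scheme \<Rightarrow> ('b, 'n) monoid_scheme \<Rightarrow> ('a \<times> 'b) topology" where
  "lattice_extension_topology p N H =
     prod_topology (padic_topology p N) (discrete_topology (carrier H))"


section \<open>The p-adic integers\<close>

text \<open>The inverse limit of the rings of integers modulo \<open>p\<^sup>n\<close>, \<open>n \<ge> 1\<close>; the component with index
  \<open>n\<close> is the residue modulo \<open>p\<^sup>n\<^sup>+\<^sup>1\<close> (\<open>residue_ring 1\<close> is not a ring).\<close>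

definition Zp :: "nat \<Rightarrow> (nat \<Rightarrow> int) ring" where
  "Zp p =
     \<lparr>carrier = {x. \<forall>n. x n \<in> carrier (residue_ring (int p ^ Suc n)) \<and>
                        x (Suc n) mod int p ^ Suc n = x n},
      monoid.mult = (\<lambda>x y n. x n \<otimes>\<^bsub>residue_ring (int p ^ Suc n)\<^esub> y n),
      one = (\<lambda>n. \<one>\<^bsub>residue_ring (int p ^ Suc n)\<^esub>),
      zero = (\<lambda>n. \<zero>\<^bsub>residue_ring (int p ^ Suc n)\<^esub>),
      add = (\<lambda>x y n. x n \<oplus>\<^bsub>residue_ring (int p ^ Suc n)\<^esub> y n)\<rparr>"


section \<open>The groups\<close>

text \<open>\<open>L\<close> is a field into which the p-adic integers are embedded by \<open>\<phi>\<close> (equivalently, an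
  extension field of the p-adic numbers). The generator \<open>1\<close> of the cyclic group plays the role
  of \<open>s\<close>.\<close>

definition Zp_adjoin ::
    "nat \<Rightarrow> 'a ring \<Rightarrow> ((nat \<Rightarrow> int) \<Rightarrow> 'a) \<Rightarrow> 'a \<Rightarrow> 'a ring" where
  "Zp_adjoin p L \<phi> \<zeta> = L\<lparr>carrier := ring.simple_extension L (\<phi> ` carrier (Zp p)) \<zeta>\<rparr>"

definition max_class_group ::
    "nat \<Rightarrow> 'a ring \<Rightarrow> ((nat \<Rightarrow> int) \<Rightarrow> 'a) \<Rightarrow> 'a \<Rightarrow> ('a \<times> int) monoid" where
  "max_class_group p L \<phi> \<zeta> =
     semidirect (add_monoid (Zp_adjoin p L \<phi> \<zeta>)) (integer_mod_group p)
       (\<lambda>k x. (\<zeta> [^]\<^bsub>L\<^esub> nat k) \<otimes>\<^bsub>L\<^esub> x)"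

definition max_class_topology ::
    "nat \<Rightarrow> 'a ring \<Rightarrow> ((nat \<Rightarrow> int) \<Rightarrow> 'a) \<Rightarrow> 'a \<Rightarrow> ('a \<times> int) topology" where
  "max_class_topology p L \<phi> \<zeta> =
     lattice_extension_topology p (add_monoid (Zp_adjoin p L \<phi> \<zeta>)) (integer_mod_group p)"

text \<open>Hamilton quaternions over \<open>R\<close>; \<open>(a, b, c, d)\<close> stands for \<open>a + b i + c j + d k\<close>.\<close>

context fixes R :: "('a, 'm) ring_scheme" (structure) begin

definition quat :: "('a \<times> 'a \<times> 'a \<times> 'a) ring" where
  "quat =
     \<lparr>carrier = carrier R \<times> carrier R \<times> carrier R \<times> carrier R,
      monoid.mult = (\<lambda>(a, b, c, d) (a', b', c', d').
        (a \<otimes> a' \<ominus> b \<otimes> b' \<ominus> c \<otimes> c' \<ominus> d \<otimes> d',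
         a \<otimes> b' \<oplus> b \<otimes> a' \<oplus> c \<otimes> d' \<ominus> d \<otimes> c',
         a \<otimes> c' \<ominus> b \<otimes> d' \<oplus> c \<otimes> a' \<oplus> d \<otimes> b',
         a \<otimes> d' \<oplus> b \<otimes> c' \<ominus> c \<otimes> b' \<oplus> d \<otimes> a')),
      one = (\<one>, \<zero>, \<zero>, \<zero>),
      zero = (\<zero>, \<zero>, \<zero>, \<zero>),
      add = (\<lambda>(a, b, c, d) (a', b', c', d'). (a \<oplus> a', b \<oplus> b', c \<oplus> c', d \<oplus> d'))\<rparr>"

definition quat_basis :: "('a \<times> 'a \<times> 'a \<times> 'a) set" where
  "quat_basis = {(\<one>, \<zero>, \<zero>, \<zero>), (\<zero>, \<one>, \<zero>, \<zero>), (\<zero>, \<zero>, \<one>, \<zero>), (\<zero>, \<zero>, \<zero>, \<one>)}"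

definition Q8 :: "('a \<times> 'a \<times> 'a \<times> 'a) ring" where
  "Q8 = quat\<lparr>carrier := quat_basis \<union> (\<lambda>u. \<ominus>\<^bsub>quat\<^esub> u) ` quat_basis\<rparr>"

end

text \<open>Since the quaternion product is bilinear, left multiplication by an element of \<open>Q8\<close> is the
  linear extension of its left multiplication on the signed basis.\<close>

definition quat_group ::
    "nat \<Rightarrow> (((nat \<Rightarrow> int) \<times> (nat \<Rightarrow> int) \<times> (nat \<Rightarrow> int) \<times> (nat \<Rightarrow> int)) \<times>
              ((nat \<Rightarrow> int) \<times> (nat \<Rightarrow> int) \<times> (nat \<Rightarrow> int) \<times> (nat \<Rightarrow> int))) monoid" where
  "quat_group p =
     semidirect (add_monoid (quat (Zp p))) (Q8 (Zp p)) (\<lambda>q v. q \<otimes>\<^bsub>quat (Zp p)\<^esub> v)"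

definition quat_topology ::
    "nat \<Rightarrow> (((nat \<Rightarrow> int) \<times> (nat \<Rightarrow> int) \<times> (nat \<Rightarrow> int) \<times> (nat \<Rightarrow> int)) \<times>
              ((nat \<Rightarrow> int) \<times> (nat \<Rightarrow> int) \<times> (nat \<Rightarrow> int) \<times> (nat \<Rightarrow> int))) topology" where
  "quat_topology p = lattice_extension_topology p (add_monoid (quat (Zp p))) (Q8 (Zp p))"

text \<open>\<open>H\<close> is a group of permutations of \<open>{1..n}\<close>; the inverse below makes this a left action.\<close>

definition wreath ::
    "nat \<Rightarrow> ('a, 'm) monoid_scheme \<Rightarrow> (nat \<Rightarrow> nat, 'n) monoid_scheme \<Rightarrow>
     ((nat \<Rightarrow> 'a) \<times> (nat \<Rightarrow> nat)) monoid" where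
  "wreath n A H =
     semidirect (product_group {1..n} (\<lambda>_. A)) H (\<lambda>\<sigma> x. \<lambda>i\<in>{1..n}. x (inv_into UNIV \<sigma> i))"

definition D4 :: "(nat \<Rightarrow> nat) monoid" where
  "D4 = (sym_group 4)\<lparr>carrier :=
     generate (sym_group 4) {cycle_of_list [1, 2, 3, 4], Transposition.transpose 1 3}\<rparr>"

definition Z2_wr_D4 :: "((nat \<Rightarrow> nat \<Rightarrow> int) \<times> (nat \<Rightarrow> nat)) monoid" where
  "Z2_wr_D4 = wreath 4 (add_monoid (Zp 2)) D4"

definition Z2_wr_D4_topology :: "((nat \<Rightarrow> nat \<Rightarrow> int) \<times> (nat \<Rightarrow> nat)) topology" where
  "Z2_wr_D4_topology =
     lattice_extension_topology 2 (product_group {1..4} (\<lambda>_. add_monoid (Zp 2))) D4"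

end

(*
  All three groups are extensions of a lattice N over the p-adic integers by a finite group.  The
  closure of a subgroup is open iff the translations it contains include p^n N for some n, so two
  elements are adjacent iff the translations they produce span N rationally.  Common neighbours are
  found by avoiding finitely many bad values of a parameter.  Non-adjacency is always shown by
  exhibiting a saturated sublattice A of infinite index, usually the common kernel of some p-adic
  linear forms, such that both elements stabilize A and fix a common rational point modulo A.

  For the dihedral group, N splits rationally into two lines and an irreducible plane; the lines
  are detected by the sum and the alternating sum of the coordinates.  Vertices of type A have all
  sufficiently generic elements over the 4-cycle as neighbours, so any two of them share one.  The
  remaining nonisolated vertices, of type B, lie over the half turn or over a reflection fixing two
  points, and their alternating sum vanishes; any two of them have a common neighbour of type A.
  This bounds the diameter by 3.  A vertex over the identity only has neighbours over 4-cycles,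
  since for an involution h some form kills a, h a and b + h b; the alternating sum shows that no
  vertex of type B has such a neighbour, so the distance 3 occurs.
*)
theory Submission
  imports Defs
begin

section \<open>Diameters\<close>

text \<open>In every openness proof the translations in the closure of a subgroup form a module: the
  integers are dense in the p-adic integers, so p-adic multiples are available, and conjugation
  gives stability under the image in the finite group. It remains to invert a field element, a norm
  or a determinant up to a power of p. The cases differ in how far one nonzero vector goes. In (1)
  any one will do, the lattice being an order in a field. In (2) it need not, because for odd p the
  quaternion algebra splits and has nonzero elements of norm zero; hence the criterion asks for a
  nonzero norm, which is quadratic in the parameter to be chosen. In (3) a 4-cycle already acts
  irreducibly on the plane, as -1 is no square in the 2-adic numbers, while the half turn and the
  two reflections fixing points split it into lines and act trivially on the other two constituents
  together, where two independent vectors are therefore required. The rational fixed points of x ->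
  b + h x have denominator 1 or 2: the inverse of 1 - h is 1/2 where h = -1 and (1 + h)/2 where the
  square of h is -1.\<close>

lemma (in wf_digraph) awalk_cost_const_one: "awalk_cost (\<lambda>_. 1) q = real (length q)"
  by (induction q) auto

lemma graph_diameter_le:
  assumes "wf_digraph D"
    and "\<And>u v. u \<in> verts D \<Longrightarrow> v \<in> verts D \<Longrightarrow> \<exists>q. pre_digraph.awalk D u q v \<and> length q \<le> n"
  shows "graph_diameter D \<le> ereal n"
  unfolding graph_diameter_def
proof (intro SUP_least)
  interpret wf_digraph D by fact
  fix u v assume "u \<in> verts D" "v \<in> verts D"
  then obtain q where q: "awalk u q v" "length q \<le> n"
    using assms(2) by blast
  have "graph_dist D u v \<le> ereal (length q)"
    using min_cost_le_walk_cost [OF q(1), of "\<lambda>_. 1"]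
    by (simp add: graph_dist_def awalk_cost_const_one)
  also have "\<dots> \<le> ereal n" using q(2) by simp
  finally show "graph_dist D u v \<le> ereal n" .
qed

lemma graph_diameter_ge:
  assumes "wf_digraph D" "u \<in> verts D" "v \<in> verts D"
    and "\<And>q. pre_digraph.awalk D u q v \<Longrightarrow> n \<le> length q"
  shows "ereal n \<le> graph_diameter D"
proof -
  interpret wf_digraph D by fact
  have "ereal n \<le> graph_dist D u v"
    unfolding graph_dist_def \<mu>_def
    by (intro INF_greatest) (use assms(4) in \<open>simp add: awalk_cost_const_one\<close>)
  also have "\<dots> \<le> (SUP v\<in>verts D. graph_dist D u v)"
    using assms(3) by (rule SUP_upper)
  also have "\<dots> \<le> graph_diameter D"
    unfolding graph_diameter_def using assms(2) by (rule SUP_upper)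
  finally show ?thesis .
qed

section \<open>Adjacency and walks in the proper virtually generating graph\<close>

definition virt_adj ::
    "('a, 'm) monoid_scheme \<Rightarrow> 'a topology \<Rightarrow> 'a \<Rightarrow> 'a \<Rightarrow> bool" where
  "virt_adj G T x y \<longleftrightarrow> x \<in> carrier G \<and> y \<in> carrier G \<and>
     openin T (T closure_of generate G {x, y})"

lemma virt_adj_sym: "virt_adj G T x y \<longleftrightarrow> virt_adj G T y x"
  by (auto simp: virt_adj_def insert_commute)

lemma virt_adj_commute: "virt_adj G T x y \<Longrightarrow> virt_adj G T y x"
  by (simp add: virt_adj_sym)

lemma verts_proper_virt_gen_graph:
  "x \<in> verts (proper_virt_gen_graph G T) \<longleftrightarrow> (\<exists>y. virt_adj G T x y)"
  by (auto simp: proper_virt_gen_graph_def virt_isolated_def virt_adj_def)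

lemma virt_adj_in_verts:
  assumes "virt_adj G T x y"
  shows "x \<in> verts (proper_virt_gen_graph G T)" "y \<in> verts (proper_virt_gen_graph G T)"
  using assms virt_adj_sym verts_proper_virt_gen_graph by metis+

text \<open>Both ends of an arc are nonisolated, so passing to the induced subgraph loses no arc,
  and walks can be read off \<open>virt_adj\<close> alone.\<close>

lemma awalk_proper_virt_gen_graph_Cons:
  "pre_digraph.awalk (proper_virt_gen_graph G T) x (e # es) y \<longleftrightarrow>
     fst e = x \<and> virt_adj G T x (snd e) \<and>
     pre_digraph.awalk (proper_virt_gen_graph G T) (snd e) es y"
proof -
  interpret wf_digraph "proper_virt_gen_graph G T"
    by (rule wf_digraph_proper_virt_gen_graph)
  have "e \<in> arcs (proper_virt_gen_graph G T) \<longleftrightarrow> virt_adj G T (fst e) (snd e)"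
  proof
    assume "virt_adj G T (fst e) (snd e)"
    then show "e \<in> arcs (proper_virt_gen_graph G T)"
      using virt_adj_in_verts [of G T "fst e" "snd e"]
      by (auto simp: proper_virt_gen_graph_def virt_gen_graph_def virt_adj_def)
  qed (auto simp: proper_virt_gen_graph_def virt_gen_graph_def virt_adj_def)
  moreover have "tail (proper_virt_gen_graph G T) = fst" "head (proper_virt_gen_graph G T) = snd"
    by (simp_all add: proper_virt_gen_graph_def virt_gen_graph_def)
  ultimately show ?thesis
    by (auto simp: awalk_Cons_iff)
qed

lemma awalk_proper_virt_gen_graph_Nil:
  "pre_digraph.awalk (proper_virt_gen_graph G T) x [] y \<longleftrightarrow>
     x = y \<and> x \<in> verts (proper_virt_gen_graph G T)"
  using wf_digraph.awalk_Nil_iff [OF wf_digraph_proper_virt_gen_graph] .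

lemmas awalk_proper_virt_gen_graph_iff =
  awalk_proper_virt_gen_graph_Nil awalk_proper_virt_gen_graph_Cons

text \<open>The elements \<open>x'\<close> and \<open>y'\<close> only witness that \<open>x\<close>
  and \<open>y\<close> are nonisolated. Walks may repeat vertices, so for x = y one goes to a
  neighbour and back.\<close>

lemma virt_diameter_eq_2:
  assumes upper: "\<And>x y x' y'. virt_adj G T x x' \<Longrightarrow> virt_adj G T y y' \<Longrightarrow>
      virt_adj G T x y \<or> (\<exists>z. virt_adj G T x z \<and> virt_adj G T z y)"
    and lower: "virt_adj G T u u'" "virt_adj G T v v'" "u \<noteq> v" "\<not> virt_adj G T u v"
  shows "graph_diameter (proper_virt_gen_graph G T) = 2"
proof -
  let ?D = "proper_virt_gen_graph G T"
  note wf = wf_digraph_proper_virt_gen_graph [of G T]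
  have "graph_diameter ?D \<le> ereal (real 2)"
  proof (rule graph_diameter_le [OF wf])
    fix x y assume xy: "x \<in> verts ?D" "y \<in> verts ?D"
    then consider "virt_adj G T x y" | z where "virt_adj G T x z" "virt_adj G T z y"
      using upper verts_proper_virt_gen_graph by metis
    then show "\<exists>q. pre_digraph.awalk ?D x q y \<and> length q \<le> 2"
    proof cases
      case 1
      then show ?thesis using xy
        by (intro exI [of _ "[(x, y)]"]) (auto simp: awalk_proper_virt_gen_graph_iff)
    next
      case 2
      then show ?thesis using xy
        by (intro exI [of _ "[(x, z), (z, y)]"]) (auto simp: awalk_proper_virt_gen_graph_iff)
    qed
  qed
  moreover have "ereal (real 2) \<le> graph_diameter ?D"
  proof (rule graph_diameter_ge [OF wf])
    fix q assume "pre_digraph.awalk ?D u q v"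
    \<comment> \<open>The rule \<open>remdups_adj.cases\<close> serves for its split of lists into
      length 0, length 1 and length at least 2.\<close>
    then show "2 \<le> length q"
      using lower(3,4) by (cases q rule: remdups_adj.cases)
        (auto simp: awalk_proper_virt_gen_graph_iff)
  qed (use virt_adj_in_verts(1) [OF lower(1)] virt_adj_in_verts(1) [OF lower(2)] in auto)
  ultimately show ?thesis by simp
qed

text \<open>Adjacent vertices fall under the second alternative of \<open>upper\<close>: the walk
  runs along the edge, back, and along it again.\<close>

lemma virt_diameter_eq_3:
  assumes upper: "\<And>x y x' y'. virt_adj G T x x' \<Longrightarrow> virt_adj G T y y' \<Longrightarrow>
      (\<exists>z. virt_adj G T x z \<and> virt_adj G T z y) \<or>
      (\<exists>z w. virt_adj G T x z \<and> virt_adj G T z w \<and> virt_adj G T w y)"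
    and lower: "virt_adj G T u u'" "virt_adj G T v v'" "u \<noteq> v" "\<not> virt_adj G T u v"
      "\<And>z. \<not> (virt_adj G T u z \<and> virt_adj G T z v)"
  shows "graph_diameter (proper_virt_gen_graph G T) = 3"
proof -
  let ?D = "proper_virt_gen_graph G T"
  note wf = wf_digraph_proper_virt_gen_graph [of G T]
  have "graph_diameter ?D \<le> ereal (real 3)"
  proof (rule graph_diameter_le [OF wf])
    fix x y assume xy: "x \<in> verts ?D" "y \<in> verts ?D"
    then consider z where "virt_adj G T x z" "virt_adj G T z y"
      | z w where "virt_adj G T x z" "virt_adj G T z w" "virt_adj G T w y"
      using upper verts_proper_virt_gen_graph by metis
    then show "\<exists>q. pre_digraph.awalk ?D x q y \<and> length q \<le> 3"
    proof cases
      case 1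
      then show ?thesis using xy
        by (intro exI [of _ "[(x, z), (z, y)]"]) (auto simp: awalk_proper_virt_gen_graph_iff)
    next
      case 2
      then show ?thesis using xy
        by (intro exI [of _ "[(x, z), (z, w), (w, y)]"])
          (auto simp: awalk_proper_virt_gen_graph_iff)
    qed
  qed
  moreover have "ereal (real 3) \<le> graph_diameter ?D"
  proof (rule graph_diameter_ge [OF wf])
    fix q assume q: "pre_digraph.awalk ?D u q v"
    show "3 \<le> length q"
    proof (rule ccontr)
      assume "\<not> 3 \<le> length q"
      then consider "q = []" | e where "q = [e]" | e f where "q = [e, f]"
        by (cases q; cases "tl q"; cases "tl (tl q)") auto
      then show False
        using q lower(3-5) by cases (auto simp: awalk_proper_virt_gen_graph_iff)
    qed
  qed (use virt_adj_in_verts(1) [OF lower(1)] virt_adj_in_verts(1) [OF lower(2)] in auto)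
  ultimately show ?thesis by simp
qed

section \<open>Open subgroups of split extensions\<close>

text \<open>The lattice is kept as an abstract abelian group because the three lattices are
  constructed in quite different ways. The number \<open>p\<close> enters through the topology only;
  p-adic scalars are brought in later by \<open>translation_part_scale\<close>.\<close>

locale lattice_extension = N: comm_group N + H: group H
  for N :: "('a, 'm) monoid_scheme" (structure) and H :: "('b, 'n) monoid_scheme"
    and act :: "'b \<Rightarrow> 'a \<Rightarrow> 'a" and p :: nat +
  assumes act_closed [simp, intro]: "h \<in> carrier H \<Longrightarrow> v \<in> carrier N \<Longrightarrow> act h v \<in> carrier N"
    and act_mult: "h \<in> carrier H \<Longrightarrow> v \<in> carrier N \<Longrightarrow> w \<in> carrier N \<Longrightarrow>
      act h (v \<otimes> w) = act h v \<otimes> act h w"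
    and act_comp: "g \<in> carrier H \<Longrightarrow> h \<in> carrier H \<Longrightarrow> v \<in> carrier N \<Longrightarrow>
      act (g \<otimes>\<^bsub>H\<^esub> h) v = act g (act h v)"
    and act_one [simp]: "v \<in> carrier N \<Longrightarrow> act \<one>\<^bsub>H\<^esub> v = v"
begin

abbreviation "G \<equiv> semidirect N H act"
abbreviation "T \<equiv> lattice_extension_topology p N H"

lemma act_unit [simp]: "h \<in> carrier H \<Longrightarrow> act h \<one> = \<one>"
  using act_mult [of h \<one> \<one>] N.l_cancel_one' by (metis N.one_closed N.r_one act_closed)

lemma act_inv:
  assumes "h \<in> carrier H" "v \<in> carrier N"
  shows "act h (inv v) = inv (act h v)"
  using assms act_mult [of h "inv v" v] by (intro N.inv_equality [symmetric]) auto

lemma act_pow: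
  assumes "h \<in> carrier H" "v \<in> carrier N"
  shows "act h (v [^] (n::nat)) = act h v [^] n"
  using assms by (induction n) (auto simp: act_mult)

lemma act_inv_cancel [simp]:
  assumes "h \<in> carrier H" "v \<in> carrier N"
  shows "act h (act (inv\<^bsub>H\<^esub> h) v) = v" "act (inv\<^bsub>H\<^esub> h) (act h v) = v"
  using assms by (simp_all flip: act_comp)

lemma carrier_G [simp]: "carrier G = carrier N \<times> carrier H"
  and one_G [simp]: "\<one>\<^bsub>G\<^esub> = (\<one>, \<one>\<^bsub>H\<^esub>)"
  and mult_G [simp]: "(a, g) \<otimes>\<^bsub>G\<^esub> (b, h) = (a \<otimes> act g b, g \<otimes>\<^bsub>H\<^esub> h)"
  by (simp_all add: semidirect_def)

sublocale G: group G
proof (rule groupI)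
  fix x assume "x \<in> carrier G"
  then obtain a g where x: "x = (a, g)" "a \<in> carrier N" "g \<in> carrier H" by auto
  then have "(act (inv\<^bsub>H\<^esub> g) (inv a), inv\<^bsub>H\<^esub> g) \<otimes>\<^bsub>G\<^esub> x = \<one>\<^bsub>G\<^esub>"
    by (simp add: act_inv)
  then show "\<exists>y\<in>carrier G. y \<otimes>\<^bsub>G\<^esub> x = \<one>\<^bsub>G\<^esub>"
    using x by force
qed (auto simp: act_mult act_comp N.m_assoc H.m_assoc)

lemma inv_G:
  assumes "a \<in> carrier N" "g \<in> carrier H"
  shows "inv\<^bsub>G\<^esub> (a, g) = (act (inv\<^bsub>H\<^esub> g) (inv a), inv\<^bsub>H\<^esub> g)"
  using assms by (intro G.inv_equality) (auto simp: act_inv)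

text \<open>As \<open>H\<close> is discrete, the sets {v + p^n w} times {k} form a neighbourhood
  basis at (v, k). Such a coset is open because adding a further p^n-fold multiple does not leave
  it.\<close>

lemma openin_T:
  "openin T U \<longleftrightarrow> U \<subseteq> carrier G \<and>
     (\<forall>v k. (v, k) \<in> U \<longrightarrow> (\<exists>n. \<forall>w\<in>carrier N. (v \<otimes> w [^] (p ^ n), k) \<in> U))"
  (is "?L \<longleftrightarrow> ?R")
proof
  assume ?L
  then have *: "\<exists>A B. openin (padic_topology p N) A \<and> B \<subseteq> carrier H \<and> v \<in> A \<and> k \<in> B \<and> A \<times> B \<subseteq> U"
    if "(v, k) \<in> U" for v k
    using that by (auto simp: lattice_extension_topology_def openin_prod_topology_alt)
  show ?R
  proof (intro conjI allI impI)
    show "U \<subseteq> carrier G"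
      using * by (fastforce simp: openin_padic_topology [OF N.monoid_axioms])
    fix v k assume "(v, k) \<in> U"
    from * [OF this] show "\<exists>n. \<forall>w\<in>carrier N. (v \<otimes> w [^] (p ^ n), k) \<in> U"
      unfolding openin_padic_topology [OF N.monoid_axioms] by blast
  qed
next
  assume R: ?R
  have "\<exists>A B. openin (padic_topology p N) A \<and> B \<subseteq> carrier H \<and> v \<in> A \<and> k \<in> B \<and> A \<times> B \<subseteq> U"
    if vk: "(v, k) \<in> U" for v k
  proof -
    have c: "v \<in> carrier N" "k \<in> carrier H" using R vk by auto
    obtain n where n: "\<forall>w\<in>carrier N. (v \<otimes> w [^] (p ^ n), k) \<in> U"
      using R vk by blast
    define A where "A = {v \<otimes> w [^] (p ^ n) | w. w \<in> carrier N}"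
    have "openin (padic_topology p N) A"
      unfolding openin_padic_topology [OF N.monoid_axioms]
    proof (intro conjI ballI)
      show "A \<subseteq> carrier N" using c by (auto simp: A_def)
      fix x assume "x \<in> A"
      then obtain w where w: "w \<in> carrier N" "x = v \<otimes> w [^] (p ^ n)" by (auto simp: A_def)
      have "x \<otimes> y [^] (p ^ n) \<in> A" if "y \<in> carrier N" for y
        unfolding A_def using w that c
        by (auto intro!: exI [of _ "w \<otimes> y"] simp: N.nat_pow_distrib N.m_assoc)
      then show "\<exists>n. \<forall>y\<in>carrier N. x \<otimes> y [^] (p ^ n) \<in> A" by blast
    qed
    moreover have "v \<in> A"
      unfolding A_def using c by (auto intro!: exI [of _ \<one>])
    ultimately show ?thesis
      using c n by (intro exI [of _ A] exI [of _ "{k}"]) (auto simp: A_def)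
  qed
  then show ?L
    by (simp add: lattice_extension_topology_def openin_prod_topology_alt)
qed

lemma topspace_T [simp]: "topspace T = carrier G"
proof
  show "topspace T \<subseteq> carrier G"
    using openin_topspace [of T] openin_T by blast
  have "openin T (carrier G)"
    unfolding openin_T by auto
  then show "carrier G \<subseteq> topspace T"
    by (rule openin_subset)
qed

lemma in_closure_T:
  assumes "v \<in> carrier N" "k \<in> carrier H"
  shows "(v, k) \<in> T closure_of S \<longleftrightarrow> (\<forall>n. \<exists>w\<in>carrier N. (v \<otimes> w [^] (p ^ n), k) \<in> S)"
proof
  assume L: "(v, k) \<in> T closure_of S"
  show "\<forall>n. \<exists>w\<in>carrier N. (v \<otimes> w [^] (p ^ n), k) \<in> S"
  proof
    fix n
    define A where "A = {(v \<otimes> w [^] (p ^ n), k) | w. w \<in> carrier N}"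
    have "openin T A"
      unfolding openin_T
    proof (intro conjI allI impI)
      show "A \<subseteq> carrier G" using assms by (auto simp: A_def)
      fix x l assume "(x, l) \<in> A"
      then obtain w where w: "w \<in> carrier N" "x = v \<otimes> w [^] (p ^ n)" "l = k" by (auto simp: A_def)
      have "(x \<otimes> y [^] (p ^ n), l) \<in> A" if "y \<in> carrier N" for y
        unfolding A_def using w that assms
        by (auto intro!: exI [of _ "w \<otimes> y"] simp: N.nat_pow_distrib N.m_assoc)
      then show "\<exists>n. \<forall>y\<in>carrier N. (x \<otimes> y [^] (p ^ n), l) \<in> A" by blast
    qed
    moreover have "(v, k) \<in> A"
      unfolding A_def using assms by (auto intro!: exI [of _ \<one>])
    ultimately obtain y where "y \<in> S" "y \<in> A"
      using L unfolding in_closure_of by blast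
    then show "\<exists>w\<in>carrier N. (v \<otimes> w [^] (p ^ n), k) \<in> S"
      unfolding A_def by blast
  qed
next
  assume R: "\<forall>n. \<exists>w\<in>carrier N. (v \<otimes> w [^] (p ^ n), k) \<in> S"
  have "\<exists>y. y \<in> S \<and> y \<in> U" if U: "(v, k) \<in> U" "openin T U" for U
  proof -
    obtain n where "\<forall>w\<in>carrier N. (v \<otimes> w [^] (p ^ n), k) \<in> U"
      using U unfolding openin_T by blast
    then show ?thesis using R by blast
  qed
  moreover have "(v, k) \<in> topspace T" using assms by simp
  ultimately show "(v, k) \<in> T closure_of S"
    unfolding in_closure_of by blast
qed

section \<open>The translations in the closure of a subgroup\<close>

text \<open>By \<open>in_closure_T\<close> these are the \<open>v\<close> for which (v, 1) lies in
  the closure of \<open>S\<close>. The approximation is written out so that later computations take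
  place inside \<open>S\<close> itself.\<close>

definition translation_part :: "('a \<times> 'b) set \<Rightarrow> 'a set" where
  "translation_part S = {v \<in> carrier N. \<forall>m. \<exists>w\<in>carrier N. (v \<otimes> w [^] (p ^ m), \<one>\<^bsub>H\<^esub>) \<in> S}"

lemma translation_part_carrier: "v \<in> translation_part S \<Longrightarrow> v \<in> carrier N"
  by (simp add: translation_part_def)

text \<open>A neighbourhood of the identity consisting of translations can be moved to any point (u,
  k) of the closure: an approximation of the translation, multiplied from the left onto an
  approximation of (u, k), stays in \<open>S\<close>, and the two error terms combine into a single
  p^m-th power because \<open>N\<close> is abelian.\<close>

lemma openin_closure_iff:
  assumes S: "subgroup S G"
  shows "openin T (T closure_of S) \<longleftrightarrow> (\<exists>n. \<forall>v\<in>carrier N. v [^] (p ^ n) \<in> translation_part S)"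
    (is "?L \<longleftrightarrow> ?R")
proof
  assume ?L
  have "\<one>\<^bsub>G\<^esub> \<in> T closure_of S"
    using subgroup.one_closed [OF S] subgroup.subset [OF S] closure_of_subset
    by (metis subsetD topspace_T)
  then obtain n where n: "\<forall>w\<in>carrier N. (\<one> \<otimes> w [^] (p ^ n), \<one>\<^bsub>H\<^esub>) \<in> T closure_of S"
    using \<open>?L\<close> unfolding openin_T one_G by blast
  have "v [^] (p ^ n) \<in> translation_part S" if "v \<in> carrier N" for v
    using n that in_closure_T [of "v [^] (p ^ n)" "\<one>\<^bsub>H\<^esub>" S] by (simp add: translation_part_def)
  then show ?R by blast
next
  assume ?R
  then obtain n where n: "v [^] (p ^ n) \<in> translation_part S" if "v \<in> carrier N" for v by blast
  show ?L
    unfolding openin_T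
  proof (intro conjI allI impI)
    show "T closure_of S \<subseteq> carrier G"
      using closure_of_subset_topspace [of T S] by (simp only: topspace_T)
    fix u k assume uk: "(u, k) \<in> T closure_of S"
    then have c: "u \<in> carrier N" "k \<in> carrier H"
      using closure_of_subset_topspace [of T S] by (auto simp only: topspace_T carrier_G)
    have "(u \<otimes> v [^] (p ^ n), k) \<in> T closure_of S" if v: "v \<in> carrier N" for v
    proof -
      have "\<exists>z\<in>carrier N. (u \<otimes> v [^] (p ^ n) \<otimes> z [^] (p ^ m), k) \<in> S" for m
      proof -
        obtain w where w: "w \<in> carrier N" "(u \<otimes> w [^] (p ^ m), k) \<in> S"
          using uk in_closure_T [OF c] by blast
        obtain w' where w': "w' \<in> carrier N" "(v [^] (p ^ n) \<otimes> w' [^] (p ^ m), \<one>\<^bsub>H\<^esub>) \<in> S"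
          using n [OF v] by (auto simp: translation_part_def)
        have "(v [^] (p ^ n) \<otimes> w' [^] (p ^ m) \<otimes> (u \<otimes> w [^] (p ^ m)), k) \<in> S"
          using subgroup.m_closed [OF S w'(2) w(2)] c v w(1) w'(1) by simp
        moreover have "v [^] (p ^ n) \<otimes> w' [^] (p ^ m) \<otimes> (u \<otimes> w [^] (p ^ m)) =
            u \<otimes> v [^] (p ^ n) \<otimes> (w \<otimes> w') [^] (p ^ m)"
          using c v w(1) w'(1) by (simp add: N.nat_pow_distrib N.m_ac)
        ultimately show ?thesis
          using w(1) w'(1) by (auto intro: bexI [of _ "w \<otimes> w'"])
      qed
      then show ?thesis
        using in_closure_T [of "u \<otimes> v [^] (p ^ n)" k S] c v by simp
    qed
    then show "\<exists>n. \<forall>v\<in>carrier N. (u \<otimes> v [^] (p ^ n), k) \<in> T closure_of S" by blast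
  qed
qed

lemma translation_part_incl:
  assumes "v \<in> carrier N" "(v, \<one>\<^bsub>H\<^esub>) \<in> S"
  shows "v \<in> translation_part S"
  using assms unfolding translation_part_def by (auto intro!: bexI [of _ \<one>])

lemma translation_part_mult:
  assumes S: "subgroup S G" and "v \<in> translation_part S" "v' \<in> translation_part S"
  shows "v \<otimes> v' \<in> translation_part S"
proof -
  have c: "v \<in> carrier N" "v' \<in> carrier N" using assms translation_part_carrier by auto
  have "\<exists>w\<in>carrier N. (v \<otimes> v' \<otimes> w [^] (p ^ m), \<one>\<^bsub>H\<^esub>) \<in> S" for m
  proof -
    obtain w where w: "w \<in> carrier N" "(v \<otimes> w [^] (p ^ m), \<one>\<^bsub>H\<^esub>) \<in> S"
      using assms(2) by (auto simp: translation_part_def)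
    obtain w' where w': "w' \<in> carrier N" "(v' \<otimes> w' [^] (p ^ m), \<one>\<^bsub>H\<^esub>) \<in> S"
      using assms(3) by (auto simp: translation_part_def)
    have "(v \<otimes> w [^] (p ^ m) \<otimes> (v' \<otimes> w' [^] (p ^ m)), \<one>\<^bsub>H\<^esub>) \<in> S"
      using subgroup.m_closed [OF S w(2) w'(2)] c w w' by simp
    moreover have "v \<otimes> w [^] (p ^ m) \<otimes> (v' \<otimes> w' [^] (p ^ m)) =
        v \<otimes> v' \<otimes> (w \<otimes> w') [^] (p ^ m)"
      using c w(1) w'(1) by (simp add: N.nat_pow_distrib N.m_ac)
    ultimately show ?thesis
      using w(1) w'(1) by (auto intro: bexI [of _ "w \<otimes> w'"])
  qed
  then show ?thesis
    using c by (simp add: translation_part_def)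
qed

lemma translation_part_one: "subgroup S G \<Longrightarrow> \<one> \<in> translation_part S"
  using translation_part_incl [of \<one> S] subgroup.one_closed [of S G] by simp

lemma translation_part_inv:
  assumes S: "subgroup S G" and "v \<in> translation_part S"
  shows "inv v \<in> translation_part S"
proof -
  have c: "v \<in> carrier N" using assms translation_part_carrier by auto
  have "\<exists>w\<in>carrier N. (inv v \<otimes> w [^] (p ^ m), \<one>\<^bsub>H\<^esub>) \<in> S" for m
  proof -
    obtain w where w: "w \<in> carrier N" "(v \<otimes> w [^] (p ^ m), \<one>\<^bsub>H\<^esub>) \<in> S"
      using assms(2) by (auto simp: translation_part_def)
    have "(inv (v \<otimes> w [^] (p ^ m)), \<one>\<^bsub>H\<^esub>) \<in> S"
      using subgroup.m_inv_closed [OF S w(2)] c w by (simp add: inv_G)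
    moreover have "inv (v \<otimes> w [^] (p ^ m)) = inv v \<otimes> (inv w) [^] (p ^ m)"
      using c w(1) by (simp add: N.inv_mult N.nat_pow_inv)
    ultimately show ?thesis
      using w(1) by (auto intro: bexI [of _ "inv w"])
  qed
  then show ?thesis
    using c by (simp add: translation_part_def)
qed

lemma translation_part_nat_pow:
  assumes S: "subgroup S G" and "v \<in> translation_part S"
  shows "v [^] (n::nat) \<in> translation_part S"
  using assms by (induction n) (auto intro: translation_part_mult translation_part_one)

text \<open>Conjugation by (b, h) sends the translation by x to the translation by h x; the
  contribution of b cancels in the abelian group \<open>N\<close>.\<close>

lemma translation_part_act:
  assumes S: "subgroup S G" and "v \<in> translation_part S" "(b, h) \<in> S"
  shows "act h v \<in> translation_part S"
proof -
  have c: "v \<in> carrier N" using assms translation_part_carrier by auto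
  have bh: "b \<in> carrier N" "h \<in> carrier H" using subgroup.subset [OF S] assms(3) by auto
  have "\<exists>w\<in>carrier N. (act h v \<otimes> w [^] (p ^ m), \<one>\<^bsub>H\<^esub>) \<in> S" for m
  proof -
    obtain w where w: "w \<in> carrier N" "(v \<otimes> w [^] (p ^ m), \<one>\<^bsub>H\<^esub>) \<in> S"
      using assms(2) by (auto simp: translation_part_def)
    have "(b, h) \<otimes>\<^bsub>G\<^esub> (v \<otimes> w [^] (p ^ m), \<one>\<^bsub>H\<^esub>) \<otimes>\<^bsub>G\<^esub> inv\<^bsub>G\<^esub> (b, h) \<in> S"
      using S w(2) assms(3) by (simp only: subgroup.m_closed subgroup.m_inv_closed)
    moreover have "b \<otimes> x \<otimes> inv b = x" if "x \<in> carrier N" for x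
      using bh that by (simp add: N.m_comm [of b x] N.m_assoc)
    then have "(b, h) \<otimes>\<^bsub>G\<^esub> (v \<otimes> w [^] (p ^ m), \<one>\<^bsub>H\<^esub>) \<otimes>\<^bsub>G\<^esub> inv\<^bsub>G\<^esub> (b, h) =
        (act h v \<otimes> act h w [^] (p ^ m), \<one>\<^bsub>H\<^esub>)"
      using c bh w(1) by (simp add: inv_G act_mult act_pow)
    ultimately show ?thesis
      using w(1) bh by (intro bexI [of _ "act h w"]) auto
  qed
  then show ?thesis
    using c bh by (simp add: translation_part_def)
qed

text \<open>The error of approximating v by u and that of approximating u inside \<open>S\<close>
  are both p^m-th powers and merge into one. This is what allows passing from integer to p-adic
  multiples.\<close>

lemma translation_part_closed:
  assumes S: "subgroup S G" and v: "v \<in> carrier N"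
    and approx: "\<And>m. \<exists>u\<in>translation_part S. \<exists>w\<in>carrier N. v = u \<otimes> w [^] (p ^ m)"
  shows "v \<in> translation_part S"
proof -
  have "\<exists>w\<in>carrier N. (v \<otimes> w [^] (p ^ m), \<one>\<^bsub>H\<^esub>) \<in> S" for m
  proof -
    obtain u w where u: "u \<in> translation_part S" "w \<in> carrier N" "v = u \<otimes> w [^] (p ^ m)"
      using approx by blast
    then have "u \<in> carrier N" using translation_part_carrier by auto
    obtain w' where w': "w' \<in> carrier N" "(u \<otimes> w' [^] (p ^ m), \<one>\<^bsub>H\<^esub>) \<in> S"
      using u(1) by (auto simp: translation_part_def)
    have "v \<otimes> (inv w \<otimes> w') [^] (p ^ m) = u \<otimes> w' [^] (p ^ m)"
      using u(2) \<open>u \<in> carrier N\<close> w'(1) unfolding u(3)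
      by (simp add: N.nat_pow_distrib N.nat_pow_inv N.m_assoc)
        (simp add: N.m_assoc [symmetric])
    then show ?thesis
      using w' u(2) by (auto intro!: bexI [of _ "inv w \<otimes> w'"])
  qed
  then show ?thesis
    using v by (simp add: translation_part_def)
qed

section \<open>Common fixed points as an obstruction to adjacency\<close>

definition padic_closed :: "'a set \<Rightarrow> bool" where
  "padic_closed A \<longleftrightarrow>
     (\<forall>v\<in>carrier N. (\<forall>m. \<exists>w\<in>carrier N. v \<otimes> w [^] (p ^ m) \<in> A) \<longrightarrow> v \<in> A)"

text \<open>Modulo \<open>A\<close> the point \<open>u / k\<close> is fixed under the affine action of both generators, hence
  under the whole subgroup, which therefore contains no translations outside \<open>A\<close>.\<close>

lemma not_virt_adj_if_fixed_point:
  fixes k :: nat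
  assumes A: "subgroup A N" "padic_closed A"
    and not_open: "\<And>n. \<exists>v\<in>carrier N. v [^] (p ^ n) \<notin> A"
    and torsion: "\<And>v. v \<in> carrier N \<Longrightarrow> v [^] k \<in> A \<Longrightarrow> v \<in> A"
    and u: "u \<in> carrier N"
    and stab: "\<And>v. v \<in> carrier N \<Longrightarrow> act g v \<in> A \<longleftrightarrow> v \<in> A"
      "\<And>v. v \<in> carrier N \<Longrightarrow> act h v \<in> A \<longleftrightarrow> v \<in> A"
    and fixed: "a [^] k \<otimes> act g u \<otimes> inv u \<in> A" "b [^] k \<otimes> act h u \<otimes> inv u \<in> A"
  shows "\<not> virt_adj G T (a, g) (b, h)"
proof
  assume adj: "virt_adj G T (a, g) (b, h)"
  then have c: "a \<in> carrier N" "g \<in> carrier H" "b \<in> carrier N" "h \<in> carrier H"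
    by (auto simp: virt_adj_def)
  \<comment> \<open>Additively the last condition reads k v + l u - u in A, that is, the affine map
    x -> v + l x fixes u / k modulo A.\<close>
  define S where "S = {(v, l). v \<in> carrier N \<and> l \<in> carrier H \<and>
      (\<forall>w\<in>carrier N. act l w \<in> A \<longleftrightarrow> w \<in> A) \<and> v [^] k \<otimes> act l u \<otimes> inv u \<in> A}"
  have A_m: "x \<otimes> y \<in> A" if "x \<in> A" "y \<in> A" for x y
    using A(1) that by (rule subgroup.m_closed)
  have A_inv: "inv x \<in> A" if "x \<in> A" for x
    using A(1) that by (rule subgroup.m_inv_closed)
  have rearrange: "x \<otimes> y \<otimes> z \<otimes> (x' \<otimes> w \<otimes> y') = x \<otimes> x' \<otimes> w \<otimes> z \<otimes> (y \<otimes> y')"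
    if "x \<in> carrier N" "y \<in> carrier N" "z \<in> carrier N" "w \<in> carrier N"
      "x' \<in> carrier N" "y' \<in> carrier N" for x y z w x' y'
    using that by (simp add: N.m_ac)
  have "subgroup S G"
  proof (rule G.subgroupI)
    show "S \<subseteq> carrier G" by (auto simp: S_def)
    have "\<one>\<^bsub>G\<^esub> \<in> S"
      using u subgroup.one_closed [OF A(1)] by (simp add: S_def)
    then show "S \<noteq> {}" by blast
    fix x y assume xS: "x \<in> S" and yS: "y \<in> S"
    from xS obtain v l where x: "x = (v, l)" "v \<in> carrier N" "l \<in> carrier H"
        "\<And>w. w \<in> carrier N \<Longrightarrow> act l w \<in> A \<longleftrightarrow> w \<in> A" "v [^] k \<otimes> act l u \<otimes> inv u \<in> A"
      by (auto simp: S_def)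
    from yS obtain v' l' where y: "y = (v', l')" "v' \<in> carrier N" "l' \<in> carrier H"
        "\<And>w. w \<in> carrier N \<Longrightarrow> act l' w \<in> A \<longleftrightarrow> w \<in> A" "v' [^] k \<otimes> act l' u \<otimes> inv u \<in> A"
      by (auto simp: S_def)
    \<comment> \<open>The condition for the second factor is transported by \<open>l\<close>, which
      stabilizes \<open>A\<close>, and added to the first one; the inner terms
      \<open>act l u\<close> cancel and the condition for the product remains.\<close>
    have "act l (v' [^] k \<otimes> act l' u \<otimes> inv u) \<in> A"
      using x y u by simp
    then have "v [^] k \<otimes> act l u \<otimes> inv u \<otimes> act l (v' [^] k \<otimes> act l' u \<otimes> inv u) \<in> A"
      using x(5) A_m by blast
    also have "v [^] k \<otimes> act l u \<otimes> inv u \<otimes> act l (v' [^] k \<otimes> act l' u \<otimes> inv u) =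
        v [^] k \<otimes> act l u \<otimes> inv u \<otimes> (act l v' [^] k \<otimes> act (l \<otimes>\<^bsub>H\<^esub> l') u \<otimes> inv (act l u))"
      using x(2,3) y(2,3) u by (simp add: act_mult act_pow act_comp act_inv)
    also have "\<dots> = v [^] k \<otimes> act l v' [^] k \<otimes> act (l \<otimes>\<^bsub>H\<^esub> l') u \<otimes> inv u \<otimes> (act l u \<otimes> inv (act l u))"
      using x(2,3) y(2,3) u by (intro rearrange) auto
    also have "\<dots> = (v \<otimes> act l v') [^] k \<otimes> act (l \<otimes>\<^bsub>H\<^esub> l') u \<otimes> inv u"
      using x(2,3) y(2,3) u by (simp add: N.nat_pow_distrib)
    finally show "x \<otimes>\<^bsub>G\<^esub> y \<in> S"
      using x y by (auto simp: S_def act_comp)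
    have l': "inv\<^bsub>H\<^esub> l \<in> carrier H" using x by simp
    have st: "act (inv\<^bsub>H\<^esub> l) w \<in> A \<longleftrightarrow> w \<in> A" if "w \<in> carrier N" for w
      using x(4) [of "act (inv\<^bsub>H\<^esub> l) w"] x(3) l' that by (simp del: H.inv_closed)
    have "inv (act (inv\<^bsub>H\<^esub> l) (v [^] k \<otimes> act l u \<otimes> inv u)) \<in> A"
      using st x(2,3,5) u by (intro A_inv) simp
    also have "inv (act (inv\<^bsub>H\<^esub> l) (v [^] k \<otimes> act l u \<otimes> inv u)) =
        (act (inv\<^bsub>H\<^esub> l) (inv v)) [^] k \<otimes> act (inv\<^bsub>H\<^esub> l) u \<otimes> inv u"
      using x(2,3) u
      by (simp add: act_mult act_pow act_inv N.inv_mult N.nat_pow_inv N.m_ac)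
    finally show "inv\<^bsub>G\<^esub> x \<in> S"
      using x(1-3) st by (simp add: inv_G S_def)
  qed
  moreover have "{(a, g), (b, h)} \<subseteq> S"
    using c stab fixed by (auto simp: S_def)
  ultimately have sub: "generate G {(a, g), (b, h)} \<subseteq> S"
    by (intro G.generate_subgroup_incl)
  \<comment> \<open>For a translation the linear part is trivial and u cancels, so the condition
    shrinks to v^k in A; saturation of \<open>A\<close> removes the exponent, and closedness removes
    the approximation.\<close>
  have "translation_part (generate G {(a, g), (b, h)}) \<subseteq> A"
  proof
    fix v assume v: "v \<in> translation_part (generate G {(a, g), (b, h)})"
    then have vc: "v \<in> carrier N" by (rule translation_part_carrier)
    have "\<exists>w\<in>carrier N. v \<otimes> w [^] (p ^ m) \<in> A" for m
    proof -
      obtain w where w: "w \<in> carrier N" "(v \<otimes> w [^] (p ^ m), \<one>\<^bsub>H\<^esub>) \<in> generate G {(a, g), (b, h)}"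
        using v by (auto simp: translation_part_def)
      then have "(v \<otimes> w [^] (p ^ m)) [^] k \<otimes> act \<one>\<^bsub>H\<^esub> u \<otimes> inv u \<in> A"
        using sub by (auto simp: S_def)
      then have "(v \<otimes> w [^] (p ^ m)) [^] k \<in> A"
        using u vc w(1) by (simp add: N.m_assoc)
      then show ?thesis using torsion vc w(1) by blast
    qed
    then show "v \<in> A"
      using A(2) vc by (simp add: padic_closed_def)
  qed
  moreover have "subgroup (generate G {(a, g), (b, h)}) G"
    using c by (intro G.generate_is_subgroup) auto
  ultimately show False
    using adj not_open unfolding virt_adj_def by (meson openin_closure_iff subsetD)
qed

text \<open>Only closure properties of the generated subgroup are ever used, so an arbitrary
  subgroup containing both elements takes its place.\<close>

lemma virt_adj_if_translation_part:
  assumes "a \<in> carrier N" "g \<in> carrier H" "b \<in> carrier N" "h \<in> carrier H"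
    and "\<And>S. subgroup S G \<Longrightarrow> (a, g) \<in> S \<Longrightarrow> (b, h) \<in> S \<Longrightarrow>
      \<exists>n. \<forall>v\<in>carrier N. v [^] (p ^ n) \<in> translation_part S"
  shows "virt_adj G T (a, g) (b, h)"
proof -
  have "subgroup (generate G {(a, g), (b, h)}) G"
    using assms by (intro G.generate_is_subgroup) auto
  moreover from this have "\<exists>n. \<forall>v\<in>carrier N. v [^] (p ^ n) \<in> translation_part (generate G {(a, g), (b, h)})"
    by (rule assms(5)) (auto intro: generate.incl)
  ultimately show ?thesis
    using assms(1-4) openin_closure_iff by (simp add: virt_adj_def)
qed

end

section \<open>Linear systems with more unknowns than equations\<close>

text \<open>Gaussian elimination without fractions. A row of zeros is dropped; otherwise a pivot
  \<open>A r l\<close> eliminates the unknown \<open>l\<close> from the other rows by cross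
  multiplication, leaving one equation and one unknown fewer.\<close>

lemma (in domain) exists_nontrivial_solution:
  fixes A :: "'i \<Rightarrow> 'j \<Rightarrow> 'a"
  assumes "finite I" "finite J" "card I < card J"
    and "\<And>i j. i \<in> I \<Longrightarrow> j \<in> J \<Longrightarrow> A i j \<in> carrier R"
  shows "\<exists>c\<in>J \<rightarrow> carrier R. (\<exists>j\<in>J. c j \<noteq> \<zero>) \<and> (\<forall>i\<in>I. (\<Oplus>j\<in>J. A i j \<otimes> c j) = \<zero>)"
  using assms
proof (induction I arbitrary: A J rule: finite_induct)
  case empty
  then have "J \<noteq> {}" by auto
  then show ?case
    by (intro bexI [of _ "\<lambda>_. \<one>"]) auto
next
  case (insert r I)
  show ?case
  proof (cases "\<forall>j\<in>J. A r j = \<zero>")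
    case True
    obtain c where c: "c \<in> J \<rightarrow> carrier R" "\<exists>j\<in>J. c j \<noteq> \<zero>"
        "\<forall>i\<in>I. (\<Oplus>j\<in>J. A i j \<otimes> c j) = \<zero>"
      using insert.IH [of J A] insert.prems insert.hyps by auto
    have "(\<Oplus>j\<in>J. A r j \<otimes> c j) = (\<Oplus>j\<in>J. \<zero>)"
      using c(1) True by (intro finsum_cong') (auto simp: Pi_iff)
    then show ?thesis
      using c by (intro bexI [of _ c]) auto
  next
    case False
    then obtain l where l: "l \<in> J" "A r l \<noteq> \<zero>" by blast
    define K where "K = J - {l}"
    have K: "finite K" "l \<notin> K" "J = insert l K" "card I < card K" "K \<subseteq> J"
      using l insert.prems insert.hyps by (auto simp: K_def)
    have A: "A i j \<in> carrier R" if "i \<in> insert r I" "j \<in> J" for i j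
      using insert.prems(3) that by blast
    define B where "B i j = A r l \<otimes> A i j \<ominus> A i l \<otimes> A r j" for i j
    obtain c where c: "c \<in> K \<rightarrow> carrier R" "\<exists>j\<in>K. c j \<noteq> \<zero>"
        "\<forall>i\<in>I. (\<Oplus>j\<in>K. B i j \<otimes> c j) = \<zero>"
      using insert.IH [of K B] K A l by (auto simp: B_def subset_iff)
    have ck: "c j \<in> carrier R" if "j \<in> K" for j using c(1) that by auto
    define s where "s = (\<Oplus>j\<in>K. A r j \<otimes> c j)"
    have sc: "s \<in> carrier R"
      unfolding s_def using A K ck by (intro finsum_closed) auto
    \<comment> \<open>Row \<open>r\<close> determines the unknown \<open>l\<close>. Scaling the
      other unknowns by the pivot avoids a division and keeps the solution nonzero, as there are no
      zero divisors.\<close>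
    define d where "d j = (if j = l then \<ominus> s else A r l \<otimes> c j)" for j
    have dc: "d \<in> J \<rightarrow> carrier R"
      using sc ck A l K by (auto simp: d_def)
    have split: "(\<Oplus>j\<in>J. A i j \<otimes> d j) = A i l \<otimes> (\<ominus> s) \<oplus> (\<Oplus>j\<in>K. A i j \<otimes> (A r l \<otimes> c j))"
      if i: "i \<in> insert r I" for i
    proof -
      have "(\<Oplus>j\<in>J. A i j \<otimes> d j) = A i l \<otimes> d l \<oplus> (\<Oplus>j\<in>K. A i j \<otimes> d j)"
        unfolding K(3) using K dc A i l by (subst finsum_insert) (auto simp: Pi_iff)
      moreover have "(\<Oplus>j\<in>K. A i j \<otimes> d j) = (\<Oplus>j\<in>K. A i j \<otimes> (A r l \<otimes> c j))"
        using K A i l ck by (intro finsum_cong') (auto simp: d_def)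
      ultimately show ?thesis by (simp add: d_def)
    qed
    have "(\<Oplus>j\<in>J. A i j \<otimes> d j) = \<zero>" if i: "i \<in> insert r I" for i
    proof (cases "i = r")
      case True
      have "(\<Oplus>j\<in>K. A r j \<otimes> (A r l \<otimes> c j)) = (\<Oplus>j\<in>K. A r l \<otimes> (A r j \<otimes> c j))"
        using K A l ck by (intro finsum_cong') (auto simp: m_lcomm)
      also have "\<dots> = A r l \<otimes> s"
        unfolding s_def using K A l ck by (subst finsum_rdistr) auto
      finally show ?thesis
        using split [of r] True A l sc by (simp add: r_minus l_neg)
    next
      case False
      then have iI: "i \<in> I" using i by simp
      have "(\<Oplus>j\<in>K. A i j \<otimes> (A r l \<otimes> c j)) = (\<Oplus>j\<in>K. B i j \<otimes> c j \<oplus> A i l \<otimes> (A r j \<otimes> c j))"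
      proof (rule finsum_cong')
        fix j assume j: "j \<in> K"
        have "A i j \<in> carrier R" "A i l \<in> carrier R" "A r j \<in> carrier R" "A r l \<in> carrier R"
          "c j \<in> carrier R" using A i l K(5) j ck by auto
        then show "A i j \<otimes> (A r l \<otimes> c j) = B i j \<otimes> c j \<oplus> A i l \<otimes> (A r j \<otimes> c j)"
          unfolding B_def by algebra
      qed (use A i l K ck in \<open>auto simp: B_def\<close>)
      also have "\<dots> = (\<Oplus>j\<in>K. B i j \<otimes> c j) \<oplus> (\<Oplus>j\<in>K. A i l \<otimes> (A r j \<otimes> c j))"
        using A i l K ck by (intro finsum_addf) (auto simp: B_def)
      also have "\<dots> = A i l \<otimes> s"
        unfolding s_def using c(3) iI K A i l ck by (subst finsum_rdistr) auto
      finally show ?thesis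
        using split [OF i] A i l sc by (simp add: r_minus l_neg)
    qed
    moreover have "\<exists>j\<in>J. d j \<noteq> \<zero>"
    proof -
      obtain j where j: "j \<in> K" "c j \<noteq> \<zero>" using c(2) by blast
      then have "d j \<noteq> \<zero>"
        using l A K ck by (auto simp: d_def integral_iff)
      then show ?thesis using j K by blast
    qed
    ultimately show ?thesis using dc by blast
  qed
qed

section \<open>The ring of p-adic integers\<close>

lemma Zp_carrier_iff:
  "x \<in> carrier (Zp p) \<longleftrightarrow>
     (\<forall>n. 0 \<le> x n \<and> x n < int p ^ Suc n \<and> x (Suc n) mod int p ^ Suc n = x n)"
  by (auto simp: Zp_def residue_ring_def)

lemma Zp_mult: "x \<otimes>\<^bsub>Zp p\<^esub> y = (\<lambda>n. x n * y n mod int p ^ Suc n)"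
  and Zp_add: "x \<oplus>\<^bsub>Zp p\<^esub> y = (\<lambda>n. (x n + y n) mod int p ^ Suc n)"
  and Zp_one: "\<one>\<^bsub>Zp p\<^esub> = (\<lambda>_. 1)"
  and Zp_zero: "\<zero>\<^bsub>Zp p\<^esub> = (\<lambda>_. 0)"
  by (simp_all add: Zp_def residue_ring_def)

text \<open>Turns a coherent sequence of arbitrary integers into its canonical representatives;
  index n belongs to the modulus p^(n+1).\<close>

definition Zp_of_seq :: "nat \<Rightarrow> (nat \<Rightarrow> int) \<Rightarrow> nat \<Rightarrow> int" where
  "Zp_of_seq p f n = f n mod int p ^ Suc n"

lemma cong_imp_cong_power_Suc:
  "[a = b] (mod int p ^ Suc (Suc n)) \<Longrightarrow> [a = b] (mod int p ^ Suc n)"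
  by (erule cong_dvd_modulus) (simp add: le_imp_power_dvd)

lemma Zp_of_seq_closed:
  assumes "p > 0" "\<And>n. [f (Suc n) = f n] (mod int p ^ Suc n)"
  shows "Zp_of_seq p f \<in> carrier (Zp p)"
  unfolding Zp_carrier_iff
proof (intro allI conjI)
  fix n
  have "int p ^ Suc n dvd int p ^ Suc (Suc n)" by (simp add: le_imp_power_dvd)
  then show "Zp_of_seq p f (Suc n) mod int p ^ Suc n = Zp_of_seq p f n"
    using assms(2) [of n] by (simp only: Zp_of_seq_def mod_mod_cancel cong_def)
qed (use assms(1) in \<open>simp_all add: Zp_of_seq_def del: power_Suc\<close>)

lemma Zp_carrier_cong:
  assumes "x \<in> carrier (Zp p)"
  shows "[x (Suc n) = x n] (mod int p ^ Suc n)"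
  using assms mod_mod_trivial [of "x (Suc n)" "int p ^ Suc n"]
  unfolding Zp_carrier_iff cong_def by metis

lemma Zp_carrier_mod [simp]:
  assumes "x \<in> carrier (Zp p)"
  shows "x n mod (int p * int p ^ n) = x n"
  using assms by (auto simp: Zp_carrier_iff)

lemma Zp_carrier_mod_le:
  assumes "x \<in> carrier (Zp p)" "m \<le> n"
  shows "x n mod int p ^ Suc m = x m"
  using assms(2)
proof (induction n rule: dec_induct)
  case base
  then show ?case using assms(1) by simp
next
  case (step n)
  have "x (Suc n) mod int p ^ Suc m = x (Suc n) mod int p ^ Suc n mod int p ^ Suc m"
    using step by (simp add: mod_mod_cancel le_imp_power_dvd del: power_Suc)
  then show ?case
    using step assms(1) by (simp add: Zp_carrier_iff del: power_Suc)
qed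

locale padic =
  fixes p :: nat
  assumes prime_p: "Factorial_Ring.prime p"
begin

abbreviation Z where "Z \<equiv> Zp p"

lemma p_gt_1: "int p > 1"
  using prime_gt_1_nat [OF prime_p] by simp

lemma p_pow_gt_1: "1 < int p * int p ^ n"
  using p_gt_1 by (metis one_less_power power_Suc zero_less_Suc)

lemma Zp_of_seq_in_Zp:
  "(\<And>n. [f (Suc n) = f n] (mod int p ^ Suc n)) \<Longrightarrow> Zp_of_seq p f \<in> carrier Z"
  using p_gt_1 by (intro Zp_of_seq_closed) auto

lemma Zp_cring: "cring Z"
proof (rule cringI)
  have closed: "(\<lambda>n. f (x n) (y n) mod int p ^ Suc n) \<in> carrier Z"
    if "x \<in> carrier Z" "y \<in> carrier Z"
      and "\<And>n. [f (x (Suc n)) (y (Suc n)) = f (x n) (y n)] (mod int p ^ Suc n)" for f x y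
    using Zp_of_seq_in_Zp [of "\<lambda>n. f (x n) (y n)"] that(3)
    by (simp add: Zp_of_seq_def [abs_def])
  have one: "\<one>\<^bsub>Z\<^esub> \<in> carrier Z" "\<zero>\<^bsub>Z\<^esub> \<in> carrier Z"
    using p_pow_gt_1 p_gt_1 by (simp_all add: Zp_carrier_iff Zp_one Zp_zero)
  show "abelian_group Z"
  proof (rule abelian_groupI)
    fix x y assume x: "x \<in> carrier Z" and y: "y \<in> carrier Z"
    show "x \<oplus>\<^bsub>Z\<^esub> y \<in> carrier Z"
      unfolding Zp_add by (rule closed [OF x y, of "(+)"]) (intro cong_add Zp_carrier_cong x y)
    have "(\<lambda>n. (- x n) mod int p ^ Suc n) \<in> carrier Z"
      by (rule closed [OF x x, of "\<lambda>a b. - a"]) (simp only: cong_minus_minus_iff Zp_carrier_cong [OF x])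
    moreover have "(\<lambda>n. (- x n) mod int p ^ Suc n) \<oplus>\<^bsub>Z\<^esub> x = \<zero>\<^bsub>Z\<^esub>"
      by (auto simp: Zp_add Zp_zero mod_simps)
    ultimately show "\<exists>y\<in>carrier Z. y \<oplus>\<^bsub>Z\<^esub> x = \<zero>\<^bsub>Z\<^esub>" by blast
  qed (auto simp: Zp_add Zp_zero one [unfolded Zp_one Zp_zero] mod_simps add_ac)
  show "comm_monoid Z"
  proof (rule comm_monoidI)
    fix x y assume x: "x \<in> carrier Z" and y: "y \<in> carrier Z"
    show "x \<otimes>\<^bsub>Z\<^esub> y \<in> carrier Z"
      unfolding Zp_mult by (rule closed [OF x y, of "(*)"]) (intro cong_mult Zp_carrier_cong x y)
  qed (auto simp: Zp_mult Zp_one one [unfolded Zp_one Zp_zero] mod_simps mult_ac)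
qed (auto simp: Zp_mult Zp_add mod_simps algebra_simps)

sublocale R: cring Z by (rule Zp_cring)

lemma minus_Zp:
  assumes "x \<in> carrier Z"
  shows "\<ominus>\<^bsub>Z\<^esub> x = (\<lambda>n. (- x n) mod int p ^ Suc n)"
proof (rule R.minus_equality)
  show "(\<lambda>n. (- x n) mod int p ^ Suc n) \<in> carrier Z"
    using Zp_of_seq_in_Zp [of "\<lambda>n. - x n"] Zp_carrier_cong [OF assms]
    by (simp add: Zp_of_seq_def [abs_def] cong_minus_minus_iff del: power_Suc)
qed (use assms in \<open>auto simp: Zp_add Zp_zero mod_simps\<close>)

lemma diff_Zp:
  assumes "x \<in> carrier Z" "y \<in> carrier Z"
  shows "x \<ominus>\<^bsub>Z\<^esub> y = (\<lambda>n. (x n - y n) mod int p ^ Suc n)"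
  using assms by (auto simp: a_minus_def minus_Zp Zp_add mod_simps)

lemma add_pow_Zp:
  assumes "x \<in> carrier Z"
  shows "[(k::nat)] \<cdot>\<^bsub>Z\<^esub> x = (\<lambda>n. (int k * x n) mod int p ^ Suc n)"
proof (induction k)
  case 0
  then show ?case by (simp add: Zp_zero)
next
  case (Suc k)
  then show ?case
    using assms by (auto simp: Zp_add mod_simps algebra_simps)
qed

lemma add_pow_one_Zp: "[(k::nat)] \<cdot>\<^bsub>Z\<^esub> \<one>\<^bsub>Z\<^esub> = (\<lambda>n. int k mod int p ^ Suc n)"
  unfolding add_pow_Zp [OF R.one_closed] by (simp add: Zp_one)

text \<open>With these formulas and \<open>mod_simps\<close> a polynomial identity over the p-adic
  integers becomes an integer identity modulo p^(n+1) at each index.\<close>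

lemma Zp_apply:
  "\<one>\<^bsub>Z\<^esub> n = 1" "\<zero>\<^bsub>Z\<^esub> n = 0"
  "(x \<otimes>\<^bsub>Z\<^esub> y) n = x n * y n mod int p ^ Suc n"
  "(x \<oplus>\<^bsub>Z\<^esub> y) n = (x n + y n) mod int p ^ Suc n"
  "x \<in> carrier Z \<Longrightarrow> (\<ominus>\<^bsub>Z\<^esub> x) n = (- x n) mod int p ^ Suc n"
  "x \<in> carrier Z \<Longrightarrow> y \<in> carrier Z \<Longrightarrow> (x \<ominus>\<^bsub>Z\<^esub> y) n = (x n - y n) mod int p ^ Suc n"
  "x \<in> carrier Z \<Longrightarrow> ([(k::nat)] \<cdot>\<^bsub>Z\<^esub> x) n = (int k * x n) mod int p ^ Suc n"
  by (simp_all add: Zp_one Zp_zero Zp_mult Zp_add minus_Zp diff_Zp add_pow_Zp)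

text \<open>Index 0 holds the residue modulo p. If it is nonzero, every component is invertible
  modulo its own prime power, and the inverses are coherent because inverses modulo p^(n+1) are
  unique.\<close>

lemma unit_if_residue_nonzero:
  assumes x: "x \<in> carrier Z" and "x 0 \<noteq> 0"
  shows "x \<in> Units Z"
proof -
  have "coprime (x n) (int p)" for n
  proof -
    have "x n mod int p = x 0"
      using Zp_carrier_mod_le [OF x, of 0 n] by simp
    then have "\<not> int p dvd x n" using assms(2) by auto
    then show ?thesis
      using prime_imp_coprime [of "int p" "x n"] prime_p by (simp add: coprime_commute)
  qed
  then have cop: "coprime (x n) (int p ^ Suc n)" for n
    by (simp del: power_Suc)
  have "\<forall>n. \<exists>y. [x n * y = 1] (mod int p ^ Suc n)"
    using cong_solve_coprime_int [OF cop] by blast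
  then obtain y where y: "[x n * y n = 1] (mod int p ^ Suc n)" for n
    unfolding choice_iff by blast
  have "[y (Suc n) = y n] (mod int p ^ Suc n)" for n
  proof -
    have "[x (Suc n) * y (Suc n) = 1] (mod int p ^ Suc n)"
      using y [of "Suc n"] by (rule cong_imp_cong_power_Suc)
    then have "[x n * y (Suc n) = 1] (mod int p ^ Suc n)"
      using Zp_carrier_cong [OF x, of n] by (meson cong_scalar_right cong_sym cong_trans)
    then have "[x n * y (Suc n) = x n * y n] (mod int p ^ Suc n)"
      using y [of n] by (meson cong_sym cong_trans)
    then show ?thesis
      using cop [of n] by (simp add: cong_mult_lcancel del: power_Suc)
  qed
  then have c: "Zp_of_seq p y \<in> carrier Z"
    by (rule Zp_of_seq_in_Zp)
  have "x n * y n mod int p ^ Suc n = 1" for n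
    using y [of n] p_pow_gt_1 [of n] by (simp add: cong_def)
  then have "x \<otimes>\<^bsub>Z\<^esub> Zp_of_seq p y = \<one>\<^bsub>Z\<^esub>"
    by (simp add: Zp_mult Zp_one Zp_of_seq_def mod_simps)
  then show ?thesis
    using x c R.m_comm [OF x c] by (auto simp: Units_def)
qed

text \<open>The component with index \<open>k\<close> is the residue modulo p^(k+1), whence the
  exponent \<open>Suc k\<close>. The last conclusion gives the residue of the quotient modulo p,
  from which one sees whether it is a unit.\<close>

lemma divisible_if_residue_zero:
  assumes x: "x \<in> carrier Z" and "x k = 0"
  obtains w where "w \<in> carrier Z" "x = [(p ^ Suc k)] \<cdot>\<^bsub>Z\<^esub> w" "w 0 = x (Suc k) div int p ^ Suc k"
proof -
  define w where "w n = x (n + Suc k) div int p ^ Suc k" for n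
  have dvd: "int p ^ Suc k dvd x (n + Suc k)" for n
    using Zp_carrier_mod_le [OF x, of k "n + Suc k"] assms(2) by auto
  have eq: "x (n + Suc k) = int p ^ Suc k * w n" for n
    unfolding w_def using dvd by (simp del: power_Suc)
  have pos: "0 < int p ^ j" for j using p_gt_1 by simp
  have "w \<in> carrier Z"
    unfolding Zp_carrier_iff
  proof (intro allI conjI)
    fix n
    have b: "0 \<le> x (n + Suc k)" "x (n + Suc k) < int p ^ Suc (n + Suc k)"
      using x unfolding Zp_carrier_iff by blast+
    then show "0 \<le> w n" using pos [of "Suc k"] by (simp add: w_def pos_imp_zdiv_nonneg_iff del: power_Suc)
    have "int p ^ Suc k * w n < int p ^ Suc k * int p ^ Suc n"
      using b(2) unfolding eq by (simp add: power_add mult_ac)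
    then show "w n < int p ^ Suc n" using pos [of "Suc k"] by (simp del: power_Suc)
    have "x (Suc (n + Suc k)) mod int p ^ Suc (n + Suc k) = x (n + Suc k)"
      using x unfolding Zp_carrier_iff by blast
    then have "(int p ^ Suc k * w (Suc n)) mod (int p ^ Suc k * int p ^ Suc n) = int p ^ Suc k * w n"
      using eq [of "Suc n"] eq [of n] by (simp add: power_add mult_ac)
    then show "w (Suc n) mod int p ^ Suc n = w n"
      using pos [of "Suc k"] by (simp add: mod_mult_mult1 del: power_Suc)
  qed
  moreover have "x = [(p ^ Suc k)] \<cdot>\<^bsub>Z\<^esub> w"
  proof
    fix n
    have "x n = x (n + Suc k) mod int p ^ Suc n"
      using Zp_carrier_mod_le [OF x, of n "n + Suc k"] by simp
    also have "\<dots> = (int p ^ Suc k * (w n mod int p ^ Suc n)) mod int p ^ Suc n"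
      unfolding eq by (simp add: mod_simps del: power_Suc)
    finally show "x n = ([(p ^ Suc k)] \<cdot>\<^bsub>Z\<^esub> w) n"
      using \<open>w \<in> carrier Z\<close> by (simp add: add_pow_Zp)
  qed
  ultimately show ?thesis
    using that by (simp add: w_def)
qed

lemma eq_p_power_times_unit:
  assumes x: "x \<in> carrier Z" and "x \<noteq> \<zero>\<^bsub>Z\<^esub>"
  obtains k w where "w \<in> Units Z" "x = [(p ^ k)] \<cdot>\<^bsub>Z\<^esub> w"
proof -
  obtain n where n: "x n \<noteq> 0"
    using assms(2) by (auto simp: Zp_zero)
  \<comment> \<open>Since index n stands for the modulus p^(n+1), this is exactly the p-adic
    valuation of x.\<close>
  define k where "k = (LEAST n. x n \<noteq> 0)"
  have k: "x k \<noteq> 0" "\<And>j. j < k \<Longrightarrow> x j = 0"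
    unfolding k_def using n LeastI [of "\<lambda>n. x n \<noteq> 0"] not_less_Least by blast+
  show ?thesis
  proof (cases k)
    case 0
    then show ?thesis
      using that [of x 0] unit_if_residue_nonzero [OF x] k x by simp
  next
    case (Suc j)
    then obtain w where w: "w \<in> carrier Z" "x = [(p ^ k)] \<cdot>\<^bsub>Z\<^esub> w" "w 0 = x k div int p ^ k"
      using divisible_if_residue_zero [OF x, of j] k by auto
    have "x k mod int p ^ k = 0"
      using Zp_carrier_mod_le [OF x, of j k] k Suc by auto
    then have "w 0 \<noteq> 0"
      using w(3) k(1) by auto
    then show ?thesis
      using that [of w k] w unit_if_residue_nonzero by blast
  qed
qed

text \<open>A substitute for division: nonzero elements are invertible up to a power of p, which is
  all that openness of a sublattice asks for.\<close>

lemma p_power_eq_multiple: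
  assumes x: "x \<in> carrier Z" and "x \<noteq> \<zero>\<^bsub>Z\<^esub>"
  obtains y k where "y \<in> carrier Z" "y \<otimes>\<^bsub>Z\<^esub> x = [(p ^ k)] \<cdot>\<^bsub>Z\<^esub> \<one>\<^bsub>Z\<^esub>"
proof -
  obtain k w where w: "w \<in> Units Z" "x = [(p ^ k)] \<cdot>\<^bsub>Z\<^esub> w"
    using eq_p_power_times_unit assms .
  have "inv\<^bsub>Z\<^esub> w \<otimes>\<^bsub>Z\<^esub> x = [(p ^ k)] \<cdot>\<^bsub>Z\<^esub> \<one>\<^bsub>Z\<^esub>"
    unfolding w(2) using w(1) by (subst R.add_pow_rdistr) auto
  then show ?thesis using that w(1) by blast
qed

text \<open>The component of x at n is read off from the one at n + k, where p^k can be cancelled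
  and the modulus p^(n+1) is left over.\<close>

lemma p_power_torsion_free:
  assumes x: "x \<in> carrier Z" and "[(p ^ k)] \<cdot>\<^bsub>Z\<^esub> x = \<zero>\<^bsub>Z\<^esub>"
  shows "x = \<zero>\<^bsub>Z\<^esub>"
proof
  fix n
  have "(int (p ^ k) * x (n + k)) mod int p ^ Suc (n + k) = 0"
    using fun_cong [OF assms(2), of "n + k"] by (simp add: add_pow_Zp [OF x] Zp_zero del: power_Suc)
  then have "(int p ^ k * x (n + k)) mod (int p ^ k * int p ^ Suc n) = 0"
    by (simp add: power_add mult_ac)
  then have "x (n + k) mod int p ^ Suc n = 0"
    using p_gt_1 by (simp add: mod_mult_mult1 del: power_Suc)
  then show "x n = \<zero>\<^bsub>Z\<^esub> n"
    using Zp_carrier_mod_le [OF x, of n "n + k"] by (simp add: Zp_zero)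
qed

sublocale R: domain Z
proof
  show "\<one>\<^bsub>Z\<^esub> \<noteq> \<zero>\<^bsub>Z\<^esub>" by (auto simp: Zp_one Zp_zero fun_eq_iff)
  fix a b assume ab: "a \<otimes>\<^bsub>Z\<^esub> b = \<zero>\<^bsub>Z\<^esub>" "a \<in> carrier Z" "b \<in> carrier Z"
  show "a = \<zero>\<^bsub>Z\<^esub> \<or> b = \<zero>\<^bsub>Z\<^esub>"
  proof (cases "b = \<zero>\<^bsub>Z\<^esub>", blast, intro disjI1, rule ccontr)
    assume "b \<noteq> \<zero>\<^bsub>Z\<^esub>" "a \<noteq> \<zero>\<^bsub>Z\<^esub>"
    then obtain y k where y: "y \<in> carrier Z" "y \<otimes>\<^bsub>Z\<^esub> a = [(p ^ k)] \<cdot>\<^bsub>Z\<^esub> \<one>\<^bsub>Z\<^esub>"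
      using p_power_eq_multiple ab by blast
    have "[(p ^ k)] \<cdot>\<^bsub>Z\<^esub> b = y \<otimes>\<^bsub>Z\<^esub> a \<otimes>\<^bsub>Z\<^esub> b"
      unfolding y(2) using ab by (subst R.add_pow_ldistr) auto
    also have "\<dots> = \<zero>\<^bsub>Z\<^esub>"
      using ab y(1) by (simp add: R.m_assoc)
    finally show False
      using p_power_torsion_free ab \<open>b \<noteq> _\<close> by blast
  qed
qed

lemma torsion_free:
  assumes x: "x \<in> carrier Z" and "[k] \<cdot>\<^bsub>Z\<^esub> x = \<zero>\<^bsub>Z\<^esub>" "k > (0::nat)"
  shows "x = \<zero>\<^bsub>Z\<^esub>"
proof -
  \<comment> \<open>The index \<open>k\<close> is large enough to see the integer \<open>k\<close>,
    because k < p^k.\<close>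
  have "([k] \<cdot>\<^bsub>Z\<^esub> \<one>\<^bsub>Z\<^esub>) k \<noteq> 0"
  proof -
    have "k < p ^ k" using prime_gt_1_nat [OF prime_p] by (simp add: power_gt_expt)
    also have "\<dots> \<le> p ^ Suc k" using prime_gt_0_nat [OF prime_p] by simp
    finally have "int k < int p ^ Suc k" by (metis of_nat_less_iff of_nat_power)
    then show ?thesis using assms(3) by (simp add: add_pow_one_Zp)
  qed
  then have "[k] \<cdot>\<^bsub>Z\<^esub> \<one>\<^bsub>Z\<^esub> \<noteq> \<zero>\<^bsub>Z\<^esub>" by (metis Zp_zero)
  moreover have "([k] \<cdot>\<^bsub>Z\<^esub> \<one>\<^bsub>Z\<^esub>) \<otimes>\<^bsub>Z\<^esub> x = \<zero>\<^bsub>Z\<^esub>"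
    using x assms(2) by (subst R.add_pow_ldistr) auto
  ultimately show ?thesis
    using x R.integral R.add.nat_pow_closed R.one_closed by blast
qed

lemma padic_separated:
  assumes x: "x \<in> carrier Z" and "\<And>m. \<exists>w\<in>carrier Z. x = [(p ^ m)] \<cdot>\<^bsub>Z\<^esub> w"
  shows "x = \<zero>\<^bsub>Z\<^esub>"
proof
  fix n
  obtain w where "w \<in> carrier Z" "x = [(p ^ Suc n)] \<cdot>\<^bsub>Z\<^esub> w" using assms(2) by blast
  then show "x n = \<zero>\<^bsub>Z\<^esub> n" by (simp add: add_pow_Zp Zp_zero)
qed

lemma integer_approximation:
  assumes x: "x \<in> carrier Z"
  obtains k w where "w \<in> carrier Z" "x = [(k::nat)] \<cdot>\<^bsub>Z\<^esub> \<one>\<^bsub>Z\<^esub> \<oplus>\<^bsub>Z\<^esub> [(p ^ m)] \<cdot>\<^bsub>Z\<^esub> w"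
proof -
  \<comment> \<open>This agrees with x modulo p^(m+1), one power more than required; the spare
    factor p is absorbed into the remainder.\<close>
  define k where "k = nat (x m)"
  have "0 \<le> x m" using x unfolding Zp_carrier_iff by blast
  have "(x \<ominus>\<^bsub>Z\<^esub> [k] \<cdot>\<^bsub>Z\<^esub> \<one>\<^bsub>Z\<^esub>) m = (x m - ([k] \<cdot>\<^bsub>Z\<^esub> \<one>\<^bsub>Z\<^esub>) m) mod int p ^ Suc m"
    by (simp only: diff_Zp [OF x R.add.nat_pow_closed [OF R.one_closed]])
  also have "\<dots> = 0"
    using \<open>0 \<le> x m\<close> by (simp add: add_pow_one_Zp k_def mod_simps)
  finally have "(x \<ominus>\<^bsub>Z\<^esub> [k] \<cdot>\<^bsub>Z\<^esub> \<one>\<^bsub>Z\<^esub>) m = 0" .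
  then obtain w where w: "w \<in> carrier Z" "x \<ominus>\<^bsub>Z\<^esub> [k] \<cdot>\<^bsub>Z\<^esub> \<one>\<^bsub>Z\<^esub> = [(p ^ Suc m)] \<cdot>\<^bsub>Z\<^esub> w"
    using divisible_if_residue_zero [of "x \<ominus>\<^bsub>Z\<^esub> [k] \<cdot>\<^bsub>Z\<^esub> \<one>\<^bsub>Z\<^esub>" m] x by auto
  have "x = [k] \<cdot>\<^bsub>Z\<^esub> \<one>\<^bsub>Z\<^esub> \<oplus>\<^bsub>Z\<^esub> (x \<ominus>\<^bsub>Z\<^esub> [k] \<cdot>\<^bsub>Z\<^esub> \<one>\<^bsub>Z\<^esub>)"
    using x by (simp add: a_minus_def R.add.m_lcomm R.r_neg)
  also have "x \<ominus>\<^bsub>Z\<^esub> [k] \<cdot>\<^bsub>Z\<^esub> \<one>\<^bsub>Z\<^esub> = [(p ^ m)] \<cdot>\<^bsub>Z\<^esub> ([p] \<cdot>\<^bsub>Z\<^esub> w)"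
    unfolding w(2) using w(1) by (simp add: R.add.nat_pow_pow mult_ac)
  finally show ?thesis
    using that w(1) by (metis R.add.nat_pow_closed)
qed

end

section \<open>Extensions in the presence of p-adic scalars and functionals\<close>

text \<open>A neighbour x of the identity generates an open subgroup by itself, hence together with
  any y. This settles the case of the identity in the group of maximal class.\<close>

lemma (in lattice_extension) virt_adj_one:
  assumes "virt_adj G T \<one>\<^bsub>G\<^esub> x" "y \<in> carrier G"
  shows "virt_adj G T x y"
proof -
  have x: "x \<in> carrier G" using assms(1) by (simp add: virt_adj_def)
  have S: "subgroup (generate G {x, y}) G" "subgroup (generate G {\<one>\<^bsub>G\<^esub>, x}) G"
    using x assms(2) by (intro G.generate_is_subgroup; simp)+
  have "generate G {\<one>\<^bsub>G\<^esub>, x} \<subseteq> generate G {x, y}"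
    by (intro G.generate_subgroup_incl S) (auto intro: generate.incl generate.one simp del: one_G)
  then have "translation_part (generate G {\<one>\<^bsub>G\<^esub>, x}) \<subseteq> translation_part (generate G {x, y})"
    unfolding translation_part_def by blast
  then show ?thesis
    using assms x openin_closure_iff [OF S(1)] openin_closure_iff [OF S(2)]
    unfolding virt_adj_def by blast
qed

text \<open>Here \<open>s\<close> plays the role of z -> z x; as the abstract lattice carries no
  scalars, its additivity is supplied by \<open>s_approx\<close>. Integer multiples of x approximate
  s z, and the translation part is closed.\<close>

lemma (in lattice_extension) translation_part_scale:
  assumes "Factorial_Ring.prime p"
    and S: "subgroup S G" and x: "x \<in> translation_part S" and z: "z \<in> carrier (Zp p)"
    and s_closed: "\<And>w. w \<in> carrier (Zp p) \<Longrightarrow> s w \<in> carrier N"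
    and s_approx: "\<And>(k::nat) m w. w \<in> carrier (Zp p) \<Longrightarrow>
      s ([k] \<cdot>\<^bsub>Zp p\<^esub> \<one>\<^bsub>Zp p\<^esub> \<oplus>\<^bsub>Zp p\<^esub> [(p ^ m)] \<cdot>\<^bsub>Zp p\<^esub> w) = x [^] k \<otimes> s w [^] (p ^ m)"
  shows "s z \<in> translation_part S"
proof (rule translation_part_closed [OF S s_closed [OF z]])
  interpret padic p by unfold_locales fact
  fix m
  obtain k w where w: "w \<in> carrier Z" "z = [(k::nat)] \<cdot>\<^bsub>Z\<^esub> \<one>\<^bsub>Z\<^esub> \<oplus>\<^bsub>Z\<^esub> [(p ^ m)] \<cdot>\<^bsub>Z\<^esub> w"
    using integer_approximation [OF z] .
  then show "\<exists>u\<in>translation_part S. \<exists>w\<in>carrier N. s z = u \<otimes> w [^] (p ^ m)"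
    using s_approx s_closed translation_part_nat_pow [OF S x] by blast
qed

text \<open>The sublattice is the common kernel of \<open>F\<close>. It is closed because the p-adic
  integers are separated, saturated because they are torsion-free, and of infinite index because
  \<open>f\<^sub>0\<close> does not vanish. The premises on carriers inside \<open>fixed\<close>
  hand the caller the membership facts that follow from the assumed adjacency.\<close>

lemma (in lattice_extension) not_virt_adj_if_functionals:
  fixes k :: nat
  assumes "Factorial_Ring.prime p"
    and F: "F \<subseteq> hom N (add_monoid (Zp p))"
    and nonzero: "f\<^sub>0 \<in> F" "v\<^sub>0 \<in> carrier N" "f\<^sub>0 v\<^sub>0 \<noteq> \<zero>\<^bsub>Zp p\<^esub>"
    and k: "k > 0" and u: "u \<in> carrier N"
    and stab: "\<And>v. v \<in> carrier N \<Longrightarrow> (\<forall>f\<in>F. f (act g v) = \<zero>\<^bsub>Zp p\<^esub>) \<longleftrightarrow> (\<forall>f\<in>F. f v = \<zero>\<^bsub>Zp p\<^esub>)"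
      "\<And>v. v \<in> carrier N \<Longrightarrow> (\<forall>f\<in>F. f (act h v) = \<zero>\<^bsub>Zp p\<^esub>) \<longleftrightarrow> (\<forall>f\<in>F. f v = \<zero>\<^bsub>Zp p\<^esub>)"
    and fixed: "\<And>f. a \<in> carrier N \<Longrightarrow> g \<in> carrier H \<Longrightarrow> f \<in> F \<Longrightarrow>
        f (a [^] k \<otimes> act g u \<otimes> inv u) = \<zero>\<^bsub>Zp p\<^esub>"
      "\<And>f. b \<in> carrier N \<Longrightarrow> h \<in> carrier H \<Longrightarrow> f \<in> F \<Longrightarrow>
        f (b [^] k \<otimes> act h u \<otimes> inv u) = \<zero>\<^bsub>Zp p\<^esub>"
  shows "\<not> virt_adj G T (a, g) (b, h)"
proof
  assume adj: "virt_adj G T (a, g) (b, h)"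
  then have c: "a \<in> carrier N" "g \<in> carrier H" "b \<in> carrier N" "h \<in> carrier H"
    by (auto simp: virt_adj_def)
  interpret padic p by unfold_locales fact
  have hom: "group_hom N (add_monoid Z) f" if "f \<in> F" for f
    using that F R.add.is_group N.is_group by (intro group_hom.intro group_hom_axioms.intro) auto
  have f_closed: "f v \<in> carrier Z" if "f \<in> F" "v \<in> carrier N" for f v
    using group_hom.hom_closed [OF hom [OF that(1)] that(2)] by simp
  have f_pow: "f (v [^] (n::nat)) = [n] \<cdot>\<^bsub>Z\<^esub> f v" if "f \<in> F" "v \<in> carrier N" for f v n
    using group_hom.hom_nat_pow [OF hom [OF that(1)] that(2)] by (simp add: add_pow_def)
  have f_mult: "f (v \<otimes> w) = f v \<oplus>\<^bsub>Z\<^esub> f w" if "f \<in> F" "v \<in> carrier N" "w \<in> carrier N" for f v w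
    using group_hom.hom_mult [OF hom [OF that(1)] that(2,3)] by simp
  define A where "A = {v \<in> carrier N. \<forall>f\<in>F. f v = \<zero>\<^bsub>Z\<^esub>}"
  have "\<not> virt_adj G T (a, g) (b, h)"
  proof (rule not_virt_adj_if_fixed_point [where A = A and k = k and u = u])
    show "subgroup A N"
    proof (rule N.subgroupI)
      have "\<one> \<in> A"
        using group_hom.hom_one [OF hom] by (auto simp: A_def)
      then show "A \<noteq> {}" by blast
      show "inv v \<in> A" if "v \<in> A" for v
        using that group_hom.hom_inv [OF hom, of _ v] R.add.inv_one by (auto simp: A_def)
    qed (auto simp: A_def f_mult)
    show "padic_closed A"
      unfolding padic_closed_def
    proof (intro ballI impI)
      fix v assume v: "v \<in> carrier N" and *: "\<forall>m. \<exists>w\<in>carrier N. v \<otimes> w [^] (p ^ m) \<in> A"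
      have "f v = \<zero>\<^bsub>Z\<^esub>" if f: "f \<in> F" for f
      proof (rule padic_separated)
        show "f v \<in> carrier Z" using f v by (rule f_closed)
        fix m
        obtain w where w: "w \<in> carrier N" "v \<otimes> w [^] (p ^ m) \<in> A" using * by blast
        then have "f v \<oplus>\<^bsub>Z\<^esub> [(p ^ m)] \<cdot>\<^bsub>Z\<^esub> f w = \<zero>\<^bsub>Z\<^esub>"
          using f v by (simp add: A_def f_mult f_pow)
        then have "f v = \<ominus>\<^bsub>Z\<^esub> ([(p ^ m)] \<cdot>\<^bsub>Z\<^esub> f w)"
          using R.minus_equality f_closed f v w(1) by (metis R.add.nat_pow_closed)
        also have "\<dots> = [(p ^ m)] \<cdot>\<^bsub>Z\<^esub> (\<ominus>\<^bsub>Z\<^esub> f w)"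
          using f_closed f w(1) by (simp add: R.add.nat_pow_inv)
        finally show "\<exists>w\<in>carrier Z. f v = [(p ^ m)] \<cdot>\<^bsub>Z\<^esub> w"
          using f_closed f w(1) by blast
      qed
      then show "v \<in> A" using v by (simp add: A_def)
    qed
    show "\<exists>v\<in>carrier N. v [^] (p ^ n) \<notin> A" for n
      using nonzero p_power_torsion_free [of "f\<^sub>0 v\<^sub>0" n] f_closed f_pow
      by (auto simp: A_def intro!: bexI [of _ v\<^sub>0])
    show "v \<in> A" if "v \<in> carrier N" "v [^] k \<in> A" for v
      using that torsion_free k f_closed f_pow by (auto simp: A_def)
  qed (use stab fixed c u in \<open>auto simp: A_def\<close>)
  then show False using adj by blast
qed

text \<open>The multiples t e of a nonzero e are pairwise distinct. Every choice of a generic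
  parameter rests on this: each condition excludes finitely many t.\<close>

lemma (in padic) finite_multiples_eq:
  assumes "e \<in> carrier Z" "e \<noteq> \<zero>\<^bsub>Z\<^esub>"
  shows "finite {t::nat. [t] \<cdot>\<^bsub>Z\<^esub> e = c}"
proof -
  have "s = t" if eq: "[s] \<cdot>\<^bsub>Z\<^esub> e = [t] \<cdot>\<^bsub>Z\<^esub> e" and le: "s \<le> t" for s t :: nat
  proof (rule ccontr)
    assume "s \<noteq> t"
    have "[s] \<cdot>\<^bsub>Z\<^esub> e \<oplus>\<^bsub>Z\<^esub> [(t - s)] \<cdot>\<^bsub>Z\<^esub> e = [t] \<cdot>\<^bsub>Z\<^esub> e"
      using assms le by (subst R.add.nat_pow_mult) auto
    also have "\<dots> = [s] \<cdot>\<^bsub>Z\<^esub> e \<oplus>\<^bsub>Z\<^esub> \<zero>\<^bsub>Z\<^esub>"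
      using assms eq by simp
    finally have "[s] \<cdot>\<^bsub>Z\<^esub> e \<oplus>\<^bsub>Z\<^esub> [(t - s)] \<cdot>\<^bsub>Z\<^esub> e = [s] \<cdot>\<^bsub>Z\<^esub> e \<oplus>\<^bsub>Z\<^esub> \<zero>\<^bsub>Z\<^esub>" .
    then have "[(t - s)] \<cdot>\<^bsub>Z\<^esub> e = \<zero>\<^bsub>Z\<^esub>"
      using assms by (subst (asm) R.add.l_cancel) auto
    then show False
      using torsion_free assms \<open>s \<noteq> t\<close> le by simp
  qed
  then have "inj (\<lambda>t::nat. [t] \<cdot>\<^bsub>Z\<^esub> e)"
    by (metis injI nle_le)
  then show ?thesis
    using finite_vimageI [of "{c}"] by (simp add: vimage_def)
qed

section \<open>The pro-p group of maximal class\<close>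

locale max_class = padic p + L: field L
  for p :: nat and L :: "'a ring" (structure) and \<phi> :: "(nat \<Rightarrow> int) \<Rightarrow> 'a" and \<zeta> :: 'a +
  assumes phi_hom: "\<phi> \<in> ring_hom (Zp p) L" and phi_inj: "inj_on \<phi> (carrier (Zp p))"
    and zeta_unit: "\<zeta> \<in> Units L" and ord_zeta: "group.ord (units_of L) \<zeta> = p"
begin

sublocale phi: ring_hom_cring Z L \<phi>
  by unfold_locales (rule phi_hom)

abbreviation E :: "'a set" where "E \<equiv> L.simple_extension (\<phi> ` carrier Z) \<zeta>"
abbreviation D :: "'a ring" where "D \<equiv> Zp_adjoin p L \<phi> \<zeta>"
abbreviation P :: "nat \<Rightarrow> 'a" where "P n \<equiv> [(p ^ n)] \<cdot> \<one>"

lemma zeta_closed [simp]: "\<zeta> \<in> carrier L"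
  using zeta_unit by blast

lemma zeta_pow_p: "\<zeta> [^] p = \<one>"
proof -
  interpret U: group "units_of L" by (rule L.units_group)
  have "\<zeta> [^]\<^bsub>units_of L\<^esub> p = \<one>\<^bsub>units_of L\<^esub>"
    using U.pow_ord_eq_1 [of \<zeta>] zeta_unit ord_zeta by (simp add: units_of_carrier)
  then show ?thesis
    using zeta_unit by (simp add: L.units_of_pow units_of_one)
qed

lemma zeta_neq_one: "\<zeta> \<noteq> \<one>"
proof
  interpret U: group "units_of L" by (rule L.units_group)
  assume "\<zeta> = \<one>"
  then have "U.ord \<zeta> = 1"
    using U.ord_eq_1 [of \<zeta>] zeta_unit by (simp add: units_of_carrier units_of_one)
  then show False using ord_zeta p_gt_1 by simp
qed

lemma zeta_pow_mod: "\<zeta> [^] (n mod p) = \<zeta> [^] n"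
proof -
  have "\<zeta> [^] n = \<zeta> [^] (p * (n div p) + n mod p)" by simp
  also have "\<dots> = (\<zeta> [^] p) [^] (n div p) \<otimes> \<zeta> [^] (n mod p)"
    by (simp only: L.nat_pow_mult [symmetric] L.nat_pow_pow zeta_closed)
  finally show ?thesis by (simp add: zeta_pow_p)
qed

lemma image_subring: "subring (\<phi> ` carrier Z) L"
  using ring_hom_ringI2 [OF R.ring_axioms L.ring_axioms phi_hom] R.carrier_is_subring
  by (rule ring_hom_ring.img_is_subring)

lemma E_subring: "subring E L"
  by (rule L.simple_extension_is_subring [OF image_subring zeta_closed])

lemma E_carrier: "x \<in> E \<Longrightarrow> x \<in> carrier L"
  using subringE(1) [OF E_subring] by blast

lemmas E_closed = subringE(2,3,5,6,7) [OF E_subring]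

lemma zeta_in_E: "\<zeta> \<in> E"
  by (rule L.simple_extension_mem [OF image_subring zeta_closed])

lemma phi_in_E: "z \<in> carrier Z \<Longrightarrow> \<phi> z \<in> E"
  using L.simple_extension_incl [OF subringE(1) [OF image_subring] zeta_closed] by blast

lemma phi_add_pow: "z \<in> carrier Z \<Longrightarrow> \<phi> ([(n::nat)] \<cdot>\<^bsub>Z\<^esub> z) = [n] \<cdot> \<phi> z"
  by (induction n) simp_all

lemma add_pow_eq_mult: "x \<in> carrier L \<Longrightarrow> [(n::nat)] \<cdot> x = [n] \<cdot> \<one> \<otimes> x"
  by (subst L.add_pow_ldistr) auto

lemma P_in_E: "[(n::nat)] \<cdot> \<one> \<in> E"
  using phi_in_E [of "[n] \<cdot>\<^bsub>Z\<^esub> \<one>\<^bsub>Z\<^esub>"] by (simp add: phi_add_pow)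

lemma P_add: "P (m + n) = P m \<otimes> P n"
  by (simp add: L.add_pow_ldistr L.add.nat_pow_pow power_add mult.commute)

lemma phi_eq_zero_iff: "z \<in> carrier Z \<Longrightarrow> \<phi> z = \<zero> \<longleftrightarrow> z = \<zero>\<^bsub>Z\<^esub>"
  using phi_inj by (metis R.zero_closed inj_onD phi.hom_zero)

lemma P_nonzero: "P n \<noteq> \<zero>"
proof
  assume "P n = \<zero>"
  then have "\<phi> ([(p ^ n)] \<cdot>\<^bsub>Z\<^esub> \<one>\<^bsub>Z\<^esub>) = \<zero>" by (simp add: phi_add_pow)
  then show False
    using phi_eq_zero_iff torsion_free [of "\<one>\<^bsub>Z\<^esub>" "p ^ n"] prime_gt_0_nat [OF prime_p] by simp
qed

lemma D_simps [simp]: "carrier D = E" "add D = add L" "zero D = zero L" "monoid.mult D = monoid.mult L" "one D = one L"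
  by (simp_all add: Zp_adjoin_def)

lemma D_ring: "ring D"
  unfolding Zp_adjoin_def by (rule L.subring_is_ring [OF E_subring])

definition DN :: "'a monoid" where "DN = add_monoid D"

lemma DN_simps [simp]: "carrier DN = E" "monoid.mult DN = add L" "one DN = zero L"
  by (simp_all add: DN_def)

lemma DN_comm_group: "comm_group DN"
  unfolding DN_def using abelian_group.a_comm_group [OF ring.is_abelian_group [OF D_ring]] .

lemma D_pow: "x [^]\<^bsub>DN\<^esub> (n::nat) = [n] \<cdot> x"
  by (simp add: add_pow_def nat_pow_def)

lemma D_inv:
  assumes "x \<in> E"
  shows "inv\<^bsub>DN\<^esub> x = \<ominus> x"
proof -
  interpret A: comm_group DN by (rule DN_comm_group)
  show ?thesis
    using assms E_closed(3) E_carrier by (intro A.inv_equality) (auto simp: L.l_neg)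
qed

sublocale ext: lattice_extension DN "integer_mod_group p"
  "\<lambda>k x. (\<zeta> [^] nat k) \<otimes> x" p
proof (intro lattice_extension.intro lattice_extension_axioms.intro)
  show "comm_group DN" by (rule DN_comm_group)
  have pow: "\<zeta> [^] (n::nat) \<in> E" for n
    by (induction n) (simp_all add: E_closed zeta_in_E)
  show "\<zeta> [^] nat \<one>\<^bsub>integer_mod_group p\<^esub> \<otimes> v = v" if "v \<in> carrier DN" for v
    using that E_carrier by simp
  fix h g v w assume h: "h \<in> carrier (integer_mod_group p)" and v: "v \<in> carrier DN"
  show "\<zeta> [^] nat h \<otimes> v \<in> carrier DN"
    using v pow E_closed by simp
  { assume w: "w \<in> carrier DN"
    show "\<zeta> [^] nat h \<otimes> (v \<otimes>\<^bsub>DN\<^esub> w) =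
        (\<zeta> [^] nat h \<otimes> v) \<otimes>\<^bsub>DN\<^esub> (\<zeta> [^] nat h \<otimes> w)"
      using v w E_carrier by (simp add: L.r_distr) }
  { assume g: "g \<in> carrier (integer_mod_group p)"
    have gh: "0 \<le> g" "0 \<le> h" using g h p_gt_1 by (auto simp: carrier_integer_mod_group split: if_splits)
    then have "nat (g \<otimes>\<^bsub>integer_mod_group p\<^esub> h) = (nat g + nat h) mod p"
      by (simp add: nat_mod_distrib nat_add_distrib)
    then show "\<zeta> [^] nat (g \<otimes>\<^bsub>integer_mod_group p\<^esub> h) \<otimes> v = \<zeta> [^] nat g \<otimes> (\<zeta> [^] nat h \<otimes> v)"
      using v E_carrier by (simp add: zeta_pow_mod L.nat_pow_mult [symmetric] L.m_assoc) }
qed simp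

lemma group_eq: "max_class_group p L \<phi> \<zeta> = ext.G"
  and topology_eq: "max_class_topology p L \<phi> \<zeta> = ext.T"
  by (simp_all add: max_class_group_def max_class_topology_def DN_def)

text \<open>Every nonzero element of \<open>E\<close> divides a power of \<open>p\<close>: its inverse lies in the field
  \<open>Q(\<zeta>)\<close>, where \<open>Q\<close> is the field of fractions of the image of the p-adic integers.\<close>

definition Q :: "'a set" where
  "Q = {t \<in> carrier L. \<exists>n. P n \<otimes> t \<in> \<phi> ` carrier Z}"

lemma Q_I: "t \<in> carrier L \<Longrightarrow> z \<in> carrier Z \<Longrightarrow> P n \<otimes> t = \<phi> z \<Longrightarrow> t \<in> Q"
  unfolding Q_def by (auto intro!: exI [of _ n])

text \<open>For inverses: if p^n t is the image of z and y z = p^k, then p^k times the inverse of t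
  is the image of y p^n.\<close>

lemma Q_subfield: "subfield Q L"
proof (rule L.subfieldI')
  show "subring Q L"
  proof (rule L.subringI)
    show "Q \<subseteq> carrier L" by (auto simp: Q_def)
    show "\<one> \<in> Q" by (rule Q_I [of _ "\<one>\<^bsub>Z\<^esub>" 0]) auto
    fix s assume s: "s \<in> Q"
    then obtain n z where sz: "s \<in> carrier L" "z \<in> carrier Z" "P n \<otimes> s = \<phi> z"
      by (auto simp: Q_def)
    then have "P n \<otimes> (\<ominus> s) = \<phi> (\<ominus>\<^bsub>Z\<^esub> z)" by (simp add: L.r_minus)
    then show "\<ominus> s \<in> Q" using sz by (intro Q_I [of _ "\<ominus>\<^bsub>Z\<^esub> z" n]) auto
    fix t assume "t \<in> Q"
    then obtain m y where ty: "t \<in> carrier L" "y \<in> carrier Z" "P m \<otimes> t = \<phi> y"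
      by (auto simp: Q_def)
    have "P (n + m) \<otimes> (s \<otimes> t) = (P n \<otimes> s) \<otimes> (P m \<otimes> t)"
      unfolding P_add using sz(1) ty(1) by (simp add: L.m_ac)
    also have "\<dots> = \<phi> (z \<otimes>\<^bsub>Z\<^esub> y)" using sz ty by simp
    finally show "s \<otimes> t \<in> Q" using sz ty by (intro Q_I [of _ "z \<otimes>\<^bsub>Z\<^esub> y" "n + m"]) auto
    have "P (n + m) \<otimes> (s \<oplus> t) = P m \<otimes> (P n \<otimes> s) \<oplus> P n \<otimes> (P m \<otimes> t)"
      unfolding P_add using sz(1) ty(1) by (simp add: L.m_ac L.l_distr L.r_distr)
    also have "\<dots> = \<phi> ([(p ^ m)] \<cdot>\<^bsub>Z\<^esub> z \<oplus>\<^bsub>Z\<^esub> [(p ^ n)] \<cdot>\<^bsub>Z\<^esub> y)"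
      using sz ty by (simp add: phi_add_pow add_pow_eq_mult [symmetric])
    finally show "s \<oplus> t \<in> Q" using sz ty
      by (intro Q_I [of _ "[(p ^ m)] \<cdot>\<^bsub>Z\<^esub> z \<oplus>\<^bsub>Z\<^esub> [(p ^ n)] \<cdot>\<^bsub>Z\<^esub> y" "n + m"]) auto
  qed
  fix t assume "t \<in> Q - {\<zero>}"
  then obtain n z where t: "t \<in> carrier L" "t \<noteq> \<zero>" "z \<in> carrier Z" "P n \<otimes> t = \<phi> z"
    by (auto simp: Q_def)
  have tu: "t \<in> Units L" using t L.field_Units by blast
  have "P n \<otimes> t \<noteq> \<zero>" using t P_nonzero L.integral by blast
  then have "z \<noteq> \<zero>\<^bsub>Z\<^esub>" using t(4) by auto
  then obtain y k where y: "y \<in> carrier Z" "y \<otimes>\<^bsub>Z\<^esub> z = [(p ^ k)] \<cdot>\<^bsub>Z\<^esub> \<one>\<^bsub>Z\<^esub>"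
    using p_power_eq_multiple t(3) by blast
  have "P k = \<phi> (y \<otimes>\<^bsub>Z\<^esub> z)" unfolding y(2) by (simp add: phi_add_pow)
  also have "\<dots> = \<phi> y \<otimes> (P n \<otimes> t)" using y(1) t by simp
  finally have "P k \<otimes> inv t = \<phi> y \<otimes> (P n \<otimes> t) \<otimes> inv t" by simp
  also have "\<dots> = \<phi> y \<otimes> P n"
    using y(1) t(1) tu by (simp add: L.m_assoc)
  also have "\<dots> = \<phi> (y \<otimes>\<^bsub>Z\<^esub> [(p ^ n)] \<cdot>\<^bsub>Z\<^esub> \<one>\<^bsub>Z\<^esub>)"
    using y(1) by (simp add: phi_add_pow)
  finally show "inv t \<in> Q" using tu y(1)
    by (intro Q_I [of _ "y \<otimes>\<^bsub>Z\<^esub> [(p ^ n)] \<cdot>\<^bsub>Z\<^esub> \<one>\<^bsub>Z\<^esub>" k]) auto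
qed

lemma zeta_algebraic: "(L.algebraic over Q) \<zeta>"
proof -
  \<comment> \<open>The polynomial X^p - 1, leading coefficient first, with p - 1 zeros before the
    constant term.\<close>
  define q where "q = \<one> # replicate (p - 1) \<zero> @ [\<ominus> \<one>]"
  have Q: "subring Q L" using subfieldE(1) [OF Q_subfield] .
  have "q \<in> carrier (Q [X]\<^bsub>L\<^esub>)"
    unfolding univ_poly_carrier [symmetric] polynomial_def q_def
    using subringE(2,3,5) [OF Q] by auto
  moreover have "L.eval q \<zeta> = \<zero>"
    using p_gt_1 by (simp add: q_def L.eval_replicate zeta_pow_p L.r_neg)
  ultimately show ?thesis
    by (intro L.algebraicI [of q]) (auto simp: q_def over_def)
qed

text \<open>Elements of a simple extension arise by Horner steps from s and t to s \<zeta> + t; the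
  product of the powers of p that clear s and t clears the result.\<close>

lemma clear_denominators:
  assumes "t \<in> L.simple_extension Q \<zeta>"
  shows "\<exists>n. P n \<otimes> t \<in> E"
  using assms
proof (induction rule: L.simple_extension.induct)
  case zero
  then show ?case using E_closed(1) by simp
next
  case (lin s t)
  then obtain n where n: "P n \<otimes> s \<in> E" by blast
  obtain m z where "z \<in> carrier Z" "P m \<otimes> t = \<phi> z" using lin by (auto simp: Q_def)
  then have m: "P m \<otimes> t \<in> E" using phi_in_E by simp
  have c: "s \<in> carrier L" "t \<in> carrier L"
    using lin L.simple_extension_in_carrier [of Q \<zeta>] by (auto simp: Q_def)
  have "P (n + m) \<otimes> (s \<otimes> \<zeta> \<oplus> t) = P m \<otimes> ((P n \<otimes> s) \<otimes> \<zeta>) \<oplus> P n \<otimes> (P m \<otimes> t)"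
    unfolding P_add using c by (simp add: L.m_ac L.r_distr)
  also have "\<dots> \<in> E"
    by (rule E_closed(5) [OF E_closed(4) [OF P_in_E E_closed(4) [OF n zeta_in_E]]
          E_closed(4) [OF P_in_E m]])
  finally show ?case by blast
qed

lemma divides_p_power:
  assumes "d \<in> E" "d \<noteq> \<zero>"
  obtains e n where "e \<in> E" "d \<otimes> e = P n"
proof -
  have "\<phi> z \<in> Q" if "z \<in> carrier Z" for z
    using that by (auto simp: Q_def intro!: exI [of _ 0])
  then have "E \<subseteq> L.simple_extension Q \<zeta>"
    by (intro L.mono_simple_extension) auto
  moreover have "subfield (L.simple_extension Q \<zeta>) L"
    using L.simple_extension_is_subfield [OF Q_subfield zeta_closed] zeta_algebraic by simp
  ultimately have "inv d \<in> L.simple_extension Q \<zeta>"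
    using L.subfield_m_inv(1) assms by blast
  then obtain n where n: "P n \<otimes> inv d \<in> E"
    using clear_denominators by blast
  have d: "d \<in> Units L" using assms E_carrier L.field_Units by blast
  then have "d \<otimes> (P n \<otimes> inv d) = P n \<otimes> (d \<otimes> inv d)"
    by (intro L.m_lcomm) auto
  then have "d \<otimes> (P n \<otimes> inv d) = P n"
    using d by simp
  then show ?thesis using that n by blast
qed

section \<open>Generators of the lattice, and p is not invertible in it\<close>

text \<open>The module over the p-adic integers generated by the powers of \<zeta> with exponent
  below n. The recursion splits off the highest power, the one that the argument of Nakayama's lemma
  drops.\<close>

primrec span :: "nat \<Rightarrow> 'a set" where
  "span 0 = {\<zero>}"
| "span (Suc n) = {m \<oplus> \<phi> z \<otimes> \<zeta> [^] n | m z. m \<in> span n \<and> z \<in> carrier Z}"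

lemma span_carrier: "span n \<subseteq> carrier L"
  by (induction n) auto

lemma span_SucI: "m \<in> span n \<Longrightarrow> z \<in> carrier Z \<Longrightarrow> m \<oplus> \<phi> z \<otimes> \<zeta> [^] n \<in> span (Suc n)"
  by auto

lemma span_mono: "span n \<subseteq> span (Suc n)"
proof
  fix x assume x: "x \<in> span n"
  then have "x = x \<oplus> \<phi> \<zero>\<^bsub>Z\<^esub> \<otimes> \<zeta> [^] n"
    using span_carrier by (simp add: subset_iff)
  then show "x \<in> span (Suc n)" using span_SucI [OF x R.zero_closed] by simp
qed

lemma span_add: "x \<in> span n \<Longrightarrow> y \<in> span n \<Longrightarrow> x \<oplus> y \<in> span n"
proof (induction n arbitrary: x y)
  case (Suc n)
  then obtain m z m' z' where *: "x = m \<oplus> \<phi> z \<otimes> \<zeta> [^] n" "m \<in> span n" "z \<in> carrier Z"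
      "y = m' \<oplus> \<phi> z' \<otimes> \<zeta> [^] n" "m' \<in> span n" "z' \<in> carrier Z"
    by auto
  have "m \<in> carrier L" "m' \<in> carrier L" using * span_carrier by auto
  then have "x \<oplus> y = (m \<oplus> m') \<oplus> \<phi> (z \<oplus>\<^bsub>Z\<^esub> z') \<otimes> \<zeta> [^] n"
    using * by (simp add: L.l_distr L.a_ac)
  then show ?case using span_SucI [OF Suc.IH [OF *(2,5)] R.a_closed [OF *(3,6)]] by simp
qed simp

lemma span_scalar: "x \<in> span n \<Longrightarrow> y \<in> carrier Z \<Longrightarrow> \<phi> y \<otimes> x \<in> span n"
proof (induction n arbitrary: x)
  case (Suc n)
  then obtain m z where *: "x = m \<oplus> \<phi> z \<otimes> \<zeta> [^] n" "m \<in> span n" "z \<in> carrier Z"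
    by auto
  have "m \<in> carrier L" using * span_carrier by auto
  then have "\<phi> y \<otimes> x = \<phi> y \<otimes> m \<oplus> \<phi> (y \<otimes>\<^bsub>Z\<^esub> z) \<otimes> \<zeta> [^] n"
    using * Suc.prems by (simp add: L.r_distr L.m_assoc)
  then show ?case
    using span_SucI [OF Suc.IH [OF *(2) Suc.prems(2)] R.m_closed [OF Suc.prems(2) *(3)]] by simp
qed simp

lemma span_zeta: "x \<in> span n \<Longrightarrow> x \<otimes> \<zeta> \<in> span (Suc n)"
proof (induction n arbitrary: x)
  case 0
  then show ?case using span_SucI [OF 0 R.zero_closed] by simp
next
  case (Suc n)
  then obtain m z where *: "x = m \<oplus> \<phi> z \<otimes> \<zeta> [^] n" "m \<in> span n" "z \<in> carrier Z"
    by auto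
  have "m \<in> carrier L" using * span_carrier by auto
  then have "x \<otimes> \<zeta> = m \<otimes> \<zeta> \<oplus> \<phi> z \<otimes> \<zeta> [^] Suc n"
    using * by (simp add: L.l_distr L.m_assoc)
  then show ?case using * Suc.IH [of m] by auto
qed

lemma image_in_span: "z \<in> carrier Z \<Longrightarrow> \<phi> z \<in> span (Suc n)"
proof (induction n)
  case 0
  have "\<phi> z = \<zero> \<oplus> \<phi> z \<otimes> \<zeta> [^] (0::nat)" using 0 by simp
  then show ?case using span_SucI [of \<zero> 0 z] 0 by simp
next
  case (Suc n)
  then show ?case using span_mono [of "Suc n"] by blast
qed

text \<open>Multiplication by \<zeta> raises the exponents by one, and the highest power wraps
  around to the constant 1 because the p-th power of \<zeta> is 1. Thus \<open>span p\<close> is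
  closed under Horner steps.\<close>

lemma E_subset_span: "E \<subseteq> span p"
proof
  obtain q where "p = Suc q" using p_gt_1 by (cases p) auto
  then have q: "span p = span (Suc q)" "\<zeta> [^] p = \<zeta> [^] q \<otimes> \<zeta>"
    by (simp_all only: L.nat_pow_Suc)
  have zeta: "x \<otimes> \<zeta> \<in> span p" if x: "x \<in> span p" for x
  proof -
    obtain m z where *: "x = m \<oplus> \<phi> z \<otimes> \<zeta> [^] q" "m \<in> span q" "z \<in> carrier Z"
      using x unfolding q(1) by auto
    have "m \<in> carrier L" using * span_carrier by auto
    moreover have "\<zeta> [^] q \<otimes> \<zeta> = \<one>" using zeta_pow_p q(2) by simp
    ultimately have "x \<otimes> \<zeta> = m \<otimes> \<zeta> \<oplus> \<phi> z"
      using * by (simp add: L.l_distr L.m_assoc)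
    then show ?thesis
      using span_add [OF span_zeta [OF *(2)] image_in_span [OF *(3)]] unfolding q(1)
      by (simp del: span.simps)
  qed
  fix x assume "x \<in> E"
  then show "x \<in> span p"
  proof (induction rule: L.simple_extension.induct)
    case zero
    have "\<phi> \<zero>\<^bsub>Z\<^esub> \<in> span p" using image_in_span [of "\<zero>\<^bsub>Z\<^esub>" q] unfolding q(1) by simp
    then show ?case by simp
  next
    case (lin s t)
    then obtain z where "z \<in> carrier Z" "t = \<phi> z" by auto
    then have "t \<in> span p" using image_in_span [of z q] unfolding q(1) by simp
    then show ?case using span_add zeta lin by blast
  qed
qed

text \<open>Nakayama's lemma: if \<open>p\<close> were invertible in \<open>E\<close>, then the last generator in
  \<open>1, \<zeta>, \<dots>, \<zeta>\<^sup>n\<close> could be dropped, as its coefficient \<open>1 - p z\<close> is a unit.\<close>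

lemma p_not_unit:
  assumes t: "t \<in> E"
  shows "P 1 \<otimes> t \<noteq> \<one>"
proof
  assume one: "P 1 \<otimes> t = \<one>"
  have "E \<subseteq> span (p - n)" for n
  proof (induction n)
    case 0
    then show ?case using E_subset_span by simp
  next
    case (Suc n)
    show ?case
    proof (cases "n < p")
      case False
      then show ?thesis using Suc by simp
    next
      case True
      define k where "k = p - Suc n"
      have k: "p - n = Suc k" using True by (simp add: k_def)
      have pow: "\<zeta> [^] k \<in> E"
        by (induction k) (simp_all add: E_closed zeta_in_E)
      then have "\<zeta> [^] k \<otimes> t \<in> span (Suc k)"
        using Suc E_closed(4) t unfolding k by blast
      then obtain m z where m: "\<zeta> [^] k \<otimes> t = m \<oplus> \<phi> z \<otimes> \<zeta> [^] k" "m \<in> span k" "z \<in> carrier Z"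
        by auto
      have mc: "m \<in> carrier L" using m span_carrier by auto
      \<comment> \<open>Multiplying \<open>m(1)\<close> by p gives \<zeta>^k = p m + p z \<zeta>^k,
        that is, y \<zeta>^k = p m; the residue of y modulo p is 1.\<close>
      define y where "y = \<one>\<^bsub>Z\<^esub> \<ominus>\<^bsub>Z\<^esub> [p] \<cdot>\<^bsub>Z\<^esub> z"
      have yc: "y \<in> carrier Z" using m by (simp add: y_def)
      have "y 0 = (\<one>\<^bsub>Z\<^esub> 0 - ([p] \<cdot>\<^bsub>Z\<^esub> z) 0) mod int p ^ Suc 0"
        unfolding y_def by (subst diff_Zp) (use m in auto)
      then have "y 0 = 1 mod int p"
        using m by (simp add: add_pow_Zp Zp_one mod_simps)
      then have "y \<in> Units Z"
        using unit_if_residue_nonzero yc p_gt_1 by simp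
      then obtain w where w: "w \<in> carrier Z" "w \<otimes>\<^bsub>Z\<^esub> y = \<one>\<^bsub>Z\<^esub>"
        using R.Units_l_inv R.Units_inv_closed by blast
      have tc: "t \<in> carrier L" using t E_carrier by blast
      have "\<zeta> [^] k = \<zeta> [^] k \<otimes> (P 1 \<otimes> t)" using one by simp
      also have "\<dots> = P 1 \<otimes> (\<zeta> [^] k \<otimes> t)" using tc by (simp add: L.m_lcomm)
      also have "\<dots> = P 1 \<otimes> m \<oplus> \<phi> ([p] \<cdot>\<^bsub>Z\<^esub> z) \<otimes> \<zeta> [^] k"
        unfolding m(1) using mc m(3)
        by (simp add: L.r_distr phi_add_pow L.add_pow_ldistr)
      finally have e: "\<zeta> [^] k = P 1 \<otimes> m \<oplus> \<phi> ([p] \<cdot>\<^bsub>Z\<^esub> z) \<otimes> \<zeta> [^] k" .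
      have "\<phi> y = \<one> \<ominus> \<phi> ([p] \<cdot>\<^bsub>Z\<^esub> z)"
        using m by (simp add: y_def a_minus_def)
      then have "\<phi> y \<otimes> \<zeta> [^] k = \<zeta> [^] k \<ominus> \<phi> ([p] \<cdot>\<^bsub>Z\<^esub> z) \<otimes> \<zeta> [^] k"
        using m by (simp add: a_minus_def L.l_distr L.l_minus)
      also have "\<dots> = P 1 \<otimes> m"
        by (subst e) (use mc m(3) in \<open>simp add: a_minus_def L.a_assoc L.r_neg\<close>)
      finally have "\<phi> w \<otimes> (\<phi> y \<otimes> \<zeta> [^] k) = \<phi> w \<otimes> (P 1 \<otimes> m)" by simp
      moreover have "\<phi> w \<otimes> \<phi> y = \<one>" using w yc phi.hom_mult [of w y] by simp
      ultimately have "\<zeta> [^] k = \<phi> w \<otimes> (P 1 \<otimes> m)"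
        using w(1) yc by (simp add: L.m_assoc [symmetric])
      also have "P 1 \<otimes> m = \<phi> ([(p ^ 1)] \<cdot>\<^bsub>Z\<^esub> \<one>\<^bsub>Z\<^esub>) \<otimes> m" by (simp add: phi_add_pow)
      finally have zk: "\<zeta> [^] k \<in> span k"
        using span_scalar [OF span_scalar [OF m(2)]] w(1) by simp
      have "span (Suc k) \<subseteq> span k"
        using span_add span_scalar [OF zk] by auto
      then show ?thesis using Suc k by (auto simp: k_def)
    qed
  qed
  \<comment> \<open>All generators are gone: \<open>E\<close> would be contained in
    \<open>span 0\<close>, which is zero, yet it contains 1.\<close>
  from this [of p] show False using E_closed(2) by auto
qed

text \<open>A nonzero x divides some p^n; being divisible by p^(n+1) as well, it would make p
  invertible.\<close>

lemma E_separated: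
  assumes x: "x \<in> E" and "\<And>m. \<exists>w\<in>E. x = P m \<otimes> w"
  shows "x = \<zero>"
proof (rule ccontr)
  assume "x \<noteq> \<zero>"
  then obtain e n where e: "e \<in> E" "x \<otimes> e = P n" using divides_p_power x by blast
  obtain w where w: "w \<in> E" "x = P (Suc n) \<otimes> w" using assms(2) by blast
  have c: "e \<in> carrier L" "w \<in> carrier L" using e w E_carrier by auto
  have "P n \<otimes> (P 1 \<otimes> (w \<otimes> e)) = P (n + 1) \<otimes> w \<otimes> e"
    unfolding P_add using c by (simp add: L.m_assoc)
  also have "\<dots> = P n \<otimes> \<one>" using e w by simp
  finally have "P 1 \<otimes> (w \<otimes> e) = \<one>"
    using P_nonzero [of n] c by (subst (asm) L.m_lcancel) auto
  then show False using p_not_unit E_closed(4) w e by blast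
qed

section \<open>Adjacency in the group of maximal class\<close>

lemma translation_part_scalar:
  assumes S: "subgroup S ext.G" and x: "x \<in> ext.translation_part S" and z: "z \<in> carrier Z"
  shows "\<phi> z \<otimes> x \<in> ext.translation_part S"
proof (rule ext.translation_part_scale [OF prime_p S x z, of "\<lambda>z. \<phi> z \<otimes> x"])
  have xE: "x \<in> E" using ext.translation_part_carrier [OF x] by simp
  fix w assume w: "w \<in> carrier Z"
  show "\<phi> w \<otimes> x \<in> carrier DN"
    using xE w phi_in_E E_closed(4) by simp
  fix k m :: nat
  show "\<phi> ([k] \<cdot>\<^bsub>Z\<^esub> \<one>\<^bsub>Z\<^esub> \<oplus>\<^bsub>Z\<^esub> [(p ^ m)] \<cdot>\<^bsub>Z\<^esub> w) \<otimes> x =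
      x [^]\<^bsub>DN\<^esub> k \<otimes>\<^bsub>DN\<^esub> (\<phi> w \<otimes> x) [^]\<^bsub>DN\<^esub> (p ^ m)"
    using w E_carrier [OF xE] by (simp add: D_pow phi_add_pow L.l_distr L.add_pow_ldistr)
qed

text \<open>As k is nonzero modulo the prime p, a power of \<zeta>^k equals \<zeta>. So the
  translations are stable under \<zeta> and under p-adic scalars, hence form an ideal of the ring
  \<open>E\<close>.\<close>

lemma translation_part_ideal:
  assumes S: "subgroup S ext.G" and bk: "(b, k) \<in> S" "k \<noteq> 0"
    and x: "x \<in> ext.translation_part S" and e: "e \<in> E"
  shows "e \<otimes> x \<in> ext.translation_part S"
proof -
  have "k \<in> {0..<int p}"
    using subgroup.subset [OF S] bk p_gt_1 by (auto simp: carrier_integer_mod_group)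
  then have k: "0 < nat k" "nat k < p" using bk by auto
  then have "\<not> p dvd nat k" using dvd_imp_le by fastforce
  then have "coprime (nat k) p"
    using prime_imp_coprime [OF prime_p] coprime_commute by blast
  then obtain j where "[nat k * j = Suc 0] (mod p)"
    using cong_solve_coprime_nat by blast
  then have j: "\<zeta> [^] (nat k * j) = \<zeta>"
    using zeta_pow_mod [of "nat k * j"] p_gt_1 by (simp add: cong_def)
  have zeta: "\<zeta> \<otimes> y \<in> ext.translation_part S" if y: "y \<in> ext.translation_part S" for y
  proof -
    have yc: "y \<in> carrier L" using ext.translation_part_carrier [OF y] E_carrier by simp
    have "\<zeta> [^] (nat k * i) \<otimes> y \<in> ext.translation_part S" for i
    proof (induction i)
      case 0
      then show ?case using y yc by simp
    next
      case (Suc i)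
      have "\<zeta> [^] nat k \<otimes> (\<zeta> [^] (nat k * i) \<otimes> y) \<in> ext.translation_part S"
        using ext.translation_part_act [OF S Suc.IH bk(1)] .
      also have "\<zeta> [^] nat k \<otimes> (\<zeta> [^] (nat k * i) \<otimes> y) = \<zeta> [^] (nat k * Suc i) \<otimes> y"
        using yc by (simp add: L.nat_pow_mult [symmetric] L.m_assoc)
      finally show ?case .
    qed
    from this [of j] show ?thesis by (simp add: j)
  qed
  have xc: "x \<in> carrier L" using ext.translation_part_carrier [OF x] E_carrier by simp
  show ?thesis
    using e
  proof (induction rule: L.simple_extension.induct)
    case zero
    then show ?case using ext.translation_part_one [OF S] xc by simp
  next
    case (lin s t)
    then obtain z where z: "z \<in> carrier Z" "t = \<phi> z" by auto
    have "s \<in> carrier L" using lin E_carrier by blast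
    then have "(s \<otimes> \<zeta> \<oplus> t) \<otimes> x = \<zeta> \<otimes> (s \<otimes> x) \<oplus> \<phi> z \<otimes> x"
      using z xc by (simp add: L.l_distr L.r_distr L.m_ac)
    then show ?case
      using ext.translation_part_mult [OF S zeta [OF lin.IH] translation_part_scalar [OF S x z(1)]]
      by simp
  qed
qed

text \<open>The translations form an ideal containing the nonzero a, and by
  \<open>divides_p_power\<close> such an ideal contains a power of p.\<close>

lemma virt_adj_translation:
  assumes "a \<in> E" "a \<noteq> \<zero>" "b \<in> E" "k \<in> carrier (integer_mod_group p)" "k \<noteq> 0"
  shows "virt_adj ext.G ext.T (a, 0) (b, k)"
proof (rule ext.virt_adj_if_translation_part)
  fix S assume S: "subgroup S ext.G" "(a, 0) \<in> S" "(b, k) \<in> S"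
  have a: "a \<in> ext.translation_part S"
    using ext.translation_part_incl [of a S] S assms by simp
  obtain e n where e: "e \<in> E" "a \<otimes> e = P n" using divides_p_power assms by blast
  have "v [^]\<^bsub>DN\<^esub> (p ^ n) \<in> ext.translation_part S" if v: "v \<in> E" for v
  proof -
    have "v [^]\<^bsub>DN\<^esub> (p ^ n) = (e \<otimes> v) \<otimes> a"
      using v e assms E_carrier add_pow_eq_mult [of v "p ^ n"]
      by (simp add: D_pow L.m_ac flip: e(2))
    then show ?thesis
      using translation_part_ideal [OF S(1,3) assms(5) a] E_closed(4) v e by simp
  qed
  then show "\<exists>n. \<forall>v\<in>carrier DN. v [^]\<^bsub>DN\<^esub> (p ^ n) \<in> ext.translation_part S"
    by auto
qed (use assms in auto)

text \<open>Both elements fix the origin, so the obstruction applies with the zero sublattice. That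
  it is closed is \<open>E_separated\<close>.\<close>

lemma not_virt_adj_complement: "\<not> virt_adj ext.G ext.T (\<zero>, k) (\<zero>, l)"
proof
  assume adj: "virt_adj ext.G ext.T (\<zero>, k) (\<zero>, l)"
  have "\<not> virt_adj ext.G ext.T (\<zero>, k) (\<zero>, l)"
  proof (rule ext.not_virt_adj_if_fixed_point [where A = "{\<zero>}" and k = 1 and u = \<zero>])
    show "subgroup {\<zero>} DN"
      using ext.N.triv_subgroup by simp
    show "ext.padic_closed {\<zero>}"
      unfolding ext.padic_closed_def
    proof (intro ballI impI)
      fix v assume v: "v \<in> carrier DN"
        and *: "\<forall>m. \<exists>w\<in>carrier DN. v \<otimes>\<^bsub>DN\<^esub> w [^]\<^bsub>DN\<^esub> (p ^ m) \<in> {\<zero>}"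
      have "\<exists>w\<in>E. v = P m \<otimes> w" for m
      proof -
        obtain w where w: "w \<in> E" "v \<oplus> [(p ^ m)] \<cdot> w = \<zero>"
          using * by (fastforce simp: D_pow)
        have c: "v \<in> carrier L" "w \<in> carrier L" using v w E_carrier by auto
        then have "v = \<ominus> ([(p ^ m)] \<cdot> w)"
          using L.minus_equality [OF w(2)] by simp
        also have "\<dots> = P m \<otimes> (\<ominus> w)"
          using c by (subst add_pow_eq_mult) (auto simp: L.r_minus)
        finally show ?thesis using E_closed(3) w by blast
      qed
      then show "v \<in> {\<zero>}" using E_separated v by simp
    qed
    fix n show "\<exists>v\<in>carrier DN. v [^]\<^bsub>DN\<^esub> (p ^ n) \<notin> {\<zero>}"
      using P_nonzero E_closed(2) by (auto simp: D_pow intro!: bexI [of _ \<one>])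
  next
    fix v assume v: "v \<in> carrier DN"
    have "\<zeta> [^] n \<otimes> v = \<zero> \<longleftrightarrow> v = \<zero>" for n :: nat
    proof -
      have "\<zeta> [^] n \<noteq> \<zero>"
        using L.Units_pow_closed [OF zeta_unit, of n] L.field_Units by auto
      then show ?thesis
        using v E_carrier [of v] L.integral_iff [of "\<zeta> [^] n" v] by simp
    qed
    then show "(\<zeta> [^] nat k \<otimes> v \<in> {\<zero>}) = (v \<in> {\<zero>})" "(\<zeta> [^] nat l \<otimes> v \<in> {\<zero>}) = (v \<in> {\<zero>})"
      by simp_all
  qed (use E_closed(1) E_carrier in \<open>auto simp: D_inv\<close>)
  then show False using adj by blast
qed

text \<open>For p = 2 one has \<zeta> = -1 and the lattice has rank one, so the translation by 1
  alone generates an open subgroup. Hence the identity is a vertex; it replaces the second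
  nontrivial element of the cyclic group that the lower bound uses for odd p.\<close>

lemma virt_adj_one_if_p_eq_2:
  assumes "p = 2"
  shows "virt_adj ext.G ext.T (\<zero>, 0) (\<one>, 0)"
proof (rule ext.virt_adj_if_translation_part)
  have "\<zeta> \<otimes> \<zeta> = \<one>"
    using zeta_pow_p assms by (simp add: numeral_2_eq_2)
  then have "\<zeta> = \<ominus> \<one>"
    using L.square_eq_one [of \<zeta>] zeta_neq_one by simp
  then have "\<zeta> = \<phi> (\<ominus>\<^bsub>Z\<^esub> \<one>\<^bsub>Z\<^esub>)" by simp
  then have "\<zeta> \<in> \<phi> ` carrier Z"
    using R.a_inv_closed [OF R.one_closed] by blast
  then have "E \<subseteq> \<phi> ` carrier Z"
    by (intro L.simple_extension_subring_incl [OF image_subring] subset_refl)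
  moreover
  fix S assume S: "subgroup S ext.G" "(\<one>, 0) \<in> S"
  have "\<one> \<in> ext.translation_part S"
    using ext.translation_part_incl [of \<one> S] S E_closed(2) by simp
  then have "\<phi> z \<in> ext.translation_part S" if "z \<in> carrier Z" for z
    using translation_part_scalar [OF S(1) _ that, of \<one>] that by simp
  ultimately have "v [^]\<^bsub>DN\<^esub> (p ^ 0) \<in> ext.translation_part S" if "v \<in> E" for v
    using that E_carrier by (auto simp: D_pow)
  then show "\<exists>n. \<forall>v\<in>carrier DN. v [^]\<^bsub>DN\<^esub> (p ^ n) \<in> ext.translation_part S"
    by (metis DN_simps(1))
qed (use E_closed in auto)

lemma diameter_max_class:
  "graph_diameter (proper_virt_gen_graph (max_class_group p L \<phi> \<zeta>)
     (max_class_topology p L \<phi> \<zeta>)) = 2"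
  unfolding group_eq topology_eq
proof -
  let ?adj = "virt_adj ext.G ext.T"
  have one: "1 \<in> carrier (integer_mod_group p)" "(\<one>::'a) \<noteq> \<zero>" "\<one> \<in> E" "\<zero> \<in> E"
    using p_gt_1 E_closed by auto
  have upper: "?adj x y \<or> (\<exists>z. ?adj x z \<and> ?adj z y)" if "?adj x x'" "?adj y y'" for x y x' y'
  proof -
    have c: "x \<in> carrier ext.G" "y \<in> carrier ext.G" using that by (auto simp: virt_adj_def)
    obtain a k b l where xy: "x = (a, k)" "y = (b, l)" by fastforce
    \<comment> \<open>Two nontrivial translations share the neighbour (0, 1), two elements that are
      no translations share (1, 0), and a mixed pair is adjacent. The identity is the one remaining
      translation.\<close>
    consider "x = \<one>\<^bsub>ext.G\<^esub>" | "y = \<one>\<^bsub>ext.G\<^esub>" | "k = 0" "a \<noteq> \<zero>" "l = 0" "b \<noteq> \<zero>"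
      | "k = 0" "a \<noteq> \<zero>" "l \<noteq> 0" | "k \<noteq> 0" "l = 0" "b \<noteq> \<zero>" | "k \<noteq> 0" "l \<noteq> 0"
      using xy by auto
    then show ?thesis
    proof cases
      case 1
      then show ?thesis using ext.virt_adj_one that c by blast
    next
      case 2
      then show ?thesis using ext.virt_adj_one that c virt_adj_sym by metis
    next
      case 3
      then show ?thesis
        using virt_adj_translation [of a \<zero> 1] virt_adj_translation [of b \<zero> 1, THEN virt_adj_commute]
          c one xy by auto
    next
      case 4
      then show ?thesis
        using virt_adj_translation c xy by simp
    next
      case 5
      then show ?thesis
        using virt_adj_translation [of b a k, THEN virt_adj_commute] c xy by auto
    next
      case 6
      then show ?thesis
        using virt_adj_translation [of \<one> a k, THEN virt_adj_commute]
          virt_adj_translation [of \<one> b l] c one xy by auto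
    qed
  qed
  show "graph_diameter (proper_virt_gen_graph ext.G ext.T) = 2"
  proof (cases "p = 2")
    case True
    show ?thesis
    proof (rule virt_diameter_eq_2)
      show "?adj (\<zero>, 0) (\<one>, 0)" by (rule virt_adj_one_if_p_eq_2 [OF True])
      show "?adj (\<zero>, 1) (\<one>, 0)"
        using virt_adj_translation [of \<one> \<zero> 1, THEN virt_adj_commute] one by simp
    qed (use upper not_virt_adj_complement in auto)
  next
    case False
    then have "2 \<in> carrier (integer_mod_group p)"
      using p_gt_1 by (auto simp: carrier_integer_mod_group)
    show ?thesis
    proof (rule virt_diameter_eq_2)
      show "?adj (\<zero>, 1) (\<one>, 0)" "?adj (\<zero>, 2) (\<one>, 0)"
        using virt_adj_translation [of \<one> \<zero>, THEN virt_adj_commute] one \<open>2 \<in> _\<close> by simp_all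
    qed (use upper not_virt_adj_complement in auto)
  qed
qed

end

section \<open>The group of the quaternion lattice\<close>

context padic begin

abbreviation HZ where "HZ \<equiv> quat Z"

lemma quat_simps:
  "(a, b, c, d) \<in> carrier HZ \<longleftrightarrow>
     a \<in> carrier Z \<and> b \<in> carrier Z \<and> c \<in> carrier Z \<and> d \<in> carrier Z"
  "(a, b, c, d) \<otimes>\<^bsub>HZ\<^esub> (a', b', c', d') =
     (a \<otimes>\<^bsub>Z\<^esub> a' \<ominus>\<^bsub>Z\<^esub> b \<otimes>\<^bsub>Z\<^esub> b' \<ominus>\<^bsub>Z\<^esub> c \<otimes>\<^bsub>Z\<^esub> c' \<ominus>\<^bsub>Z\<^esub> d \<otimes>\<^bsub>Z\<^esub> d',
      a \<otimes>\<^bsub>Z\<^esub> b' \<oplus>\<^bsub>Z\<^esub> b \<otimes>\<^bsub>Z\<^esub> a' \<oplus>\<^bsub>Z\<^esub> c \<otimes>\<^bsub>Z\<^esub> d' \<ominus>\<^bsub>Z\<^esub> d \<otimes>\<^bsub>Z\<^esub> c',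
      a \<otimes>\<^bsub>Z\<^esub> c' \<ominus>\<^bsub>Z\<^esub> b \<otimes>\<^bsub>Z\<^esub> d' \<oplus>\<^bsub>Z\<^esub> c \<otimes>\<^bsub>Z\<^esub> a' \<oplus>\<^bsub>Z\<^esub> d \<otimes>\<^bsub>Z\<^esub> b',
      a \<otimes>\<^bsub>Z\<^esub> d' \<oplus>\<^bsub>Z\<^esub> b \<otimes>\<^bsub>Z\<^esub> c' \<ominus>\<^bsub>Z\<^esub> c \<otimes>\<^bsub>Z\<^esub> b' \<oplus>\<^bsub>Z\<^esub> d \<otimes>\<^bsub>Z\<^esub> a')"
  "(a, b, c, d) \<oplus>\<^bsub>HZ\<^esub> (a', b', c', d') =
     (a \<oplus>\<^bsub>Z\<^esub> a', b \<oplus>\<^bsub>Z\<^esub> b', c \<oplus>\<^bsub>Z\<^esub> c', d \<oplus>\<^bsub>Z\<^esub> d')"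
  "\<one>\<^bsub>HZ\<^esub> = (\<one>\<^bsub>Z\<^esub>, \<zero>\<^bsub>Z\<^esub>, \<zero>\<^bsub>Z\<^esub>, \<zero>\<^bsub>Z\<^esub>)"
  "\<zero>\<^bsub>HZ\<^esub> = (\<zero>\<^bsub>Z\<^esub>, \<zero>\<^bsub>Z\<^esub>, \<zero>\<^bsub>Z\<^esub>, \<zero>\<^bsub>Z\<^esub>)"
  by (auto simp: quat_def)

lemma quat_carrierE:
  assumes "x \<in> carrier HZ"
  obtains a b c d where "x = (a, b, c, d)"
    "a \<in> carrier Z" "b \<in> carrier Z" "c \<in> carrier Z" "d \<in> carrier Z"
  using assms by (cases x) (auto simp: quat_simps)

lemma quat_ring: "ring HZ"
proof (rule ringI)
  show "abelian_group HZ"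
  proof (rule abelian_groupI)
    fix x assume "x \<in> carrier HZ"
    then obtain a b c d where x: "x = (a, b, c, d)"
      "a \<in> carrier Z" "b \<in> carrier Z" "c \<in> carrier Z" "d \<in> carrier Z"
      by (rule quat_carrierE)
    then have "(\<ominus>\<^bsub>Z\<^esub> a, \<ominus>\<^bsub>Z\<^esub> b, \<ominus>\<^bsub>Z\<^esub> c, \<ominus>\<^bsub>Z\<^esub> d) \<oplus>\<^bsub>HZ\<^esub> x = \<zero>\<^bsub>HZ\<^esub>"
      by (simp add: quat_simps R.l_neg)
    then show "\<exists>y\<in>carrier HZ. y \<oplus>\<^bsub>HZ\<^esub> x = \<zero>\<^bsub>HZ\<^esub>"
      using x by (metis R.a_inv_closed quat_simps(1))
  qed (auto simp: quat_simps R.a_ac elim!: quat_carrierE)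
  show "monoid HZ"
  proof (rule monoidI)
    fix x y z assume "x \<in> carrier HZ" "y \<in> carrier HZ" "z \<in> carrier HZ"
    then show "(x \<otimes>\<^bsub>HZ\<^esub> y) \<otimes>\<^bsub>HZ\<^esub> z = x \<otimes>\<^bsub>HZ\<^esub> (y \<otimes>\<^bsub>HZ\<^esub> z)"
      by (elim quat_carrierE)
        (simp add: quat_simps fun_eq_iff Zp_apply mod_simps del: power_Suc,
         simp add: algebra_simps del: power_Suc)
  qed (auto simp: quat_simps a_minus_def elim!: quat_carrierE)
  fix x y z assume "x \<in> carrier HZ" "y \<in> carrier HZ" "z \<in> carrier HZ"
  then show "(x \<oplus>\<^bsub>HZ\<^esub> y) \<otimes>\<^bsub>HZ\<^esub> z = x \<otimes>\<^bsub>HZ\<^esub> z \<oplus>\<^bsub>HZ\<^esub> y \<otimes>\<^bsub>HZ\<^esub> z"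
    "z \<otimes>\<^bsub>HZ\<^esub> (x \<oplus>\<^bsub>HZ\<^esub> y) = z \<otimes>\<^bsub>HZ\<^esub> x \<oplus>\<^bsub>HZ\<^esub> z \<otimes>\<^bsub>HZ\<^esub> y"
    by (elim quat_carrierE;
        simp add: quat_simps fun_eq_iff Zp_apply mod_simps del: power_Suc,
        simp add: algebra_simps del: power_Suc)+
qed

sublocale Q: ring HZ by (rule quat_ring)

lemma quat_minus:
  assumes "a \<in> carrier Z" "b \<in> carrier Z" "c \<in> carrier Z" "d \<in> carrier Z"
  shows "\<ominus>\<^bsub>HZ\<^esub> (a, b, c, d) = (\<ominus>\<^bsub>Z\<^esub> a, \<ominus>\<^bsub>Z\<^esub> b, \<ominus>\<^bsub>Z\<^esub> c, \<ominus>\<^bsub>Z\<^esub> d)"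
  using assms by (intro Q.minus_equality) (auto simp: quat_simps R.l_neg)

definition qi where "qi = (\<zero>\<^bsub>Z\<^esub>, \<one>\<^bsub>Z\<^esub>, \<zero>\<^bsub>Z\<^esub>, \<zero>\<^bsub>Z\<^esub>)"
definition qj where "qj = (\<zero>\<^bsub>Z\<^esub>, \<zero>\<^bsub>Z\<^esub>, \<one>\<^bsub>Z\<^esub>, \<zero>\<^bsub>Z\<^esub>)"
definition qk where "qk = (\<zero>\<^bsub>Z\<^esub>, \<zero>\<^bsub>Z\<^esub>, \<zero>\<^bsub>Z\<^esub>, \<one>\<^bsub>Z\<^esub>)"

lemma qijk_closed [simp]: "qi \<in> carrier HZ" "qj \<in> carrier HZ" "qk \<in> carrier HZ"
  by (simp_all add: qi_def qj_def qk_def quat_simps)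

lemma qijk_mult [simp]:
  "qi \<otimes>\<^bsub>HZ\<^esub> qi = \<ominus>\<^bsub>HZ\<^esub> \<one>\<^bsub>HZ\<^esub>" "qj \<otimes>\<^bsub>HZ\<^esub> qj = \<ominus>\<^bsub>HZ\<^esub> \<one>\<^bsub>HZ\<^esub>" "qk \<otimes>\<^bsub>HZ\<^esub> qk = \<ominus>\<^bsub>HZ\<^esub> \<one>\<^bsub>HZ\<^esub>"
  "qi \<otimes>\<^bsub>HZ\<^esub> qj = qk" "qj \<otimes>\<^bsub>HZ\<^esub> qk = qi" "qk \<otimes>\<^bsub>HZ\<^esub> qi = qj"
  "qj \<otimes>\<^bsub>HZ\<^esub> qi = \<ominus>\<^bsub>HZ\<^esub> qk" "qk \<otimes>\<^bsub>HZ\<^esub> qj = \<ominus>\<^bsub>HZ\<^esub> qi" "qi \<otimes>\<^bsub>HZ\<^esub> qk = \<ominus>\<^bsub>HZ\<^esub> qj"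
  by (simp_all add: qi_def qj_def qk_def quat_simps quat_minus a_minus_def)

lemma one_neq_minus_one: "\<one>\<^bsub>Z\<^esub> \<noteq> \<ominus>\<^bsub>Z\<^esub> \<one>\<^bsub>Z\<^esub>"
proof
  assume "\<one>\<^bsub>Z\<^esub> = \<ominus>\<^bsub>Z\<^esub> \<one>\<^bsub>Z\<^esub>"
  then have "\<one>\<^bsub>Z\<^esub> \<oplus>\<^bsub>Z\<^esub> \<one>\<^bsub>Z\<^esub> = \<zero>\<^bsub>Z\<^esub>" by (metis R.l_neg R.one_closed)
  then show False using torsion_free [of "\<one>\<^bsub>Z\<^esub>" 2] by (simp add: numeral_2_eq_2)
qed

lemma qijk_distinct:
  "qi \<noteq> qj" "qi \<noteq> qk" "qj \<noteq> qk" "qi \<noteq> \<ominus>\<^bsub>HZ\<^esub> qi" "qj \<noteq> \<ominus>\<^bsub>HZ\<^esub> qi" "qk \<noteq> \<ominus>\<^bsub>HZ\<^esub> qi"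
  "qi \<noteq> \<ominus>\<^bsub>HZ\<^esub> qj" "qj \<noteq> \<ominus>\<^bsub>HZ\<^esub> qj" "qk \<noteq> \<ominus>\<^bsub>HZ\<^esub> qj"
  "qi \<noteq> \<ominus>\<^bsub>HZ\<^esub> qk" "qj \<noteq> \<ominus>\<^bsub>HZ\<^esub> qk" "qk \<noteq> \<ominus>\<^bsub>HZ\<^esub> qk"
  using one_neq_minus_one by (auto simp: qi_def qj_def qk_def quat_minus)

text \<open>The elements of order 4, that is, those of \<open>Q8\<close> outside its centre.\<close>

definition pure_units where
  "pure_units = {qi, qj, qk, \<ominus>\<^bsub>HZ\<^esub> qi, \<ominus>\<^bsub>HZ\<^esub> qj, \<ominus>\<^bsub>HZ\<^esub> qk}"

lemma Q8_simps [simp]: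
  "carrier (Q8 Z) = {\<one>\<^bsub>HZ\<^esub>, \<ominus>\<^bsub>HZ\<^esub> \<one>\<^bsub>HZ\<^esub>} \<union> pure_units"
  "monoid.mult (Q8 Z) = monoid.mult HZ" "one (Q8 Z) = one HZ"
  by (auto simp: Q8_def quat_basis_def pure_units_def qi_def qj_def qk_def quat_simps)

lemma pure_units_closed: "g \<in> pure_units \<Longrightarrow> g \<in> carrier HZ"
  by (auto simp: pure_units_def)

lemma Q8_closed: "g \<in> carrier (Q8 Z) \<Longrightarrow> g \<in> carrier HZ"
  by (auto simp: pure_units_def)

lemma pure_unit_square: "g \<in> pure_units \<Longrightarrow> g \<otimes>\<^bsub>HZ\<^esub> g = \<ominus>\<^bsub>HZ\<^esub> \<one>\<^bsub>HZ\<^esub>"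
  by (auto simp: pure_units_def Q.l_minus Q.r_minus)

lemma pure_unit_minus: "g \<in> pure_units \<Longrightarrow> \<ominus>\<^bsub>HZ\<^esub> g \<in> pure_units"
  by (auto simp: pure_units_def)

lemma minus_one_square: "\<ominus>\<^bsub>HZ\<^esub> \<one>\<^bsub>HZ\<^esub> \<otimes>\<^bsub>HZ\<^esub> \<ominus>\<^bsub>HZ\<^esub> \<one>\<^bsub>HZ\<^esub> = \<one>\<^bsub>HZ\<^esub>"
  by (simp add: Q.l_minus)

lemma group_Q8: "group (Q8 Z)"
proof (rule groupI)
  fix g h assume "g \<in> carrier (Q8 Z)" "h \<in> carrier (Q8 Z)"
  then show "g \<otimes>\<^bsub>Q8 Z\<^esub> h \<in> carrier (Q8 Z)"
    by (auto simp: pure_units_def Q.l_minus Q.r_minus)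
next
  fix g assume g: "g \<in> carrier (Q8 Z)"
  then consider "g \<in> {\<one>\<^bsub>HZ\<^esub>, \<ominus>\<^bsub>HZ\<^esub> \<one>\<^bsub>HZ\<^esub>}" | "g \<in> pure_units" by auto
  then show "\<exists>h\<in>carrier (Q8 Z). h \<otimes>\<^bsub>Q8 Z\<^esub> g = \<one>\<^bsub>Q8 Z\<^esub>"
  proof cases
    case 1
    then show ?thesis using minus_one_square by auto
  next
    case 2
    then show ?thesis
      using pure_unit_square pure_unit_minus pure_units_closed
      by (intro bexI [of _ "\<ominus>\<^bsub>HZ\<^esub> g"]) (auto simp: Q.l_minus)
  qed
qed (use Q8_closed in \<open>auto simp: Q.m_assoc simp del: Q8_simps(1)\<close>, simp)

definition QN where "QN = add_monoid HZ"

lemma QN_simps [simp]: "carrier QN = carrier HZ" "monoid.mult QN = add HZ" "one QN = zero HZ"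
  by (simp_all add: QN_def)

lemma QN_comm_group: "comm_group QN"
  unfolding QN_def by (rule Q.a_comm_group)

lemma QN_pow: "x [^]\<^bsub>QN\<^esub> (n::nat) = [n] \<cdot>\<^bsub>HZ\<^esub> x"
  by (simp add: add_pow_def nat_pow_def)

lemma QN_inv: "x \<in> carrier HZ \<Longrightarrow> inv\<^bsub>QN\<^esub> x = \<ominus>\<^bsub>HZ\<^esub> x"
  using group.inv_equality [OF comm_group.axioms(2) [OF QN_comm_group], of "\<ominus>\<^bsub>HZ\<^esub> x" x]
  by (simp add: Q.l_neg)

sublocale qext: lattice_extension QN "Q8 Z" "\<lambda>q v. q \<otimes>\<^bsub>HZ\<^esub> v" p
proof (intro lattice_extension.intro lattice_extension_axioms.intro)
  show "comm_group QN" by (rule QN_comm_group)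
  show "group (Q8 Z)" by (rule group_Q8)
qed (use Q8_closed in \<open>auto simp: Q.m_assoc Q.r_distr simp del: Q8_simps(1)\<close>)

lemma quat_group_eq: "quat_group p = qext.G"
  and quat_topology_eq: "quat_topology p = qext.T"
  by (simp_all add: quat_group_def quat_topology_def QN_def)

section \<open>Scalars, conjugation and the norm of quaternions\<close>

definition scalar where "scalar z = (z, \<zero>\<^bsub>Z\<^esub>, \<zero>\<^bsub>Z\<^esub>, \<zero>\<^bsub>Z\<^esub>)"

lemma scalar_closed [simp]: "z \<in> carrier Z \<Longrightarrow> scalar z \<in> carrier HZ"
  by (simp add: scalar_def quat_simps)

lemma scalar_hom:
  assumes "y \<in> carrier Z" "z \<in> carrier Z"
  shows "scalar (y \<oplus>\<^bsub>Z\<^esub> z) = scalar y \<oplus>\<^bsub>HZ\<^esub> scalar z"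
    "scalar (y \<otimes>\<^bsub>Z\<^esub> z) = scalar y \<otimes>\<^bsub>HZ\<^esub> scalar z"
  using assms by (auto simp: scalar_def quat_simps a_minus_def)

lemma scalar_one: "scalar \<one>\<^bsub>Z\<^esub> = \<one>\<^bsub>HZ\<^esub>"
  by (simp add: scalar_def quat_simps)

lemma scalar_add_pow: "z \<in> carrier Z \<Longrightarrow> scalar ([(n::nat)] \<cdot>\<^bsub>Z\<^esub> z) = [n] \<cdot>\<^bsub>HZ\<^esub> scalar z"
  by (induction n) (simp_all add: scalar_hom, simp add: scalar_def quat_simps)

fun qconj where "qconj (a, b, c, d) = (a, \<ominus>\<^bsub>Z\<^esub> b, \<ominus>\<^bsub>Z\<^esub> c, \<ominus>\<^bsub>Z\<^esub> d)"

fun qnorm where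
  "qnorm (a, b, c, d) = a \<otimes>\<^bsub>Z\<^esub> a \<oplus>\<^bsub>Z\<^esub> b \<otimes>\<^bsub>Z\<^esub> b \<oplus>\<^bsub>Z\<^esub> c \<otimes>\<^bsub>Z\<^esub> c \<oplus>\<^bsub>Z\<^esub> d \<otimes>\<^bsub>Z\<^esub> d"

lemma conj_closed [simp]: "v \<in> carrier HZ \<Longrightarrow> qconj v \<in> carrier HZ"
  and norm_closed [simp]: "v \<in> carrier HZ \<Longrightarrow> qnorm v \<in> carrier Z"
  by (auto simp: quat_simps elim!: quat_carrierE)

lemma conj_mult: "v \<in> carrier HZ \<Longrightarrow> qconj v \<otimes>\<^bsub>HZ\<^esub> v = scalar (qnorm v)"
  by (erule quat_carrierE)
    (simp add: scalar_def quat_simps fun_eq_iff Zp_apply mod_simps del: power_Suc)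

text \<open>If s and r both solve t (w - t) = N, the right-hand side vanishes; in a domain this
  leaves s = r or s = w - r.\<close>

lemma factor_identity:
  assumes "s \<in> carrier Z" "r \<in> carrier Z" "w \<in> carrier Z"
  shows "(s \<ominus>\<^bsub>Z\<^esub> r) \<otimes>\<^bsub>Z\<^esub> (s \<ominus>\<^bsub>Z\<^esub> (w \<ominus>\<^bsub>Z\<^esub> r)) =
    r \<otimes>\<^bsub>Z\<^esub> (w \<ominus>\<^bsub>Z\<^esub> r) \<ominus>\<^bsub>Z\<^esub> s \<otimes>\<^bsub>Z\<^esub> (w \<ominus>\<^bsub>Z\<^esub> s)"
  using assms
  by (simp add: fun_eq_iff Zp_apply mod_simps del: power_Suc)
    (simp add: algebra_simps del: power_Suc)

text \<open>The quaternions that multiply the translations into themselves form a subring containing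
  the scalars, g and h. Up to signs g, h and g h are i, j and k in some order, so this subring is
  everything.\<close>

lemma translation_part_left_ideal:
  assumes S: "subgroup S qext.G" and gh: "(a, g) \<in> S" "(b, h) \<in> S"
    and g: "g \<in> pure_units" "h \<in> pure_units" "g \<noteq> h" "g \<noteq> \<ominus>\<^bsub>HZ\<^esub> h"
    and x: "x \<in> qext.translation_part S" and qc: "q \<in> carrier HZ"
  shows "q \<otimes>\<^bsub>HZ\<^esub> x \<in> qext.translation_part S"
proof -
  let ?J = "qext.translation_part S"
  have J: "y \<in> carrier HZ" if "y \<in> ?J" for y
    using qext.translation_part_carrier [OF that] by simp
  define A where "A = {q \<in> carrier HZ. \<forall>y\<in>?J. q \<otimes>\<^bsub>HZ\<^esub> y \<in> ?J}"
  have A_mult: "q \<otimes>\<^bsub>HZ\<^esub> r \<in> A" if "q \<in> A" "r \<in> A" for q r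
    using that J by (auto simp: A_def Q.m_assoc)
  have A_add: "q \<oplus>\<^bsub>HZ\<^esub> r \<in> A" if "q \<in> A" "r \<in> A" for q r
    using that J qext.translation_part_mult [OF S] by (auto simp: A_def Q.l_distr)
  have A_minus: "\<ominus>\<^bsub>HZ\<^esub> q \<in> A" if "q \<in> A" for q
    using that J qext.translation_part_inv [OF S] by (auto simp: A_def Q.l_minus QN_inv)
  have "scalar z \<in> A" if z: "z \<in> carrier Z" for z
  proof -
    have "scalar z \<otimes>\<^bsub>HZ\<^esub> y \<in> ?J" if y: "y \<in> ?J" for y
      by (rule qext.translation_part_scale [OF prime_p S y z, of "\<lambda>z. scalar z \<otimes>\<^bsub>HZ\<^esub> y"])
        (use J [OF y] in \<open>simp_all add: QN_pow scalar_hom scalar_one scalar_add_pow Q.l_distr Q.add_pow_ldistr\<close>)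
    then show ?thesis using z by (simp add: A_def)
  qed
  moreover have gA: "g \<in> A" "h \<in> A"
    using g pure_units_closed qext.translation_part_act [OF S] gh by (auto simp: A_def)
  have "qi \<in> A \<and> qj \<in> A \<and> qk \<in> A"
  proof -
    have "{qi, qj, qk} \<subseteq> {g, \<ominus>\<^bsub>HZ\<^esub> g, h, \<ominus>\<^bsub>HZ\<^esub> h, g \<otimes>\<^bsub>HZ\<^esub> h, \<ominus>\<^bsub>HZ\<^esub> (g \<otimes>\<^bsub>HZ\<^esub> h)}"
      using g unfolding pure_units_def by (auto simp: Q.l_minus Q.r_minus)
    moreover have "{g, \<ominus>\<^bsub>HZ\<^esub> g, h, \<ominus>\<^bsub>HZ\<^esub> h, g \<otimes>\<^bsub>HZ\<^esub> h, \<ominus>\<^bsub>HZ\<^esub> (g \<otimes>\<^bsub>HZ\<^esub> h)} \<subseteq> A"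
      using gA A_minus A_mult by auto
    ultimately have "{qi, qj, qk} \<subseteq> A" by (rule subset_trans)
    then show ?thesis by simp
  qed
  ultimately have span: "scalar a \<oplus>\<^bsub>HZ\<^esub> (scalar b \<otimes>\<^bsub>HZ\<^esub> qi \<oplus>\<^bsub>HZ\<^esub> (scalar c \<otimes>\<^bsub>HZ\<^esub> qj \<oplus>\<^bsub>HZ\<^esub> scalar d \<otimes>\<^bsub>HZ\<^esub> qk)) \<in> A"
    if "a \<in> carrier Z" "b \<in> carrier Z" "c \<in> carrier Z" "d \<in> carrier Z" for a b c d
    using that by (intro A_add A_mult) auto
  obtain a b c d where abcd: "q = (a, b, c, d)"
    "a \<in> carrier Z" "b \<in> carrier Z" "c \<in> carrier Z" "d \<in> carrier Z"
    using quat_carrierE [OF qc] .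
  have q: "q = scalar a \<oplus>\<^bsub>HZ\<^esub> (scalar b \<otimes>\<^bsub>HZ\<^esub> qi \<oplus>\<^bsub>HZ\<^esub> (scalar c \<otimes>\<^bsub>HZ\<^esub> qj \<oplus>\<^bsub>HZ\<^esub> scalar d \<otimes>\<^bsub>HZ\<^esub> qk))"
    using abcd by (simp add: scalar_def qi_def qj_def qk_def quat_simps a_minus_def)
  have "q \<in> A"
    unfolding q by (rule span [OF abcd(2-5)])
  then show ?thesis using x by (simp add: A_def)
qed

lemma double_neq_zero: "[(2::nat)] \<cdot>\<^bsub>Z\<^esub> \<one>\<^bsub>Z\<^esub> \<noteq> \<zero>\<^bsub>Z\<^esub>"
  using torsion_free [of "\<one>\<^bsub>Z\<^esub>" 2] by auto

text \<open>The square of \<open>(a, g)\<close> is \<open>((1 + g) a, -1)\<close>, so the quotient of the two squares is the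
  translation by \<open>(1 + g) a - (1 + h) b\<close>.\<close>

lemma virt_adj_if_norm_nonzero:
  assumes g: "g \<in> pure_units" "h \<in> pure_units" "g \<noteq> h" "g \<noteq> \<ominus>\<^bsub>HZ\<^esub> h"
    and ab: "a \<in> carrier HZ" "b \<in> carrier HZ"
    and norm: "qnorm ((\<one>\<^bsub>HZ\<^esub> \<oplus>\<^bsub>HZ\<^esub> g) \<otimes>\<^bsub>HZ\<^esub> a \<ominus>\<^bsub>HZ\<^esub> (\<one>\<^bsub>HZ\<^esub> \<oplus>\<^bsub>HZ\<^esub> h) \<otimes>\<^bsub>HZ\<^esub> b) \<noteq> \<zero>\<^bsub>Z\<^esub>"
  shows "virt_adj qext.G qext.T (a, g) (b, h)"
proof (rule qext.virt_adj_if_translation_part)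
  fix S assume S: "subgroup S qext.G" "(a, g) \<in> S" "(b, h) \<in> S"
  have gc: "g \<in> carrier HZ" "h \<in> carrier HZ" using g pure_units_closed by auto
  define d where "d = (\<one>\<^bsub>HZ\<^esub> \<oplus>\<^bsub>HZ\<^esub> g) \<otimes>\<^bsub>HZ\<^esub> a \<ominus>\<^bsub>HZ\<^esub> (\<one>\<^bsub>HZ\<^esub> \<oplus>\<^bsub>HZ\<^esub> h) \<otimes>\<^bsub>HZ\<^esub> b"
  have dc: "d \<in> carrier HZ" using gc ab by (simp add: d_def)
  have "(a \<oplus>\<^bsub>HZ\<^esub> g \<otimes>\<^bsub>HZ\<^esub> a, \<ominus>\<^bsub>HZ\<^esub> \<one>\<^bsub>HZ\<^esub>) \<in> S"
    using subgroup.m_closed [OF S(1,2,2)] pure_unit_square g by simp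
  moreover have "(b \<oplus>\<^bsub>HZ\<^esub> h \<otimes>\<^bsub>HZ\<^esub> b, \<ominus>\<^bsub>HZ\<^esub> \<one>\<^bsub>HZ\<^esub>) \<in> S"
    using subgroup.m_closed [OF S(1,3,3)] pure_unit_square g by simp
  ultimately have "(a \<oplus>\<^bsub>HZ\<^esub> g \<otimes>\<^bsub>HZ\<^esub> a \<oplus>\<^bsub>HZ\<^esub> \<ominus>\<^bsub>HZ\<^esub> \<one>\<^bsub>HZ\<^esub> \<otimes>\<^bsub>HZ\<^esub> (b \<oplus>\<^bsub>HZ\<^esub> h \<otimes>\<^bsub>HZ\<^esub> b), \<one>\<^bsub>HZ\<^esub>) \<in> S"
    using subgroup.m_closed [OF S(1)] minus_one_square by fastforce
  moreover have "a \<oplus>\<^bsub>HZ\<^esub> g \<otimes>\<^bsub>HZ\<^esub> a \<oplus>\<^bsub>HZ\<^esub> \<ominus>\<^bsub>HZ\<^esub> \<one>\<^bsub>HZ\<^esub> \<otimes>\<^bsub>HZ\<^esub> (b \<oplus>\<^bsub>HZ\<^esub> h \<otimes>\<^bsub>HZ\<^esub> b) = d"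
    using ab gc by (simp add: d_def a_minus_def Q.l_distr Q.l_minus)
  ultimately have "d \<in> qext.translation_part S"
    using qext.translation_part_incl [of d S] dc by simp
  then have ideal: "q \<otimes>\<^bsub>HZ\<^esub> d \<in> qext.translation_part S" if "q \<in> carrier HZ" for q
    using translation_part_left_ideal [OF S g] that by blast
  \<comment> \<open>The product of the conjugate of d with d is its norm, so the left ideal
    generated by d contains the norm and with it a power of p.\<close>
  obtain y n where y: "y \<in> carrier Z" "y \<otimes>\<^bsub>Z\<^esub> qnorm d = [(p ^ n)] \<cdot>\<^bsub>Z\<^esub> \<one>\<^bsub>Z\<^esub>"
    using p_power_eq_multiple [of "qnorm d"] dc norm unfolding d_def by auto
  have "v [^]\<^bsub>QN\<^esub> (p ^ n) \<in> qext.translation_part S" if v: "v \<in> carrier HZ" for v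
  proof -
    have "v [^]\<^bsub>QN\<^esub> (p ^ n) = v \<otimes>\<^bsub>HZ\<^esub> scalar (y \<otimes>\<^bsub>Z\<^esub> qnorm d)"
      unfolding y(2) using v by (simp add: QN_pow scalar_add_pow scalar_one Q.add_pow_rdistr)
    also have "\<dots> = (v \<otimes>\<^bsub>HZ\<^esub> scalar y \<otimes>\<^bsub>HZ\<^esub> qconj d) \<otimes>\<^bsub>HZ\<^esub> d"
      using v y(1) dc by (simp add: scalar_hom conj_mult Q.m_assoc)
    finally show ?thesis
      using ideal v y(1) dc by simp
  qed
  then show "\<exists>n. \<forall>v\<in>carrier QN. v [^]\<^bsub>QN\<^esub> (p ^ n) \<in> qext.translation_part S"
    unfolding QN_simps(1) by blast
qed (use g ab pure_units_closed in auto)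

section \<open>Elements over the centre of the quaternion group are isolated\<close>

fun coordinate_form where
  "coordinate_form c (v0, v1, v2, v3) =
     c (0::nat) \<otimes>\<^bsub>Z\<^esub> v0 \<oplus>\<^bsub>Z\<^esub> c 1 \<otimes>\<^bsub>Z\<^esub> v1 \<oplus>\<^bsub>Z\<^esub> c 2 \<otimes>\<^bsub>Z\<^esub> v2 \<oplus>\<^bsub>Z\<^esub> c 3 \<otimes>\<^bsub>Z\<^esub> v3"

lemma coordinate_form_hom:
  assumes "\<And>j. j < 4 \<Longrightarrow> c j \<in> carrier Z"
  shows "coordinate_form c \<in> hom QN (add_monoid Z)"
proof (rule homI)
  have c: "c 0 \<in> carrier Z" "c 1 \<in> carrier Z" "c 2 \<in> carrier Z" "c 3 \<in> carrier Z"
    using assms by auto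
  then show "coordinate_form c v \<in> carrier (add_monoid Z)" if "v \<in> carrier QN" for v
    using that by (auto elim!: quat_carrierE)
  fix v w assume "v \<in> carrier QN" "w \<in> carrier QN"
  with c show "coordinate_form c (v \<otimes>\<^bsub>QN\<^esub> w) = coordinate_form c v \<otimes>\<^bsub>add_monoid Z\<^esub> coordinate_form c w"
    by (auto simp: quat_simps R.r_distr R.a_ac elim!: quat_carrierE)
qed

lemma coordinate_form_minus:
  assumes "\<And>j. j < 4 \<Longrightarrow> c j \<in> carrier Z" "v \<in> carrier HZ"
  shows "coordinate_form c (\<ominus>\<^bsub>HZ\<^esub> v) = \<ominus>\<^bsub>Z\<^esub> coordinate_form c v"
  using assms(2) assms(1) [of 0] assms(1) [of 1] assms(1) [of 2] assms(1) [of 3]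
  by (auto elim!: quat_carrierE simp: quat_minus R.r_minus R.minus_add)

text \<open>Vanishing at v and w imposes two equations on four coefficients. A basis vector
  belonging to a nonzero coefficient serves as \<open>x\<close>.\<close>

lemma exists_annihilating_form:
  assumes "v \<in> carrier HZ" "w \<in> carrier HZ"
  obtains c x where "\<And>j. j < 4 \<Longrightarrow> c j \<in> carrier Z"
    "coordinate_form c v = \<zero>\<^bsub>Z\<^esub>" "coordinate_form c w = \<zero>\<^bsub>Z\<^esub>"
    "x \<in> carrier HZ" "coordinate_form c x \<noteq> \<zero>\<^bsub>Z\<^esub>"
proof -
  obtain v0 v1 v2 v3 where v: "v = (v0, v1, v2, v3)"
    "v0 \<in> carrier Z" "v1 \<in> carrier Z" "v2 \<in> carrier Z" "v3 \<in> carrier Z"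
    using quat_carrierE [OF assms(1)] .
  obtain w0 w1 w2 w3 where w: "w = (w0, w1, w2, w3)"
    "w0 \<in> carrier Z" "w1 \<in> carrier Z" "w2 \<in> carrier Z" "w3 \<in> carrier Z"
    using quat_carrierE [OF assms(2)] .
  define A where "A i j = (if i = (0::nat) then [v0, v1, v2, v3] ! j else [w0, w1, w2, w3] ! j)" for i j
  have "\<exists>c\<in>{0,1,2,3} \<rightarrow> carrier Z. (\<exists>j\<in>{0,1,2,3::nat}. c j \<noteq> \<zero>\<^bsub>Z\<^esub>) \<and>
      (\<forall>i\<in>{0,1}. (\<Oplus>\<^bsub>Z\<^esub>j\<in>{0,1,2,3}. A i j \<otimes>\<^bsub>Z\<^esub> c j) = \<zero>\<^bsub>Z\<^esub>)"
    by (rule R.exists_nontrivial_solution) (use v w in \<open>auto simp: A_def\<close>)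
  then obtain c where c: "c \<in> {0,1,2,3} \<rightarrow> carrier Z" "\<exists>j\<in>{0,1,2,3::nat}. c j \<noteq> \<zero>\<^bsub>Z\<^esub>"
      "\<And>i. i \<in> {0,1} \<Longrightarrow> (\<Oplus>\<^bsub>Z\<^esub>j\<in>{0,1,2,3}. A i j \<otimes>\<^bsub>Z\<^esub> c j) = \<zero>\<^bsub>Z\<^esub>"
    by blast
  have cc: "c 0 \<in> carrier Z" "c 1 \<in> carrier Z" "c 2 \<in> carrier Z" "c 3 \<in> carrier Z" "c (Suc 0) \<in> carrier Z"
    using c(1) by auto
  have "c j \<in> carrier Z" if "j < 4" for j
  proof -
    have "j \<in> {0,1,2,3}" using that by auto
    then show ?thesis using c(1) by blast
  qed
  moreover have "coordinate_form c v = \<zero>\<^bsub>Z\<^esub>" "coordinate_form c w = \<zero>\<^bsub>Z\<^esub>"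
    using c(3) [of 0] c(3) [of 1] cc v w by (simp_all add: A_def R.m_comm R.a_assoc)
  moreover have "\<exists>x\<in>carrier HZ. coordinate_form c x \<noteq> \<zero>\<^bsub>Z\<^esub>"
    using c(2) cc
    by (auto intro: bexI [of _ "\<one>\<^bsub>HZ\<^esub>"] bexI [of _ qi] bexI [of _ qj] bexI [of _ qk]
        simp: qi_def qj_def qk_def quat_simps)
  ultimately show ?thesis using that by blast
qed

text \<open>Since g acts as 1 or -1, only stability under h restricts the sublattice. At a fixed
  point of (b, h) the other element misses being fixed by some vector d, and d and h d span at most
  a plane, so a form f kills both. The common kernel of f and f h is stable because h squares to 1
  or -1.\<close>

lemma central_isolated:
  assumes g: "g \<in> {\<one>\<^bsub>HZ\<^esub>, \<ominus>\<^bsub>HZ\<^esub> \<one>\<^bsub>HZ\<^esub>}"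
  shows "\<not> virt_adj qext.G qext.T (a, g) y"
proof
  assume adj: "virt_adj qext.G qext.T (a, g) y"
  obtain b h where y: "y = (b, h)" by (cases y)
  have ab: "a \<in> carrier HZ" "b \<in> carrier HZ" and h: "h \<in> carrier (Q8 Z)"
    using adj unfolding y by (auto simp: virt_adj_def)
  have hc: "h \<in> carrier HZ" using h by (rule Q8_closed)
  have gc: "g \<in> carrier HZ" using g by auto
  have g_mult: "g \<otimes>\<^bsub>HZ\<^esub> v = v \<or> g \<otimes>\<^bsub>HZ\<^esub> v = \<ominus>\<^bsub>HZ\<^esub> v" if "v \<in> carrier HZ" for v
    using g that by (auto simp: Q.l_minus)
  have h_square: "h \<otimes>\<^bsub>HZ\<^esub> (h \<otimes>\<^bsub>HZ\<^esub> v) = v \<or> h \<otimes>\<^bsub>HZ\<^esub> (h \<otimes>\<^bsub>HZ\<^esub> v) = \<ominus>\<^bsub>HZ\<^esub> v" if "v \<in> carrier HZ" for v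
  proof -
    have "h \<otimes>\<^bsub>HZ\<^esub> h = \<one>\<^bsub>HZ\<^esub> \<or> h \<otimes>\<^bsub>HZ\<^esub> h = \<ominus>\<^bsub>HZ\<^esub> \<one>\<^bsub>HZ\<^esub>"
      using h pure_unit_square [of h] minus_one_square by auto
    then show ?thesis
      using hc that by (auto simp: Q.l_minus simp flip: Q.m_assoc)
  qed
  have obstruction: False
    if k: "k > 0" and u: "u \<in> carrier HZ"
      and c: "\<And>j. j < 4 \<Longrightarrow> c j \<in> carrier Z"
      and x: "x \<in> carrier HZ" "coordinate_form c x \<noteq> \<zero>\<^bsub>Z\<^esub>"
      and d: "[k] \<cdot>\<^bsub>HZ\<^esub> a \<oplus>\<^bsub>HZ\<^esub> g \<otimes>\<^bsub>HZ\<^esub> u \<oplus>\<^bsub>HZ\<^esub> \<ominus>\<^bsub>HZ\<^esub> u = d"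
        "coordinate_form c d = \<zero>\<^bsub>Z\<^esub>" "coordinate_form c (h \<otimes>\<^bsub>HZ\<^esub> d) = \<zero>\<^bsub>Z\<^esub>"
      and e: "[k] \<cdot>\<^bsub>HZ\<^esub> b \<oplus>\<^bsub>HZ\<^esub> h \<otimes>\<^bsub>HZ\<^esub> u \<oplus>\<^bsub>HZ\<^esub> \<ominus>\<^bsub>HZ\<^esub> u = e"
        "coordinate_form c e = \<zero>\<^bsub>Z\<^esub>" "coordinate_form c (h \<otimes>\<^bsub>HZ\<^esub> e) = \<zero>\<^bsub>Z\<^esub>"
    for k :: nat and u c x d e
  proof -
    let ?f = "coordinate_form c"
    have hom: "?f \<in> hom QN (add_monoid Z)" using c by (rule coordinate_form_hom)
    have fc: "?f v \<in> carrier Z" if "v \<in> carrier HZ" for v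
      using hom_in_carrier [OF hom] that by simp
    have minus: "?f (\<ominus>\<^bsub>HZ\<^esub> v) = \<zero>\<^bsub>Z\<^esub> \<longleftrightarrow> ?f v = \<zero>\<^bsub>Z\<^esub>" if v: "v \<in> carrier HZ" for v
      using coordinate_form_minus [OF c v] fc [OF v] by (simp add: R.add.inv_eq_1_iff)
    have "(?f \<circ> (\<lambda>v. h \<otimes>\<^bsub>HZ\<^esub> v)) \<in> hom QN (add_monoid Z)"
      using hom_mult [OF hom] fc hc by (intro homI) (auto simp: Q.r_distr)
    then have F: "{?f, ?f \<circ> (\<lambda>v. h \<otimes>\<^bsub>HZ\<^esub> v)} \<subseteq> hom QN (add_monoid Z)"
      using hom by simp
    have "\<not> virt_adj qext.G qext.T (a, g) (b, h)"
    proof (rule qext.not_virt_adj_if_functionals [OF prime_p F, of ?f x k u])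
      fix v assume "v \<in> carrier QN"
      then have v: "v \<in> carrier HZ" by simp
      have "?f (g \<otimes>\<^bsub>HZ\<^esub> v) = \<zero>\<^bsub>Z\<^esub> \<longleftrightarrow> ?f v = \<zero>\<^bsub>Z\<^esub>"
        using g_mult [OF v] minus [OF v] by auto
      moreover have "?f (h \<otimes>\<^bsub>HZ\<^esub> (g \<otimes>\<^bsub>HZ\<^esub> v)) = \<zero>\<^bsub>Z\<^esub> \<longleftrightarrow> ?f (h \<otimes>\<^bsub>HZ\<^esub> v) = \<zero>\<^bsub>Z\<^esub>"
        using g_mult [OF v] minus [of "h \<otimes>\<^bsub>HZ\<^esub> v"] v hc by (auto simp: Q.r_minus)
      ultimately show "(\<forall>f\<in>{?f, ?f \<circ> (\<lambda>v. h \<otimes>\<^bsub>HZ\<^esub> v)}. f (g \<otimes>\<^bsub>HZ\<^esub> v) = \<zero>\<^bsub>Z\<^esub>) =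
          (\<forall>f\<in>{?f, ?f \<circ> (\<lambda>v. h \<otimes>\<^bsub>HZ\<^esub> v)}. f v = \<zero>\<^bsub>Z\<^esub>)"
        by simp
      have "?f (h \<otimes>\<^bsub>HZ\<^esub> (h \<otimes>\<^bsub>HZ\<^esub> v)) = \<zero>\<^bsub>Z\<^esub> \<longleftrightarrow> ?f v = \<zero>\<^bsub>Z\<^esub>"
        using h_square [OF v] minus [OF v] by auto
      then show "(\<forall>f\<in>{?f, ?f \<circ> (\<lambda>v. h \<otimes>\<^bsub>HZ\<^esub> v)}. f (h \<otimes>\<^bsub>HZ\<^esub> v) = \<zero>\<^bsub>Z\<^esub>) =
          (\<forall>f\<in>{?f, ?f \<circ> (\<lambda>v. h \<otimes>\<^bsub>HZ\<^esub> v)}. f v = \<zero>\<^bsub>Z\<^esub>)"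
        by auto
    qed (use k u x d e in \<open>auto simp: QN_pow QN_inv\<close>)
    then show False using adj y by simp
  qed
  show False
  proof (cases "h \<in> pure_units")
    case True
    \<comment> \<open>The fixed point of x -> b + h x is u / 2, because (1 - h)(1 + h) = 2.\<close>
    define u where "u = (\<one>\<^bsub>HZ\<^esub> \<oplus>\<^bsub>HZ\<^esub> h) \<otimes>\<^bsub>HZ\<^esub> b"
    have uc: "u \<in> carrier HZ" using ab hc by (simp add: u_def)
    have "h \<otimes>\<^bsub>HZ\<^esub> u = h \<otimes>\<^bsub>HZ\<^esub> b \<oplus>\<^bsub>HZ\<^esub> \<ominus>\<^bsub>HZ\<^esub> b"
      using ab hc pure_unit_square [OF True]
      by (simp add: u_def Q.l_distr Q.r_distr Q.l_minus flip: Q.m_assoc)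
    moreover have "[(2::nat)] \<cdot>\<^bsub>HZ\<^esub> b = b \<oplus>\<^bsub>HZ\<^esub> b"
      using ab by (simp add: numeral_2_eq_2)
    ultimately have e: "[(2::nat)] \<cdot>\<^bsub>HZ\<^esub> b \<oplus>\<^bsub>HZ\<^esub> h \<otimes>\<^bsub>HZ\<^esub> u \<oplus>\<^bsub>HZ\<^esub> \<ominus>\<^bsub>HZ\<^esub> u = \<zero>\<^bsub>HZ\<^esub>"
      using ab hc
      by (simp add: u_def Q.l_distr Q.minus_add Q.a_ac Q.r_neg Q.l_neg Q.r_neg1 Q.r_neg2)
    define d where "d = [(2::nat)] \<cdot>\<^bsub>HZ\<^esub> a \<oplus>\<^bsub>HZ\<^esub> g \<otimes>\<^bsub>HZ\<^esub> u \<oplus>\<^bsub>HZ\<^esub> \<ominus>\<^bsub>HZ\<^esub> u"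
    have dc: "d \<in> carrier HZ" using ab gc uc by (simp add: d_def)
    obtain c x where c: "\<And>j. j < 4 \<Longrightarrow> c j \<in> carrier Z" "coordinate_form c d = \<zero>\<^bsub>Z\<^esub>"
      "coordinate_form c (h \<otimes>\<^bsub>HZ\<^esub> d) = \<zero>\<^bsub>Z\<^esub>" "x \<in> carrier HZ" "coordinate_form c x \<noteq> \<zero>\<^bsub>Z\<^esub>"
      using exists_annihilating_form [OF dc Q.m_closed [OF hc dc]] by blast
    have zero: "coordinate_form c \<zero>\<^bsub>HZ\<^esub> = \<zero>\<^bsub>Z\<^esub>"
      using c(1) [of 0] c(1) [of 1] c(1) [of 2] c(1) [of 3] by (simp add: quat_simps)
    show False
      by (rule obstruction [OF _ uc c(1,4,5) d_def [symmetric] c(2,3) e]) (use zero hc in simp_all)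
  next
    case False
    then have hs: "h = \<one>\<^bsub>HZ\<^esub> \<or> h = \<ominus>\<^bsub>HZ\<^esub> \<one>\<^bsub>HZ\<^esub>" using h by simp
    \<comment> \<open>Now every kernel is stable under both elements, so a form killing a and b
      suffices, with the origin as fixed point.\<close>
    obtain c x where c: "\<And>j. j < 4 \<Longrightarrow> c j \<in> carrier Z" "coordinate_form c a = \<zero>\<^bsub>Z\<^esub>"
      "coordinate_form c b = \<zero>\<^bsub>Z\<^esub>" "x \<in> carrier HZ" "coordinate_form c x \<noteq> \<zero>\<^bsub>Z\<^esub>"
      using exists_annihilating_form [OF ab] by blast
    have "coordinate_form c (h \<otimes>\<^bsub>HZ\<^esub> a) = \<zero>\<^bsub>Z\<^esub>" "coordinate_form c (h \<otimes>\<^bsub>HZ\<^esub> b) = \<zero>\<^bsub>Z\<^esub>"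
      using hs c(2,3) ab coordinate_form_minus [OF c(1) ab(1)] coordinate_form_minus [OF c(1) ab(2)]
      by (auto simp: Q.l_minus)
    then show False
      by (intro obstruction [of 1 "\<zero>\<^bsub>HZ\<^esub>" c x a b]) (use c ab gc hc in auto)
  qed
qed

section \<open>Common neighbours in the quaternion case\<close>

lemma norm_minus_scalar:
  assumes "v \<in> carrier HZ" "s \<in> carrier Z"
  shows "qnorm (v \<ominus>\<^bsub>HZ\<^esub> scalar s) = qnorm v \<ominus>\<^bsub>Z\<^esub> s \<otimes>\<^bsub>Z\<^esub> (fst v \<oplus>\<^bsub>Z\<^esub> fst v \<ominus>\<^bsub>Z\<^esub> s)"
  using assms
  by (elim quat_carrierE)
    (simp add: a_minus_def scalar_def quat_simps quat_minus R.l_distr R.r_distr R.r_minus R.l_minus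
      R.minus_add R.m_ac R.a_ac)

text \<open>The norm of v - s is a monic quadratic polynomial in the scalar s. Besides a root r it
  can only have the root w - r, where w is twice the real part of v, and each root is t e for at
  most one t.\<close>

lemma finite_singular_translates:
  assumes v: "v \<in> carrier HZ" and e: "e \<in> carrier Z" "e \<noteq> \<zero>\<^bsub>Z\<^esub>"
  shows "finite {t::nat. qnorm (v \<ominus>\<^bsub>HZ\<^esub> scalar ([t] \<cdot>\<^bsub>Z\<^esub> e)) = \<zero>\<^bsub>Z\<^esub>}" (is "finite ?A")
proof (cases "?A = {}")
  case False
  then obtain r where r: "r \<in> ?A" by blast
  let ?s = "\<lambda>t::nat. [t] \<cdot>\<^bsub>Z\<^esub> e"
  let ?w = "fst v \<oplus>\<^bsub>Z\<^esub> fst v"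
  have w: "?w \<in> carrier Z" using v by (auto elim!: quat_carrierE)
  have N: "qnorm v \<in> carrier Z" using v by simp
  have root: "?s t \<otimes>\<^bsub>Z\<^esub> (?w \<ominus>\<^bsub>Z\<^esub> ?s t) = qnorm v" if "t \<in> ?A" for t
    using that v e w N norm_minus_scalar [OF v, of "?s t"]
    by (simp add: R.r_right_minus_eq)
  have "t \<in> {t. ?s t = ?s r} \<union> {t. ?s t = ?w \<ominus>\<^bsub>Z\<^esub> ?s r}" if t: "t \<in> ?A" for t
  proof -
    have st: "?s t \<in> carrier Z" "?s r \<in> carrier Z" using e by auto
    have "(?s t \<ominus>\<^bsub>Z\<^esub> ?s r) \<otimes>\<^bsub>Z\<^esub> (?s t \<ominus>\<^bsub>Z\<^esub> (?w \<ominus>\<^bsub>Z\<^esub> ?s r)) =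
        ?s r \<otimes>\<^bsub>Z\<^esub> (?w \<ominus>\<^bsub>Z\<^esub> ?s r) \<ominus>\<^bsub>Z\<^esub> ?s t \<otimes>\<^bsub>Z\<^esub> (?w \<ominus>\<^bsub>Z\<^esub> ?s t)"
      using factor_identity [OF st w] .
    also have "\<dots> = \<zero>\<^bsub>Z\<^esub>"
      using root [OF t] root [OF r] N by (simp add: a_minus_def R.r_neg)
    finally have "?s t \<ominus>\<^bsub>Z\<^esub> ?s r = \<zero>\<^bsub>Z\<^esub> \<or> ?s t \<ominus>\<^bsub>Z\<^esub> (?w \<ominus>\<^bsub>Z\<^esub> ?s r) = \<zero>\<^bsub>Z\<^esub>"
      using R.integral_iff [of "?s t \<ominus>\<^bsub>Z\<^esub> ?s r" "?s t \<ominus>\<^bsub>Z\<^esub> (?w \<ominus>\<^bsub>Z\<^esub> ?s r)"] st w by simp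
    then show ?thesis
      using R.r_right_minus_eq [of "?s t"] st w by auto
  qed
  then have "?A \<subseteq> {t. ?s t = ?s r} \<union> {t. ?s t = ?w \<ominus>\<^bsub>Z\<^esub> ?s r}" by blast
  then show ?thesis
    using finite_multiples_eq [OF e] by (meson finite_Un finite_subset)
next
  case True
  then show ?thesis by (simp only: finite.emptyI)
qed

text \<open>Up to sign there are three pure units, so some l differs from g and h up to sign. The
  vector over l is varied along a line on which both norm conditions become those of
  \<open>finite_singular_translates\<close>.\<close>

lemma exists_common_neighbour:
  assumes xy: "a \<in> carrier HZ" "g \<in> pure_units" "b \<in> carrier HZ" "h \<in> pure_units"
  shows "\<exists>z. virt_adj qext.G qext.T (a, g) z \<and> virt_adj qext.G qext.T z (b, h)"
proof -
  have "\<exists>l\<in>{qi, qj, qk}. l \<noteq> g \<and> l \<noteq> \<ominus>\<^bsub>HZ\<^esub> g \<and> l \<noteq> h \<and> l \<noteq> \<ominus>\<^bsub>HZ\<^esub> h"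
    using xy(2,4) unfolding pure_units_def
    by (elim insertE emptyE) (simp_all add: qijk_distinct qijk_distinct(1-3) [symmetric])
  then obtain l where l: "l \<in> {qi, qj, qk}" "l \<noteq> g" "l \<noteq> \<ominus>\<^bsub>HZ\<^esub> g" "l \<noteq> h" "l \<noteq> \<ominus>\<^bsub>HZ\<^esub> h" by blast
  then have "l \<in> pure_units" by (auto simp: pure_units_def)
  note l = this l(2-)
  have lc: "l \<in> carrier HZ" "g \<in> carrier HZ" "h \<in> carrier HZ" using l xy pure_units_closed by auto
  let ?two = "\<one>\<^bsub>Z\<^esub> \<oplus>\<^bsub>Z\<^esub> \<one>\<^bsub>Z\<^esub>"
  have two: "?two \<noteq> \<zero>\<^bsub>Z\<^esub>" using double_neq_zero by (simp add: numeral_2_eq_2)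
  define x where "x = (\<one>\<^bsub>HZ\<^esub> \<oplus>\<^bsub>HZ\<^esub> g) \<otimes>\<^bsub>HZ\<^esub> a"
  define y where "y = (\<one>\<^bsub>HZ\<^esub> \<oplus>\<^bsub>HZ\<^esub> h) \<otimes>\<^bsub>HZ\<^esub> b"
  have xc: "x \<in> carrier HZ" "y \<in> carrier HZ" using xy lc by (auto simp: x_def y_def)
  have "finite ({t::nat. qnorm (x \<ominus>\<^bsub>HZ\<^esub> scalar ([t] \<cdot>\<^bsub>Z\<^esub> ?two)) = \<zero>\<^bsub>Z\<^esub>} \<union>
      {t::nat. qnorm (y \<ominus>\<^bsub>HZ\<^esub> scalar ([t] \<cdot>\<^bsub>Z\<^esub> ?two)) = \<zero>\<^bsub>Z\<^esub>})"
    using finite_singular_translates [OF xc(1) _ two] finite_singular_translates [OF xc(2) _ two] by simp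
  then obtain t :: nat where t: "qnorm (x \<ominus>\<^bsub>HZ\<^esub> scalar ([t] \<cdot>\<^bsub>Z\<^esub> ?two)) \<noteq> \<zero>\<^bsub>Z\<^esub>"
      "qnorm (y \<ominus>\<^bsub>HZ\<^esub> scalar ([t] \<cdot>\<^bsub>Z\<^esub> ?two)) \<noteq> \<zero>\<^bsub>Z\<^esub>"
    using ex_new_if_finite [OF infinite_UNIV_nat] by blast
  \<comment> \<open>The factor 1 - l turns (1 + l) c into the scalar 2 t.\<close>
  define c where "c = (\<one>\<^bsub>HZ\<^esub> \<ominus>\<^bsub>HZ\<^esub> l) \<otimes>\<^bsub>HZ\<^esub> scalar ([t] \<cdot>\<^bsub>Z\<^esub> \<one>\<^bsub>Z\<^esub>)"
  have cc: "c \<in> carrier HZ" using lc by (simp add: c_def)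
  have "(\<one>\<^bsub>HZ\<^esub> \<oplus>\<^bsub>HZ\<^esub> l) \<otimes>\<^bsub>HZ\<^esub> (\<one>\<^bsub>HZ\<^esub> \<ominus>\<^bsub>HZ\<^esub> l) = \<one>\<^bsub>HZ\<^esub> \<oplus>\<^bsub>HZ\<^esub> \<one>\<^bsub>HZ\<^esub>"
    using lc pure_unit_square [OF l(1)]
    by (simp add: a_minus_def Q.l_distr Q.r_distr Q.r_minus Q.minus_add Q.a_assoc Q.r_neg2 Q.r_neg1)
  moreover have "(\<one>\<^bsub>HZ\<^esub> \<oplus>\<^bsub>HZ\<^esub> l) \<otimes>\<^bsub>HZ\<^esub> c =
      ((\<one>\<^bsub>HZ\<^esub> \<oplus>\<^bsub>HZ\<^esub> l) \<otimes>\<^bsub>HZ\<^esub> (\<one>\<^bsub>HZ\<^esub> \<ominus>\<^bsub>HZ\<^esub> l)) \<otimes>\<^bsub>HZ\<^esub> scalar ([t] \<cdot>\<^bsub>Z\<^esub> \<one>\<^bsub>Z\<^esub>)"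
    unfolding c_def using lc by (intro Q.m_assoc [symmetric]) auto
  ultimately have "(\<one>\<^bsub>HZ\<^esub> \<oplus>\<^bsub>HZ\<^esub> l) \<otimes>\<^bsub>HZ\<^esub> c = (\<one>\<^bsub>HZ\<^esub> \<oplus>\<^bsub>HZ\<^esub> \<one>\<^bsub>HZ\<^esub>) \<otimes>\<^bsub>HZ\<^esub> scalar ([t] \<cdot>\<^bsub>Z\<^esub> \<one>\<^bsub>Z\<^esub>)"
    by simp
  also have "\<dots> = scalar (?two \<otimes>\<^bsub>Z\<^esub> [t] \<cdot>\<^bsub>Z\<^esub> \<one>\<^bsub>Z\<^esub>)"
    by (simp add: scalar_hom scalar_one)
  also have "?two \<otimes>\<^bsub>Z\<^esub> [t] \<cdot>\<^bsub>Z\<^esub> \<one>\<^bsub>Z\<^esub> = [t] \<cdot>\<^bsub>Z\<^esub> ?two"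
    by (subst R.add_pow_rdistr) auto
  finally have c: "(\<one>\<^bsub>HZ\<^esub> \<oplus>\<^bsub>HZ\<^esub> l) \<otimes>\<^bsub>HZ\<^esub> c = scalar ([t] \<cdot>\<^bsub>Z\<^esub> ?two)" .
  have ne: "g \<noteq> \<ominus>\<^bsub>HZ\<^esub> l" "h \<noteq> \<ominus>\<^bsub>HZ\<^esub> l" using l lc by auto
  have "virt_adj qext.G qext.T (a, g) (c, l)"
    by (rule virt_adj_if_norm_nonzero [OF xy(2) l(1) l(2) [symmetric] ne(1) xy(1) cc])
      (use t(1) in \<open>simp only: c x_def [symmetric] not_False_eq_True\<close>)
  moreover have "virt_adj qext.G qext.T (b, h) (c, l)"
    by (rule virt_adj_if_norm_nonzero [OF xy(4) l(1) l(4) [symmetric] ne(2) xy(3) cc])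
      (use t(2) in \<open>simp only: c y_def [symmetric] not_False_eq_True\<close>)
  ultimately show ?thesis
    by (intro exI [of _ "(c, l)"] conjI virt_adj_commute [of _ _ "(b, h)"])
qed

lemma diameter_quat_group:
  "graph_diameter (proper_virt_gen_graph (quat_group p) (quat_topology p)) = 2"
  unfolding quat_group_eq quat_topology_eq
proof -
  let ?adj = "virt_adj qext.G qext.T"
  have pure: "\<exists>a g. x = (a, g) \<and> a \<in> carrier HZ \<and> g \<in> pure_units" if "?adj x x'" for x x'
  proof -
    obtain a g where x: "x = (a, g)" by (cases x)
    have "a \<in> carrier HZ" "g \<in> carrier (Q8 Z)" using that x by (auto simp: virt_adj_def simp del: Q8_simps)
    moreover have "g \<notin> {\<one>\<^bsub>HZ\<^esub>, \<ominus>\<^bsub>HZ\<^esub> \<one>\<^bsub>HZ\<^esub>}" using central_isolated that x by blast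
    ultimately show ?thesis using x by simp
  qed
  have pi: "qi \<in> pure_units" "\<ominus>\<^bsub>HZ\<^esub> qi \<in> pure_units" by (auto simp: pure_units_def)
  obtain z where z: "?adj (\<zero>\<^bsub>HZ\<^esub>, qi) z" "?adj z (\<zero>\<^bsub>HZ\<^esub>, \<ominus>\<^bsub>HZ\<^esub> qi)"
    using exists_common_neighbour [OF _ pi(1) _ pi(2), of "\<zero>\<^bsub>HZ\<^esub>" "\<zero>\<^bsub>HZ\<^esub>"] by auto
  show "graph_diameter (proper_virt_gen_graph qext.G qext.T) = 2"
  proof (rule virt_diameter_eq_2)
    fix x y x' y' assume "?adj x x'" "?adj y y'"
    then obtain a g b h where "x = (a, g)" "a \<in> carrier HZ" "g \<in> pure_units"
      "y = (b, h)" "b \<in> carrier HZ" "h \<in> pure_units"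
      using pure by metis
    then show "?adj x y \<or> (\<exists>z. ?adj x z \<and> ?adj z y)"
      using exists_common_neighbour by blast
  next
    show "?adj (\<zero>\<^bsub>HZ\<^esub>, qi) z" by (rule z(1))
    show "?adj (\<zero>\<^bsub>HZ\<^esub>, \<ominus>\<^bsub>HZ\<^esub> qi) z" by (rule virt_adj_commute [OF z(2)])
    show "(\<zero>\<^bsub>HZ\<^esub>, qi) \<noteq> (\<zero>\<^bsub>HZ\<^esub>, \<ominus>\<^bsub>HZ\<^esub> qi)"
      using qijk_distinct by simp
    \<comment> \<open>The four coordinates: their common kernel is zero, and both elements fix the
      origin.\<close>
    define F where "F = {fst, fst \<circ> snd, fst \<circ> snd \<circ> snd, snd \<circ> snd \<circ> snd :: _ \<Rightarrow> nat \<Rightarrow> int}"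
    have F: "F \<subseteq> hom QN (add_monoid Z)"
      by (auto simp: F_def intro!: homI elim!: quat_carrierE simp: quat_simps)
    have zero: "(\<forall>f\<in>F. f v = \<zero>\<^bsub>Z\<^esub>) \<longleftrightarrow> v = \<zero>\<^bsub>HZ\<^esub>" for v
      by (cases v) (auto simp: F_def quat_simps)
    have stab: "g \<otimes>\<^bsub>HZ\<^esub> v = \<zero>\<^bsub>HZ\<^esub> \<longleftrightarrow> v = \<zero>\<^bsub>HZ\<^esub>" if "g \<in> pure_units" "v \<in> carrier HZ" for g v
    proof
      assume "g \<otimes>\<^bsub>HZ\<^esub> v = \<zero>\<^bsub>HZ\<^esub>"
      then have "(g \<otimes>\<^bsub>HZ\<^esub> g) \<otimes>\<^bsub>HZ\<^esub> v = \<zero>\<^bsub>HZ\<^esub>"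
        using that pure_units_closed by (simp add: Q.m_assoc)
      then show "v = \<zero>\<^bsub>HZ\<^esub>"
        using that by (simp add: pure_unit_square Q.l_minus)
    qed (use that pure_units_closed in simp)
    show "\<not> ?adj (\<zero>\<^bsub>HZ\<^esub>, qi) (\<zero>\<^bsub>HZ\<^esub>, \<ominus>\<^bsub>HZ\<^esub> qi)"
    proof (rule qext.not_virt_adj_if_functionals
        [OF prime_p F, of fst "\<one>\<^bsub>HZ\<^esub>" 1 "\<zero>\<^bsub>HZ\<^esub>"])
      show "\<one>\<^bsub>HZ\<^esub> \<in> carrier QN" by simp
    next
      fix v assume "v \<in> carrier QN"
      then have v: "v \<in> carrier HZ" by simp
      show "(\<forall>f\<in>F. f (qi \<otimes>\<^bsub>HZ\<^esub> v) = \<zero>\<^bsub>Z\<^esub>) = (\<forall>f\<in>F. f v = \<zero>\<^bsub>Z\<^esub>)"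
        "(\<forall>f\<in>F. f (\<ominus>\<^bsub>HZ\<^esub> qi \<otimes>\<^bsub>HZ\<^esub> v) = \<zero>\<^bsub>Z\<^esub>) = (\<forall>f\<in>F. f v = \<zero>\<^bsub>Z\<^esub>)"
        unfolding zero using stab pi v by auto
    next
      fix f assume "f \<in> F"
      then have "f \<zero>\<^bsub>HZ\<^esub> = \<zero>\<^bsub>Z\<^esub>" using zero [of "\<zero>\<^bsub>HZ\<^esub>"] by blast
      then show "f (\<zero>\<^bsub>HZ\<^esub> [^]\<^bsub>QN\<^esub> (1::nat) \<otimes>\<^bsub>QN\<^esub> (qi \<otimes>\<^bsub>HZ\<^esub> \<zero>\<^bsub>HZ\<^esub>) \<otimes>\<^bsub>QN\<^esub> inv\<^bsub>QN\<^esub> \<zero>\<^bsub>HZ\<^esub>) = \<zero>\<^bsub>Z\<^esub>"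
        "f (\<zero>\<^bsub>HZ\<^esub> [^]\<^bsub>QN\<^esub> (1::nat) \<otimes>\<^bsub>QN\<^esub> (\<ominus>\<^bsub>HZ\<^esub> qi \<otimes>\<^bsub>HZ\<^esub> \<zero>\<^bsub>HZ\<^esub>) \<otimes>\<^bsub>QN\<^esub> inv\<^bsub>QN\<^esub> \<zero>\<^bsub>HZ\<^esub>) = \<zero>\<^bsub>Z\<^esub>"
        by (simp_all add: QN_pow QN_inv)
    qed (simp_all add: F_def quat_simps(4))
  qed
qed

end

section \<open>The wreath product with the dihedral group\<close>

fun perm4 :: "nat \<Rightarrow> nat \<Rightarrow> nat \<Rightarrow> nat \<Rightarrow> nat \<Rightarrow> nat" where
  "perm4 a b c d i = (if i = 1 then a else if i = 2 then b else if i = 3 then c else if i = 4 then d else i)"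

lemma perm4_eq_iff: "perm4 a b c d = perm4 a' b' c' d' \<longleftrightarrow> a = a' \<and> b = b' \<and> c = c' \<and> d = d'"
proof
  assume eq: "perm4 a b c d = perm4 a' b' c' d'"
  show "a = a' \<and> b = b' \<and> c = c' \<and> d = d'"
    using fun_cong [OF eq, of 1] fun_cong [OF eq, of 2] fun_cong [OF eq, of 3] fun_cong [OF eq, of 4] by simp
qed simp

text \<open>Together with \<open>perm4_eq_iff\<close> this normal form lets the simplifier evaluate
  the whole multiplication table.\<close>

lemma perm4_comp:
  "perm4 a b c d \<circ> perm4 a' b' c' d' =
     perm4 (perm4 a b c d a') (perm4 a b c d b') (perm4 a b c d c') (perm4 a b c d d')"
  by (rule ext) simp

lemma id_eq_perm4: "id = perm4 1 2 3 4"
  by (simp add: fun_eq_iff)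

declare perm4.simps [simp del]

text \<open>On the square with vertices 1, 2, 3, 4, \<open>rho\<close> is the quarter turn, the two
  swaps are the reflections in the diagonals, fixing two vertices each, and the two flips are the
  reflections without fixed vertices.\<close>

definition "rho = perm4 2 3 4 1"
definition "rho2 = perm4 3 4 1 2"
definition "rho3 = perm4 4 1 2 3"
definition "swap13 = perm4 3 2 1 4"
definition "swap24 = perm4 1 4 3 2"
definition "flip12 = perm4 2 1 4 3"
definition "flip14 = perm4 4 3 2 1"

lemmas d4_defs = rho_def rho2_def rho3_def swap13_def swap24_def flip12_def flip14_def

lemma d4_comp [simp]:
  "rho \<circ> rho = rho2" "rho2 \<circ> rho = rho3" "rho2 \<circ> rho2 = id"
  "swap13 \<circ> swap13 = id" "swap24 \<circ> swap24 = id" "flip12 \<circ> flip12 = id" "flip14 \<circ> flip14 = id"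
  "swap13 \<circ> rho = flip12" "swap24 \<circ> rho = flip14" "flip12 \<circ> rho = swap24" "flip14 \<circ> rho = swap13"
  "rho2 \<circ> swap13 = swap24" "swap13 \<circ> rho2 = swap24" "rho2 \<circ> swap24 = swap13"
  "swap24 \<circ> rho2 = swap13" "swap13 \<circ> swap24 = rho2" "swap24 \<circ> swap13 = rho2"
  "rho \<circ> rho3 = id" "rho3 \<circ> rho = id"
  by (simp_all add: d4_defs perm4_comp perm4_eq_iff perm4.simps id_eq_perm4)

lemma d4_inv [simp]:
  "inv_into UNIV rho = rho3" "inv_into UNIV rho2 = rho2" "inv_into UNIV rho3 = rho"
  "inv_into UNIV swap13 = swap13" "inv_into UNIV swap24 = swap24"
  "inv_into UNIV flip12 = flip12" "inv_into UNIV flip14 = flip14"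
  by (rule inv_unique_comp; simp)+

text \<open>The classes follow the action on the alternating sum, which is fixed by
  \<open>d4_klein\<close> and negated by \<open>d4_rotations\<close> and \<open>d4_flips\<close>.
  The half turn belongs to \<open>d4_klein\<close>, which with \<open>id\<close> forms a
  four-group.\<close>

definition d4_rotations where "d4_rotations = {rho, rho3}"
definition d4_klein where "d4_klein = {rho2, swap13, swap24}"
definition d4_flips where "d4_flips = {flip12, flip14}"

lemmas d4_class_defs = d4_rotations_def d4_klein_def d4_flips_def

lemma d4_distinct [simp]:
  "rho \<noteq> rho2" "rho \<noteq> rho3" "rho \<noteq> swap13" "rho \<noteq> swap24" "rho \<noteq> flip12" "rho \<noteq> flip14" "rho \<noteq> id"
  "rho2 \<noteq> rho3" "rho2 \<noteq> swap13" "rho2 \<noteq> swap24" "rho2 \<noteq> flip12" "rho2 \<noteq> flip14" "rho2 \<noteq> id"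
  "rho3 \<noteq> swap13" "rho3 \<noteq> swap24" "rho3 \<noteq> flip12" "rho3 \<noteq> flip14" "rho3 \<noteq> id"
  "swap13 \<noteq> swap24" "swap13 \<noteq> flip12" "swap13 \<noteq> flip14" "swap13 \<noteq> id"
  "swap24 \<noteq> flip12" "swap24 \<noteq> flip14" "swap24 \<noteq> id" "flip12 \<noteq> flip14" "flip12 \<noteq> id" "flip14 \<noteq> id"
  by (simp_all add: d4_defs perm4_eq_iff id_eq_perm4)

lemmas d4_distinct_sym [simp] = d4_distinct [symmetric]

lemma cycle_eq_rho: "cycle_of_list [1, 2, 3, 4] = rho"
  by (auto simp: rho_def fun_eq_iff transpose_def perm4.simps)

lemma transpose_eq_swap13: "Transposition.transpose 1 3 = swap13"
  by (auto simp: swap13_def fun_eq_iff transpose_def perm4.simps)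

lemma d4_permutes: "rho permutes {1..4}" "swap13 permutes {1..4}"
proof -
  have "cycle_of_list [1, 2, 3, 4 :: nat] permutes set [1, 2, 3, 4]"
    by (rule cycle_permutes)
  then show "rho permutes {1..4}"
    unfolding cycle_eq_rho by (rule permutes_subset) simp
  show "swap13 permutes {1..4}"
    unfolding transpose_eq_swap13 [symmetric] by (rule permutes_swap_id) simp_all
qed

lemma D4_subgroup: "subgroup (generate (sym_group 4) {rho, swap13}) (sym_group 4)"
  using d4_permutes by (intro group.generate_is_subgroup sym_group_is_group) (auto simp: sym_group_carrier)

lemma D4_eq: "D4 = (sym_group 4)\<lparr>carrier := generate (sym_group 4) {rho, swap13}\<rparr>"
  unfolding D4_def cycle_eq_rho transpose_eq_swap13 ..

lemma D4_group: "group D4"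
  unfolding D4_eq by (intro group.subgroup_imp_group sym_group_is_group D4_subgroup)

lemma D4_mult [simp]: "monoid.mult D4 = (\<circ>)" and D4_one [simp]: "one D4 = id"
  by (simp_all add: D4_eq sym_group_def)

lemma D4_permutes: "g \<in> carrier D4 \<Longrightarrow> g permutes {1..4}"
  using subgroup.subset [OF D4_subgroup] by (auto simp: D4_eq sym_group_carrier)

lemma D4_carrier: "carrier D4 = {id} \<union> d4_rotations \<union> d4_klein \<union> d4_flips"
proof
  interpret group "sym_group 4" by (rule sym_group_is_group)
  have inv: "inv\<^bsub>sym_group 4\<^esub> rho = rho3" "inv\<^bsub>sym_group 4\<^esub> swap13 = swap13"
    using d4_permutes permutes_inv [OF d4_permutes(1)]
    by (intro inv_equality; simp add: sym_group_carrier sym_group_mult sym_group_one)+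
  show "carrier D4 \<subseteq> {id} \<union> d4_rotations \<union> d4_klein \<union> d4_flips"
  proof
    fix g assume "g \<in> carrier D4"
    then have "g \<in> generate (sym_group 4) {rho, swap13}" by (simp add: D4_eq)
    then show "g \<in> {id} \<union> d4_rotations \<union> d4_klein \<union> d4_flips"
    proof induction
      case (eng g h)
      have "\<forall>x\<in>{id} \<union> d4_rotations \<union> d4_klein \<union> d4_flips.
          \<forall>y\<in>{id} \<union> d4_rotations \<union> d4_klein \<union> d4_flips.
          x \<circ> y \<in> {id} \<union> d4_rotations \<union> d4_klein \<union> d4_flips"
        unfolding d4_class_defs d4_defs id_eq_perm4
        by (simp add: perm4_comp perm4_eq_iff perm4.simps)
      then have "g \<circ> h \<in> {id} \<union> d4_rotations \<union> d4_klein \<union> d4_flips"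
        using eng.IH by blast
      then show ?case by (simp only: sym_group_mult)
    qed (auto simp: d4_class_defs sym_group_one inv)
  qed
  interpret D: group D4 by (rule D4_group)
  have g: "rho \<in> carrier D4" "swap13 \<in> carrier D4"
    by (auto simp: D4_eq intro: generate.incl)
  have *: "x \<circ> y \<in> carrier D4" if "x \<in> carrier D4" "y \<in> carrier D4" for x y
    using D.m_closed [OF that] by simp
  have "rho2 \<in> carrier D4" "flip12 \<in> carrier D4"
    using * [OF g(1,1)] * [OF g(2,1)] by auto
  moreover from this have "rho3 \<in> carrier D4" "swap24 \<in> carrier D4"
    using * [of rho2 rho] * [of rho2 swap13] g by auto
  moreover from this have "flip14 \<in> carrier D4"
    using * [of swap24 rho] g by auto
  ultimately show "{id} \<union> d4_rotations \<union> d4_klein \<union> d4_flips \<subseteq> carrier D4"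
    using g D.one_closed by (auto simp: d4_class_defs)
qed

text \<open>The restriction makes the value undefined outside {1..4}, as membership in
  \<open>product_group\<close> demands.\<close>

definition vec :: "'a \<Rightarrow> 'a \<Rightarrow> 'a \<Rightarrow> 'a \<Rightarrow> nat \<Rightarrow> 'a" where
  "vec a b c d = (\<lambda>i\<in>{1..4}. if i = 1 then a else if i = 2 then b else if i = 3 then c else d)"

lemma vec_apply [simp]: "vec a b c d (Suc 0) = a" "vec a b c d 2 = b" "vec a b c d 3 = c" "vec a b c d 4 = d"
  by (simp_all add: vec_def)

lemma vec_eq_iff [simp]: "vec a b c d = vec a' b' c' d' \<longleftrightarrow> a = a' \<and> b = b' \<and> c = c' \<and> d = d'"
  by (metis vec_apply)

lemma restrict_eq_vec: "(\<lambda>i\<in>{Suc 0..4}. f i) = vec (f (Suc 0)) (f 2) (f 3) (f 4)"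
proof
  fix i :: nat
  consider "i = 1" | "i = 2" | "i = 3" | "i = 4" | "i \<notin> {Suc 0..4}" by force
  then show "(\<lambda>i\<in>{Suc 0..4}. f i) i = vec (f (Suc 0)) (f 2) (f 3) (f 4) i"
    by cases (auto simp: vec_def)
qed

section \<open>Sums of two squares and powers of 4\<close>

lemma int_square_mod_4:
  fixes x :: int
  shows "even x \<and> x ^ 2 mod 4 = 0 \<or> odd x \<and> x ^ 2 mod 4 = 1"
proof (cases "even x")
  case True
  then obtain a where "x = 2 * a" by (elim evenE)
  then show ?thesis by (simp add: power_mult_distrib)
next
  case False
  then obtain a where a: "x = 2 * a + 1" by (elim oddE)
  have "x ^ 2 = 1 + (a ^ 2 + a) * 4"
    unfolding a by (simp add: power2_eq_square algebra_simps)
  then have "x ^ 2 mod 4 = 1" by (simp only: mod_mult_self1) simp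
  then show ?thesis using False by simp
qed

text \<open>Descent: squares are 0 or 1 modulo 4, so a sum of two squares divisible by 4 has both
  terms even, and a factor 4 can be cancelled.\<close>

lemma int_sum_squares_dvd:
  fixes x y :: int
  assumes "4 ^ k dvd x ^ 2 + y ^ 2"
  shows "2 ^ k dvd x \<and> 2 ^ k dvd y"
  using assms
proof (induction k arbitrary: x y)
  case (Suc k)
  have "4 dvd x ^ 2 + y ^ 2"
    using Suc.prems dvd_trans [of 4 "4 ^ Suc k"] by simp
  then have "(x ^ 2 mod 4 + y ^ 2 mod 4) mod 4 = 0"
    by (simp only: mod_add_eq dvd_imp_mod_0)
  then have "even x \<and> even y"
    using int_square_mod_4 [of x] int_square_mod_4 [of y] by auto
  then obtain a b where ab: "x = 2 * a" "y = 2 * b" by (auto elim!: evenE)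
  have "4 * 4 ^ k dvd 4 * (a ^ 2 + b ^ 2)"
    using Suc.prems unfolding ab by (simp add: power_mult_distrib)
  then have "4 ^ k dvd a ^ 2 + b ^ 2"
    unfolding dvd_mult_cancel_left by simp
  from Suc.IH [OF this] show ?case
    unfolding ab power_Suc by (auto intro: mult_dvd_mono)
qed simp

context padic begin

lemma add_pow_two: "x \<in> carrier Z \<Longrightarrow> [(2::nat)] \<cdot>\<^bsub>Z\<^esub> x = x \<oplus>\<^bsub>Z\<^esub> x"
  by (simp add: numeral_2_eq_2)

lemma double_eq_zero: "x \<in> carrier Z \<Longrightarrow> x \<oplus>\<^bsub>Z\<^esub> x = \<zero>\<^bsub>Z\<^esub> \<Longrightarrow> x = \<zero>\<^bsub>Z\<^esub>"
  using torsion_free [of x 2] add_pow_two by simp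

end

locale padic_two = padic "2::nat"
begin

definition WN where "WN = product_group {1..4::nat} (\<lambda>_. add_monoid Z)"

lemma WN_comm_group: "comm_group WN"
proof -
  have "group WN" unfolding WN_def by (rule product_group) (rule R.add.is_group)
  then show ?thesis
    by (rule group.group_comm_groupI) (auto simp: WN_def intro!: restrict_ext R.a_comm)
qed

lemma vec_closed [simp]:
  "vec a b c d \<in> carrier WN \<longleftrightarrow> a \<in> carrier Z \<and> b \<in> carrier Z \<and> c \<in> carrier Z \<and> d \<in> carrier Z"
proof
  assume "vec a b c d \<in> carrier WN"
  then have *: "vec a b c d i \<in> carrier Z" if "i \<in> {1..4}" for i
    using that PiE_mem unfolding WN_def carrier_product_group by fastforce
  show "a \<in> carrier Z \<and> b \<in> carrier Z \<and> c \<in> carrier Z \<and> d \<in> carrier Z"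
    using * [of 1] * [of 2] * [of 3] * [of 4] by simp
next
  assume "a \<in> carrier Z \<and> b \<in> carrier Z \<and> c \<in> carrier Z \<and> d \<in> carrier Z"
  then show "vec a b c d \<in> carrier WN"
    by (simp add: WN_def vec_def restrict_PiE_iff)
qed

lemma WN_E:
  assumes "v \<in> carrier WN"
  obtains a b c d where "v = vec a b c d"
    "a \<in> carrier Z" "b \<in> carrier Z" "c \<in> carrier Z" "d \<in> carrier Z"
proof -
  have "v = (\<lambda>i\<in>{1..4}. v i)" using assms by (simp add: WN_def PiE_def extensional_restrict)
  then have v: "v = vec (v 1) (v 2) (v 3) (v 4)" by (simp only: One_nat_def restrict_eq_vec)
  have "v i \<in> carrier Z" if "i \<in> {1..4}" for i
    using assms that by (auto simp: WN_def)
  then show ?thesis by (intro that [OF v]) simp_all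
qed

lemma vec_mult [simp]:
  "vec a b c d \<otimes>\<^bsub>WN\<^esub> vec a' b' c' d' = vec (a \<oplus>\<^bsub>Z\<^esub> a') (b \<oplus>\<^bsub>Z\<^esub> b') (c \<oplus>\<^bsub>Z\<^esub> c') (d \<oplus>\<^bsub>Z\<^esub> d')"
  by (simp add: WN_def restrict_eq_vec)

lemma WN_one: "\<one>\<^bsub>WN\<^esub> = vec \<zero>\<^bsub>Z\<^esub> \<zero>\<^bsub>Z\<^esub> \<zero>\<^bsub>Z\<^esub> \<zero>\<^bsub>Z\<^esub>"
  by (simp add: WN_def restrict_eq_vec)

lemma vec_inv [simp]:
  assumes "a \<in> carrier Z" "b \<in> carrier Z" "c \<in> carrier Z" "d \<in> carrier Z"
  shows "inv\<^bsub>WN\<^esub> (vec a b c d) = vec (\<ominus>\<^bsub>Z\<^esub> a) (\<ominus>\<^bsub>Z\<^esub> b) (\<ominus>\<^bsub>Z\<^esub> c) (\<ominus>\<^bsub>Z\<^esub> d)"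
  using assms by (intro group.inv_equality [OF comm_group.axioms(2) [OF WN_comm_group]])
    (simp_all add: WN_one R.l_neg)

lemma vec_pow [simp]:
  assumes "a \<in> carrier Z" "b \<in> carrier Z" "c \<in> carrier Z" "d \<in> carrier Z"
  shows "vec a b c d [^]\<^bsub>WN\<^esub> (n::nat) = vec ([n] \<cdot>\<^bsub>Z\<^esub> a) ([n] \<cdot>\<^bsub>Z\<^esub> b) ([n] \<cdot>\<^bsub>Z\<^esub> c) ([n] \<cdot>\<^bsub>Z\<^esub> d)"
proof -
  interpret W: comm_group WN by (rule WN_comm_group)
  show ?thesis using assms by (induction n) (auto simp: WN_one)
qed

definition wact :: "(nat \<Rightarrow> nat) \<Rightarrow> (nat \<Rightarrow> nat \<Rightarrow> int) \<Rightarrow> nat \<Rightarrow> nat \<Rightarrow> int" where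
  "wact g x = (\<lambda>i\<in>{1..4}. x (inv_into UNIV g i))"

lemma wact_vec [simp]:
  "wact id (vec a b c d) = vec a b c d"
  "wact rho (vec a b c d) = vec d a b c"
  "wact rho2 (vec a b c d) = vec c d a b"
  "wact rho3 (vec a b c d) = vec b c d a"
  "wact swap13 (vec a b c d) = vec c b a d"
  "wact swap24 (vec a b c d) = vec a d c b"
  "wact flip12 (vec a b c d) = vec b a d c"
  "wact flip14 (vec a b c d) = vec d c b a"
  unfolding wact_def One_nat_def restrict_eq_vec d4_inv inv_id
  by (simp_all add: d4_defs perm4.simps)

sublocale wext: lattice_extension WN D4 wact 2
proof (intro lattice_extension.intro lattice_extension_axioms.intro)
  show "comm_group WN" by (rule WN_comm_group)
  show "group D4" by (rule D4_group)
  fix g h v w assume g: "g \<in> carrier D4"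
  { assume "v \<in> carrier WN"
    then show "wact g v \<in> carrier WN"
      using g by (elim WN_E) (auto simp: D4_carrier d4_class_defs) }
  { assume "v \<in> carrier WN" "w \<in> carrier WN"
    then show "wact g (v \<otimes>\<^bsub>WN\<^esub> w) = wact g v \<otimes>\<^bsub>WN\<^esub> wact g w"
      using g by (elim WN_E) (auto simp: D4_carrier d4_class_defs) }
  { assume h: "h \<in> carrier D4"
    have perm: "g permutes {1..4}" "h permutes {1..4}" using g h D4_permutes by auto
    then have "inv_into UNIV (g \<circ> h) = inv_into UNIV h \<circ> inv_into UNIV g"
      by (intro o_inv_distrib) (auto intro: permutes_bij)
    moreover have "inv_into UNIV g i \<in> {1..4}" if "i \<in> {1..4}" for i
      using permutes_in_image [OF permutes_inv [OF perm(1)]] that by blast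
    ultimately show "wact (g \<otimes>\<^bsub>D4\<^esub> h) v = wact g (wact h v)"
      by (auto simp: wact_def fun_eq_iff restrict_def) }
next
  fix v assume "v \<in> carrier WN"
  then show "wact \<one>\<^bsub>D4\<^esub> v = v" by (elim WN_E) simp
qed

lemma wreath_eq: "Z2_wr_D4 = wext.G" and wreath_topology_eq: "Z2_wr_D4_topology = wext.T"
  by (simp_all add: Z2_wr_D4_def Z2_wr_D4_topology_def wreath_def WN_def wact_def [abs_def])

text \<open>\<open>sig\<close> and \<open>tau\<close> span the one-dimensional constituents of the dual of the permutation module,
  \<open>mm\<close> and \<open>nn\<close> the two-dimensional one; \<open>pp\<close> and \<open>qq\<close> are invariant under \<open>d4_klein\<close>.\<close>

definition sig where "sig v = v 1 \<oplus>\<^bsub>Z\<^esub> v 2 \<oplus>\<^bsub>Z\<^esub> v 3 \<oplus>\<^bsub>Z\<^esub> v (4::nat)"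
definition tau where "tau v = v 1 \<ominus>\<^bsub>Z\<^esub> v 2 \<oplus>\<^bsub>Z\<^esub> v 3 \<ominus>\<^bsub>Z\<^esub> v (4::nat)"
definition mm where "mm v = v 1 \<ominus>\<^bsub>Z\<^esub> v (3::nat)"
definition nn where "nn v = v 2 \<ominus>\<^bsub>Z\<^esub> v (4::nat)"
definition pp where "pp v = v 1 \<oplus>\<^bsub>Z\<^esub> v (3::nat)"
definition qq where "qq v = v 2 \<oplus>\<^bsub>Z\<^esub> v (4::nat)"

lemma form_vec [simp]:
  "sig (vec a b c d) = a \<oplus>\<^bsub>Z\<^esub> b \<oplus>\<^bsub>Z\<^esub> c \<oplus>\<^bsub>Z\<^esub> d"
  "tau (vec a b c d) = a \<ominus>\<^bsub>Z\<^esub> b \<oplus>\<^bsub>Z\<^esub> c \<ominus>\<^bsub>Z\<^esub> d"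
  "mm (vec a b c d) = a \<ominus>\<^bsub>Z\<^esub> c" "nn (vec a b c d) = b \<ominus>\<^bsub>Z\<^esub> d"
  "pp (vec a b c d) = a \<oplus>\<^bsub>Z\<^esub> c" "qq (vec a b c d) = b \<oplus>\<^bsub>Z\<^esub> d"
  by (simp_all add: sig_def tau_def mm_def nn_def pp_def qq_def)

lemma form_hom:
  "sig \<in> hom WN (add_monoid Z)" "tau \<in> hom WN (add_monoid Z)"
  "mm \<in> hom WN (add_monoid Z)" "nn \<in> hom WN (add_monoid Z)"
  "pp \<in> hom WN (add_monoid Z)" "qq \<in> hom WN (add_monoid Z)"
  by (auto intro!: homI elim!: WN_E simp: a_minus_def R.minus_add R.a_ac)

lemma form_closed [simp]:
  assumes "v \<in> carrier WN"
  shows "sig v \<in> carrier Z" "tau v \<in> carrier Z" "mm v \<in> carrier Z" "nn v \<in> carrier Z"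
    "pp v \<in> carrier Z" "qq v \<in> carrier Z"
  using assms by (auto elim!: WN_E)

text \<open>\<open>-1\<close> is not a square in the 2-adic numbers.\<close>

lemma sum_squares_eq_zero:
  assumes xy: "x \<in> carrier Z" "y \<in> carrier Z" and zero: "x \<otimes>\<^bsub>Z\<^esub> x \<oplus>\<^bsub>Z\<^esub> y \<otimes>\<^bsub>Z\<^esub> y = \<zero>\<^bsub>Z\<^esub>"
  shows "x = \<zero>\<^bsub>Z\<^esub> \<and> y = \<zero>\<^bsub>Z\<^esub>"
proof -
  have "x n = 0 \<and> y n = 0" for n
  proof -
    \<comment> \<open>The modulus at this index is 2^(k+1) = 4^(n+1), just enough to make both
      components divisible by 2^(n+1), the modulus at n.\<close>
    define k where "k = Suc (2 * n)"
    have "(x k * x k mod 2 ^ Suc k + y k * y k mod 2 ^ Suc k) mod 2 ^ Suc k = 0"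
      using fun_cong [OF zero, of k] by (simp add: Zp_mult Zp_add Zp_zero)
    then have "(2::int) ^ Suc k dvd x k * x k + y k * y k"
      by (simp add: mod_simps dvd_eq_mod_eq_0 del: power_Suc)
    moreover have "(2::int) ^ Suc k = 4 ^ Suc n"
      by (simp add: k_def power_mult)
    ultimately have "2 ^ Suc n dvd x k \<and> 2 ^ Suc n dvd y k"
      using int_sum_squares_dvd [of "Suc n" "x k" "y k"] by (simp add: power2_eq_square)
    then show ?thesis
      using Zp_carrier_mod_le [OF xy(1), of n k] Zp_carrier_mod_le [OF xy(2), of n k]
      by (auto simp: k_def dvd_eq_mod_eq_0 simp del: power_Suc)
  qed
  then show ?thesis by (auto simp: Zp_zero fun_eq_iff)
qed

definition vscale where "vscale c v = (\<lambda>i\<in>{1..4::nat}. c \<otimes>\<^bsub>Z\<^esub> v i)"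

lemma vscale_vec [simp]: "vscale z (vec a b c d) = vec (z \<otimes>\<^bsub>Z\<^esub> a) (z \<otimes>\<^bsub>Z\<^esub> b) (z \<otimes>\<^bsub>Z\<^esub> c) (z \<otimes>\<^bsub>Z\<^esub> d)"
  by (simp add: vscale_def restrict_eq_vec)

lemma vscale_closed [simp]: "z \<in> carrier Z \<Longrightarrow> v \<in> carrier WN \<Longrightarrow> vscale z v \<in> carrier WN"
  by (auto elim!: WN_E)

lemma translation_part_vscale:
  assumes S: "subgroup S wext.G" and x: "x \<in> wext.translation_part S" and z: "z \<in> carrier Z"
  shows "vscale z x \<in> wext.translation_part S"
  by (rule wext.translation_part_scale [OF prime_p S x z, of "\<lambda>z. vscale z x"])
    (use wext.translation_part_carrier [OF x] in
      \<open>auto elim!: WN_E simp: R.l_distr R.add_pow_ldistr\<close>)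

end

section \<open>Criteria for openness over the dihedral group\<close>

lemma (in lattice_extension) translation_part_diff:
  assumes S: "subgroup S G" and "(v, h) \<in> S" "(w, h) \<in> S"
  shows "v \<otimes>\<^bsub>N\<^esub> inv\<^bsub>N\<^esub> w \<in> translation_part S"
proof -
  have c: "v \<in> carrier N" "w \<in> carrier N" "h \<in> carrier H"
    using subgroup.subset [OF S] assms by auto
  have "(v, h) \<otimes>\<^bsub>G\<^esub> inv\<^bsub>G\<^esub> (w, h) \<in> S"
    using S assms(2,3) by (simp only: subgroup.m_closed subgroup.m_inv_closed)
  also have "(v, h) \<otimes>\<^bsub>G\<^esub> inv\<^bsub>G\<^esub> (w, h) = (v \<otimes>\<^bsub>N\<^esub> inv\<^bsub>N\<^esub> w, \<one>\<^bsub>H\<^esub>)"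
    using c by (simp add: inv_G)
  finally show ?thesis
    using c by (intro translation_part_incl) auto
qed

context padic_two begin

lemma diff_nonzero: "x \<in> carrier Z \<Longrightarrow> y \<in> carrier Z \<Longrightarrow> x \<noteq> y \<Longrightarrow> x \<ominus>\<^bsub>Z\<^esub> y \<noteq> \<zero>\<^bsub>Z\<^esub>"
  using R.r_right_minus_eq by blast

lemma open_if_basis_multiples:
  assumes S: "subgroup S wext.G" and c: "c \<in> carrier Z" "c \<noteq> \<zero>\<^bsub>Z\<^esub>"
    and basis: "vec c \<zero>\<^bsub>Z\<^esub> \<zero>\<^bsub>Z\<^esub> \<zero>\<^bsub>Z\<^esub> \<in> wext.translation_part S" "vec \<zero>\<^bsub>Z\<^esub> c \<zero>\<^bsub>Z\<^esub> \<zero>\<^bsub>Z\<^esub> \<in> wext.translation_part S"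
      "vec \<zero>\<^bsub>Z\<^esub> \<zero>\<^bsub>Z\<^esub> c \<zero>\<^bsub>Z\<^esub> \<in> wext.translation_part S" "vec \<zero>\<^bsub>Z\<^esub> \<zero>\<^bsub>Z\<^esub> \<zero>\<^bsub>Z\<^esub> c \<in> wext.translation_part S"
  shows "\<exists>n. \<forall>v\<in>carrier WN. v [^]\<^bsub>WN\<^esub> ((2::nat) ^ n) \<in> wext.translation_part S"
proof -
  obtain y n where y: "y \<in> carrier Z" "y \<otimes>\<^bsub>Z\<^esub> c = [((2::nat) ^ n)] \<cdot>\<^bsub>Z\<^esub> \<one>\<^bsub>Z\<^esub>"
    using p_power_eq_multiple c .
  have "v [^]\<^bsub>WN\<^esub> ((2::nat) ^ n) \<in> wext.translation_part S" if vc: "v \<in> carrier WN" for v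
  proof -
    obtain a1 a2 a3 a4 where v: "v = vec a1 a2 a3 a4"
      "a1 \<in> carrier Z" "a2 \<in> carrier Z" "a3 \<in> carrier Z" "a4 \<in> carrier Z"
      using WN_E [OF vc] .
    have mult: "x \<otimes>\<^bsub>Z\<^esub> y \<otimes>\<^bsub>Z\<^esub> c = [((2::nat) ^ n)] \<cdot>\<^bsub>Z\<^esub> x" if "x \<in> carrier Z" for x
      using that y c by (simp add: R.m_assoc R.add_pow_rdistr)
    have "vscale (a1 \<otimes>\<^bsub>Z\<^esub> y) (vec c \<zero>\<^bsub>Z\<^esub> \<zero>\<^bsub>Z\<^esub> \<zero>\<^bsub>Z\<^esub>) \<otimes>\<^bsub>WN\<^esub> (vscale (a2 \<otimes>\<^bsub>Z\<^esub> y) (vec \<zero>\<^bsub>Z\<^esub> c \<zero>\<^bsub>Z\<^esub> \<zero>\<^bsub>Z\<^esub>) \<otimes>\<^bsub>WN\<^esub>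
        (vscale (a3 \<otimes>\<^bsub>Z\<^esub> y) (vec \<zero>\<^bsub>Z\<^esub> \<zero>\<^bsub>Z\<^esub> c \<zero>\<^bsub>Z\<^esub>) \<otimes>\<^bsub>WN\<^esub> vscale (a4 \<otimes>\<^bsub>Z\<^esub> y) (vec \<zero>\<^bsub>Z\<^esub> \<zero>\<^bsub>Z\<^esub> \<zero>\<^bsub>Z\<^esub> c))) \<in> wext.translation_part S"
      using v y basis by (intro wext.translation_part_mult [OF S] translation_part_vscale [OF S]) simp_all
    then show ?thesis
      using v y c mult by simp
  qed
  then show ?thesis by blast
qed

text \<open>Each constituent is reached by a projection from the group ring. The fourth power of (b,
  rho) is the translation by sig b times (1, 1, 1, 1). The operator (1 - rho)(1 + rho^2) sends w1 to
  tau w1 times (1, -1, 1, -1). Finally 1 - rho^2 sends w2 to y = (m, n, -m, -n), and m y - n rho y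
  is m^2 + n^2 times (1, 0, -1, 0), nonzero by \<open>sum_squares_eq_zero\<close>.\<close>

lemma open_if_rotation:
  assumes S: "subgroup S wext.G" and b: "(b, rho) \<in> S" "sig b \<noteq> \<zero>\<^bsub>Z\<^esub>"
    and w1: "w1 \<in> wext.translation_part S" "tau w1 \<noteq> \<zero>\<^bsub>Z\<^esub>"
    and w2: "w2 \<in> wext.translation_part S" "mm w2 \<noteq> \<zero>\<^bsub>Z\<^esub> \<or> nn w2 \<noteq> \<zero>\<^bsub>Z\<^esub>"
  shows "\<exists>n. \<forall>v\<in>carrier WN. v [^]\<^bsub>WN\<^esub> ((2::nat) ^ n) \<in> wext.translation_part S"
proof -
  let ?J = "wext.translation_part S"
  note J_mult = wext.translation_part_mult [OF S] and J_inv = wext.translation_part_inv [OF S]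
    and J_scale = translation_part_vscale [OF S]
  have rot: "wact rho x \<in> ?J" if "x \<in> ?J" for x
    using wext.translation_part_act [OF S that b(1)] .
  have bc: "b \<in> carrier WN" using subgroup.subset [OF S] b(1) by auto
  have w1c: "w1 \<in> carrier WN" and w2c: "w2 \<in> carrier WN"
    using w1 w2 wext.translation_part_carrier by auto
  define c0 where "c0 = sig b"
  define c1 where "c1 = tau w1"
  define c2 where "c2 = mm w2 \<otimes>\<^bsub>Z\<^esub> mm w2 \<oplus>\<^bsub>Z\<^esub> nn w2 \<otimes>\<^bsub>Z\<^esub> nn w2"
  have cc: "c0 \<in> carrier Z" "c1 \<in> carrier Z" "c2 \<in> carrier Z"
    using bc w1c w2c by (auto simp: c0_def c1_def c2_def)
  have nz: "c0 \<noteq> \<zero>\<^bsub>Z\<^esub>" "c1 \<noteq> \<zero>\<^bsub>Z\<^esub>" "c2 \<noteq> \<zero>\<^bsub>Z\<^esub>"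
    using b w1 w2 sum_squares_eq_zero [of "mm w2" "nn w2"] w2c by (auto simp: c0_def c1_def c2_def)
  have b2: "(b \<otimes>\<^bsub>WN\<^esub> wact rho b, rho2) \<in> S"
    using subgroup.m_closed [OF S b(1) b(1)] by simp
  have "((b \<otimes>\<^bsub>WN\<^esub> wact rho b) \<otimes>\<^bsub>WN\<^esub> wact rho2 (b \<otimes>\<^bsub>WN\<^esub> wact rho b), id) \<in> S"
    using subgroup.m_closed [OF S b2 b2] by simp
  moreover have "(b \<otimes>\<^bsub>WN\<^esub> wact rho b) \<otimes>\<^bsub>WN\<^esub> wact rho2 (b \<otimes>\<^bsub>WN\<^esub> wact rho b) = vec c0 c0 c0 c0"
    using bc unfolding c0_def by (elim WN_E) (simp add: R.a_ac)
  ultimately have x0: "vec c0 c0 c0 c0 \<in> ?J"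
    using cc by (intro wext.translation_part_incl) auto
  have "(w1 \<otimes>\<^bsub>WN\<^esub> inv\<^bsub>WN\<^esub> (wact rho w1)) \<otimes>\<^bsub>WN\<^esub>
      wact rho (wact rho (w1 \<otimes>\<^bsub>WN\<^esub> inv\<^bsub>WN\<^esub> (wact rho w1))) \<in> ?J"
    using w1(1) by (intro J_mult J_inv rot)
  moreover have "(w1 \<otimes>\<^bsub>WN\<^esub> inv\<^bsub>WN\<^esub> (wact rho w1)) \<otimes>\<^bsub>WN\<^esub>
      wact rho (wact rho (w1 \<otimes>\<^bsub>WN\<^esub> inv\<^bsub>WN\<^esub> (wact rho w1))) = vec c1 (\<ominus>\<^bsub>Z\<^esub> c1) c1 (\<ominus>\<^bsub>Z\<^esub> c1)"
    using w1c unfolding c1_def by (elim WN_E) (simp add: a_minus_def R.minus_add R.a_ac)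
  ultimately have x1: "vec c1 (\<ominus>\<^bsub>Z\<^esub> c1) c1 (\<ominus>\<^bsub>Z\<^esub> c1) \<in> ?J" by simp
  define y where "y = w2 \<otimes>\<^bsub>WN\<^esub> inv\<^bsub>WN\<^esub> (wact rho (wact rho w2))"
  have yJ: "y \<in> ?J"
    unfolding y_def using w2(1) by (intro J_mult J_inv rot)
  have y: "y = vec (mm w2) (nn w2) (\<ominus>\<^bsub>Z\<^esub> mm w2) (\<ominus>\<^bsub>Z\<^esub> nn w2)"
    unfolding y_def using w2c by (elim WN_E) (simp add: a_minus_def R.minus_add R.a_ac)
  have "vscale (mm w2) y \<otimes>\<^bsub>WN\<^esub> inv\<^bsub>WN\<^esub> (vscale (nn w2) (wact rho y)) \<in> ?J"
    using yJ w2c by (intro J_mult J_inv J_scale rot) simp_all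
  moreover have "vscale (mm w2) y \<otimes>\<^bsub>WN\<^esub> inv\<^bsub>WN\<^esub> (vscale (nn w2) (wact rho y)) = vec c2 \<zero>\<^bsub>Z\<^esub> (\<ominus>\<^bsub>Z\<^esub> c2) \<zero>\<^bsub>Z\<^esub>"
    unfolding y c2_def using w2c by (simp add: R.r_minus R.minus_add R.m_comm R.r_neg R.l_neg)
  ultimately have x2: "vec c2 \<zero>\<^bsub>Z\<^esub> (\<ominus>\<^bsub>Z\<^esub> c2) \<zero>\<^bsub>Z\<^esub> \<in> ?J" by simp
  define c where "c = c0 \<otimes>\<^bsub>Z\<^esub> (c1 \<otimes>\<^bsub>Z\<^esub> c2)"
  have c: "c \<in> carrier Z" "c \<noteq> \<zero>\<^bsub>Z\<^esub>"
    using cc nz R.integral by (auto simp: c_def)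
  have xs: "vec c c c c \<in> ?J" "vec c (\<ominus>\<^bsub>Z\<^esub> c) c (\<ominus>\<^bsub>Z\<^esub> c) \<in> ?J" "vec c \<zero>\<^bsub>Z\<^esub> (\<ominus>\<^bsub>Z\<^esub> c) \<zero>\<^bsub>Z\<^esub> \<in> ?J"
    using J_scale [OF x0, of "c1 \<otimes>\<^bsub>Z\<^esub> c2"] J_scale [OF x1, of "c0 \<otimes>\<^bsub>Z\<^esub> c2"] J_scale [OF x2, of "c0 \<otimes>\<^bsub>Z\<^esub> c1"] cc
    by (simp_all add: c_def R.m_ac R.r_minus)
  \<comment> \<open>The sum (c, c, c, c) + (c, -c, c, -c) + 2 (c, 0, -c, 0) is 4 c times the first
    basis vector; \<open>rho\<close> carries it to the other axes.\<close>
  define d where "d = (c \<oplus>\<^bsub>Z\<^esub> c) \<oplus>\<^bsub>Z\<^esub> (c \<oplus>\<^bsub>Z\<^esub> c)"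
  have d: "d \<in> carrier Z" "d \<noteq> \<zero>\<^bsub>Z\<^esub>"
    using c double_eq_zero [of c] double_eq_zero [of "c \<oplus>\<^bsub>Z\<^esub> c"] by (auto simp: d_def)
  have "(vec c c c c \<otimes>\<^bsub>WN\<^esub> vec c (\<ominus>\<^bsub>Z\<^esub> c) c (\<ominus>\<^bsub>Z\<^esub> c)) \<otimes>\<^bsub>WN\<^esub>
      (vec c \<zero>\<^bsub>Z\<^esub> (\<ominus>\<^bsub>Z\<^esub> c) \<zero>\<^bsub>Z\<^esub> \<otimes>\<^bsub>WN\<^esub> vec c \<zero>\<^bsub>Z\<^esub> (\<ominus>\<^bsub>Z\<^esub> c) \<zero>\<^bsub>Z\<^esub>) \<in> ?J"
    using xs by (intro J_mult)
  moreover have "(vec c c c c \<otimes>\<^bsub>WN\<^esub> vec c (\<ominus>\<^bsub>Z\<^esub> c) c (\<ominus>\<^bsub>Z\<^esub> c)) \<otimes>\<^bsub>WN\<^esub>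
      (vec c \<zero>\<^bsub>Z\<^esub> (\<ominus>\<^bsub>Z\<^esub> c) \<zero>\<^bsub>Z\<^esub> \<otimes>\<^bsub>WN\<^esub> vec c \<zero>\<^bsub>Z\<^esub> (\<ominus>\<^bsub>Z\<^esub> c) \<zero>\<^bsub>Z\<^esub>) = vec d \<zero>\<^bsub>Z\<^esub> \<zero>\<^bsub>Z\<^esub> \<zero>\<^bsub>Z\<^esub>"
    using c unfolding d_def by (simp add: R.r_neg R.minus_add [symmetric])
  ultimately have e: "vec d \<zero>\<^bsub>Z\<^esub> \<zero>\<^bsub>Z\<^esub> \<zero>\<^bsub>Z\<^esub> \<in> ?J" by simp
  show ?thesis
    using open_if_basis_multiples [OF S d e] rot [OF e] rot [OF rot [OF e]] rot [OF rot [OF rot [OF e]]]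
    by simp
qed

text \<open>The operator 1 + rho2 maps x to (pp x, qq x, pp x, qq x), in the plane on which the
  four-group acts trivially; Cramer's rule with the determinant of w1 and w2 fills this plane. The
  two other constituents are distinct lines, onto which 1 - swap13 and 1 - swap24 project, with
  coefficients mm and nn.\<close>

lemma open_if_klein:
  assumes S: "subgroup S wext.G" and b: "(b1, rho2) \<in> S" "(b2, swap13) \<in> S" "(b3, swap24) \<in> S"
    and w: "w1 \<in> wext.translation_part S" "w2 \<in> wext.translation_part S"
      "pp w1 \<otimes>\<^bsub>Z\<^esub> qq w2 \<ominus>\<^bsub>Z\<^esub> qq w1 \<otimes>\<^bsub>Z\<^esub> pp w2 \<noteq> \<zero>\<^bsub>Z\<^esub>"
    and w3: "w3 \<in> wext.translation_part S" "mm w3 \<noteq> \<zero>\<^bsub>Z\<^esub>"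
    and w4: "w4 \<in> wext.translation_part S" "nn w4 \<noteq> \<zero>\<^bsub>Z\<^esub>"
  shows "\<exists>n. \<forall>v\<in>carrier WN. v [^]\<^bsub>WN\<^esub> ((2::nat) ^ n) \<in> wext.translation_part S"
proof -
  let ?J = "wext.translation_part S"
  note J_mult = wext.translation_part_mult [OF S] and J_inv = wext.translation_part_inv [OF S]
    and J_scale = translation_part_vscale [OF S]
  have act: "wact rho2 x \<in> ?J" "wact swap13 x \<in> ?J" "wact swap24 x \<in> ?J" if "x \<in> ?J" for x
    using wext.translation_part_act [OF S that] b by auto
  have wc: "w1 \<in> carrier WN" "w2 \<in> carrier WN" "w3 \<in> carrier WN" "w4 \<in> carrier WN"
    using w w3 w4 wext.translation_part_carrier by auto
  define m where "m = mm w3"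
  define n where "n = nn w4"
  define e where "e = pp w1 \<otimes>\<^bsub>Z\<^esub> qq w2 \<ominus>\<^bsub>Z\<^esub> qq w1 \<otimes>\<^bsub>Z\<^esub> pp w2"
  have cc: "m \<in> carrier Z" "n \<in> carrier Z" "e \<in> carrier Z"
    using wc by (auto simp: m_def n_def e_def)
  have y: "x \<otimes>\<^bsub>WN\<^esub> wact rho2 x = vec (pp x) (qq x) (pp x) (qq x)" if "x \<in> carrier WN" for x
    using that by (elim WN_E) (simp add: R.a_ac)
  have "vec (pp w1) (qq w1) (pp w1) (qq w1) \<in> ?J" "vec (pp w2) (qq w2) (pp w2) (qq w2) \<in> ?J"
    using J_mult [OF w(1) act(1) [OF w(1)]] J_mult [OF w(2) act(1) [OF w(2)]] y wc by auto
  then have "vscale (qq w2) (vec (pp w1) (qq w1) (pp w1) (qq w1)) \<otimes>\<^bsub>WN\<^esub>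
      inv\<^bsub>WN\<^esub> (vscale (qq w1) (vec (pp w2) (qq w2) (pp w2) (qq w2))) \<in> ?J"
    "vscale (pp w1) (vec (pp w2) (qq w2) (pp w2) (qq w2)) \<otimes>\<^bsub>WN\<^esub>
      inv\<^bsub>WN\<^esub> (vscale (pp w2) (vec (pp w1) (qq w1) (pp w1) (qq w1))) \<in> ?J"
    using wc by (auto intro!: J_mult J_inv J_scale simp del: vscale_vec)
  then have x12: "vec e \<zero>\<^bsub>Z\<^esub> e \<zero>\<^bsub>Z\<^esub> \<in> ?J" "vec \<zero>\<^bsub>Z\<^esub> e \<zero>\<^bsub>Z\<^esub> e \<in> ?J"
    using wc by (simp_all add: e_def a_minus_def R.m_comm R.r_neg)
  have "w3 \<otimes>\<^bsub>WN\<^esub> inv\<^bsub>WN\<^esub> (wact swap13 w3) \<in> ?J"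
    using w3(1) by (intro J_mult J_inv act)
  moreover have "w3 \<otimes>\<^bsub>WN\<^esub> inv\<^bsub>WN\<^esub> (wact swap13 w3) = vec m \<zero>\<^bsub>Z\<^esub> (\<ominus>\<^bsub>Z\<^esub> m) \<zero>\<^bsub>Z\<^esub>"
    using wc(3) unfolding m_def by (elim WN_E) (simp add: a_minus_def R.minus_add R.a_ac R.r_neg)
  ultimately have x3: "vec m \<zero>\<^bsub>Z\<^esub> (\<ominus>\<^bsub>Z\<^esub> m) \<zero>\<^bsub>Z\<^esub> \<in> ?J" by simp
  have "w4 \<otimes>\<^bsub>WN\<^esub> inv\<^bsub>WN\<^esub> (wact swap24 w4) \<in> ?J"
    using w4(1) by (intro J_mult J_inv act)
  moreover have "w4 \<otimes>\<^bsub>WN\<^esub> inv\<^bsub>WN\<^esub> (wact swap24 w4) = vec \<zero>\<^bsub>Z\<^esub> n \<zero>\<^bsub>Z\<^esub> (\<ominus>\<^bsub>Z\<^esub> n)"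
    using wc(4) unfolding n_def by (elim WN_E) (simp add: a_minus_def R.minus_add R.a_ac R.r_neg)
  ultimately have x4: "vec \<zero>\<^bsub>Z\<^esub> n \<zero>\<^bsub>Z\<^esub> (\<ominus>\<^bsub>Z\<^esub> n) \<in> ?J" by simp
  define c where "c = e \<otimes>\<^bsub>Z\<^esub> (m \<otimes>\<^bsub>Z\<^esub> n)"
  have c: "c \<in> carrier Z" "c \<noteq> \<zero>\<^bsub>Z\<^esub>"
    using cc w(3) w3(2) w4(2) R.integral unfolding c_def m_def n_def e_def by blast+
  have "vscale (m \<otimes>\<^bsub>Z\<^esub> n) (vec e \<zero>\<^bsub>Z\<^esub> e \<zero>\<^bsub>Z\<^esub>) \<in> ?J" "vscale (m \<otimes>\<^bsub>Z\<^esub> n) (vec \<zero>\<^bsub>Z\<^esub> e \<zero>\<^bsub>Z\<^esub> e) \<in> ?J"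
    "vscale (e \<otimes>\<^bsub>Z\<^esub> n) (vec m \<zero>\<^bsub>Z\<^esub> (\<ominus>\<^bsub>Z\<^esub> m) \<zero>\<^bsub>Z\<^esub>) \<in> ?J" "vscale (e \<otimes>\<^bsub>Z\<^esub> m) (vec \<zero>\<^bsub>Z\<^esub> n \<zero>\<^bsub>Z\<^esub> (\<ominus>\<^bsub>Z\<^esub> n)) \<in> ?J"
    using x12 x3 x4 cc by (auto intro!: J_scale simp del: vscale_vec)
  then have xs: "vec c \<zero>\<^bsub>Z\<^esub> c \<zero>\<^bsub>Z\<^esub> \<in> ?J" "vec \<zero>\<^bsub>Z\<^esub> c \<zero>\<^bsub>Z\<^esub> c \<in> ?J" "vec c \<zero>\<^bsub>Z\<^esub> (\<ominus>\<^bsub>Z\<^esub> c) \<zero>\<^bsub>Z\<^esub> \<in> ?J" "vec \<zero>\<^bsub>Z\<^esub> c \<zero>\<^bsub>Z\<^esub> (\<ominus>\<^bsub>Z\<^esub> c) \<in> ?J"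
    using cc by (simp_all add: c_def R.m_ac R.r_minus)
  have d: "c \<oplus>\<^bsub>Z\<^esub> c \<in> carrier Z" "c \<oplus>\<^bsub>Z\<^esub> c \<noteq> \<zero>\<^bsub>Z\<^esub>"
    using c double_eq_zero [of c] by auto
  show ?thesis
    by (rule open_if_basis_multiples [OF S d])
      (use J_mult [OF xs(1,3)] J_mult [OF xs(2,4)] J_mult [OF xs(1) J_inv [OF xs(3)]]
        J_mult [OF xs(2) J_inv [OF xs(4)]] c in \<open>simp_all add: R.r_neg\<close>)
qed

section \<open>Types of vertices and generic vectors\<close>

text \<open>What is needed for a neighbour over \<open>rho\<close>. Over a 4-cycle or a flip a
  generic neighbour makes up for any a. Over \<open>d4_klein\<close> the alternating sum can only
  come from a, and over the identity so does the plane component.\<close>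

definition type_A where
  "type_A a g \<longleftrightarrow> (g = id \<longrightarrow> tau a \<noteq> \<zero>\<^bsub>Z\<^esub> \<and> (mm a \<noteq> \<zero>\<^bsub>Z\<^esub> \<or> nn a \<noteq> \<zero>\<^bsub>Z\<^esub>)) \<and>
     (g \<in> d4_klein \<longrightarrow> tau a \<noteq> \<zero>\<^bsub>Z\<^esub>)"

text \<open>With vanishing alternating sum only neighbours in the four-group remain. On its trivial
  constituents a must then have a nonzero component, and so must it under the plane form that g
  itself fixes: nn for \<open>swap13\<close>, mm for \<open>swap24\<close>.\<close>

definition type_B where
  "type_B a g \<longleftrightarrow> g \<in> d4_klein \<and> tau a = \<zero>\<^bsub>Z\<^esub> \<and> sig a \<noteq> \<zero>\<^bsub>Z\<^esub> \<and>
     (g = swap13 \<longrightarrow> nn a \<noteq> \<zero>\<^bsub>Z\<^esub>) \<and> (g = swap24 \<longrightarrow> mm a \<noteq> \<zero>\<^bsub>Z\<^esub>)"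

text \<open>Excludes the coincidences that would make a translation found in
  \<open>virt_adj_rotation\<close> or \<open>virt_adj_klein\<close> degenerate. Disjointness from a
  finite set is what the choice of a parameter can guarantee.\<close>

definition generic_for where
  "generic_for b a \<longleftrightarrow> {sig b, tau b, mm b, nn b, mm b \<ominus>\<^bsub>Z\<^esub> nn b, mm b \<oplus>\<^bsub>Z\<^esub> nn b} \<inter>
     {\<zero>\<^bsub>Z\<^esub>, tau a, mm a, \<ominus>\<^bsub>Z\<^esub> mm a, nn a, mm a \<oplus>\<^bsub>Z\<^esub> nn a, nn a \<ominus>\<^bsub>Z\<^esub> mm a} = {}"

lemma exists_generic:
  "\<exists>b\<in>carrier WN. generic_for b a \<and> generic_for b a'"
proof -
  define F where "F a = {\<zero>\<^bsub>Z\<^esub>, tau a, mm a, \<ominus>\<^bsub>Z\<^esub> mm a, nn a, mm a \<oplus>\<^bsub>Z\<^esub> nn a, nn a \<ominus>\<^bsub>Z\<^esub> mm a}" for a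
  define C where "C = F a \<union> F a'"
  have one: "\<one>\<^bsub>Z\<^esub> \<noteq> \<zero>\<^bsub>Z\<^esub>" "\<one>\<^bsub>Z\<^esub> \<oplus>\<^bsub>Z\<^esub> \<one>\<^bsub>Z\<^esub> \<noteq> \<zero>\<^bsub>Z\<^esub>" "\<one>\<^bsub>Z\<^esub> \<oplus>\<^bsub>Z\<^esub> \<one>\<^bsub>Z\<^esub> \<oplus>\<^bsub>Z\<^esub> \<one>\<^bsub>Z\<^esub> \<noteq> \<zero>\<^bsub>Z\<^esub>"
    using torsion_free [of "\<one>\<^bsub>Z\<^esub>" 3] double_eq_zero [of "\<one>\<^bsub>Z\<^esub>"] by (auto simp: numeral_3_eq_3 R.a_assoc)
  have "finite (\<Union>c\<in>C. {t::nat. [t] \<cdot>\<^bsub>Z\<^esub> \<one>\<^bsub>Z\<^esub> = c} \<union> {t. [t] \<cdot>\<^bsub>Z\<^esub> (\<one>\<^bsub>Z\<^esub> \<oplus>\<^bsub>Z\<^esub> \<one>\<^bsub>Z\<^esub>) = c} \<union> {t. [t] \<cdot>\<^bsub>Z\<^esub> (\<one>\<^bsub>Z\<^esub> \<oplus>\<^bsub>Z\<^esub> \<one>\<^bsub>Z\<^esub> \<oplus>\<^bsub>Z\<^esub> \<one>\<^bsub>Z\<^esub>) = c})"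
    using one by (auto simp: C_def F_def intro!: finite_multiples_eq)
  then obtain t :: nat where "t \<notin> (\<Union>c\<in>C. {t::nat. [t] \<cdot>\<^bsub>Z\<^esub> \<one>\<^bsub>Z\<^esub> = c} \<union> {t. [t] \<cdot>\<^bsub>Z\<^esub> (\<one>\<^bsub>Z\<^esub> \<oplus>\<^bsub>Z\<^esub> \<one>\<^bsub>Z\<^esub>) = c} \<union> {t. [t] \<cdot>\<^bsub>Z\<^esub> (\<one>\<^bsub>Z\<^esub> \<oplus>\<^bsub>Z\<^esub> \<one>\<^bsub>Z\<^esub> \<oplus>\<^bsub>Z\<^esub> \<one>\<^bsub>Z\<^esub>) = c})"
    using ex_new_if_finite [OF infinite_UNIV_nat] by blast
  moreover define x where "x = [t] \<cdot>\<^bsub>Z\<^esub> \<one>\<^bsub>Z\<^esub>"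
  ultimately have x: "x \<notin> C" "x \<oplus>\<^bsub>Z\<^esub> x \<notin> C" "x \<oplus>\<^bsub>Z\<^esub> x \<oplus>\<^bsub>Z\<^esub> x \<notin> C" "x \<in> carrier Z"
    by (auto simp: R.add.nat_pow_distrib)
  \<comment> \<open>For (2x, x, 0, 0) all six forms take values among x, 2x and 3x, so it is enough
    that these three multiples avoid \<open>C\<close>.\<close>
  define b where "b = vec (x \<oplus>\<^bsub>Z\<^esub> x) x \<zero>\<^bsub>Z\<^esub> \<zero>\<^bsub>Z\<^esub>"
  have "{sig b, tau b, mm b, nn b, mm b \<ominus>\<^bsub>Z\<^esub> nn b, mm b \<oplus>\<^bsub>Z\<^esub> nn b} \<subseteq> {x, x \<oplus>\<^bsub>Z\<^esub> x, x \<oplus>\<^bsub>Z\<^esub> x \<oplus>\<^bsub>Z\<^esub> x}"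
    using x(4) by (auto simp: b_def a_minus_def R.a_assoc R.r_neg)
  moreover have "generic_for b d \<longleftrightarrow> {sig b, tau b, mm b, nn b, mm b \<ominus>\<^bsub>Z\<^esub> nn b, mm b \<oplus>\<^bsub>Z\<^esub> nn b} \<inter> F d = {}" for d
    by (simp only: generic_for_def F_def)
  moreover have "{x, x \<oplus>\<^bsub>Z\<^esub> x, x \<oplus>\<^bsub>Z\<^esub> x \<oplus>\<^bsub>Z\<^esub> x} \<inter> C = {}" using x(1-3) by blast
  ultimately have "generic_for b a" "generic_for b a'"
    unfolding C_def by blast+
  then show ?thesis using x(4) by (intro bexI [of _ b]) (auto simp: b_def)
qed

text \<open>A generic b has nonzero sum, so \<open>open_if_rotation\<close> asks for translations
  with nonzero alternating sum and nonzero plane component. If g is a rotation, (a, g) is divided by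
  the power of (b, rho) over g. If g is a reflection, so is g rho, and squares of elements over
  reflections are translations.\<close>

lemma virt_adj_rotation:
  assumes a: "a \<in> carrier WN" "g \<in> carrier D4" "type_A a g"
    and b: "b \<in> carrier WN" "generic_for b a"
  shows "virt_adj wext.G wext.T (a, g) (b, rho)"
proof (rule wext.virt_adj_if_translation_part)
  show "rho \<in> carrier D4" by (simp add: D4_carrier d4_class_defs)
  fix S assume S: "subgroup S wext.G" "(a, g) \<in> S" "(b, rho) \<in> S"
  let ?J = "wext.translation_part S"
  obtain a1 a2 a3 a4 where A: "a = vec a1 a2 a3 a4" "a1 \<in> carrier Z" "a2 \<in> carrier Z"
    "a3 \<in> carrier Z" "a4 \<in> carrier Z" using WN_E [OF a(1)] .
  obtain b1 b2 b3 b4 where B: "b = vec b1 b2 b3 b4" "b1 \<in> carrier Z" "b2 \<in> carrier Z"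
    "b3 \<in> carrier Z" "b4 \<in> carrier Z" using WN_E [OF b(1)] .
  note ab = A(1) B(1) and cl = A(2-5) B(2-5)
  have gen: "sig b \<noteq> \<zero>\<^bsub>Z\<^esub>" "tau a \<noteq> tau b" "mm a \<noteq> mm b" "mm a \<noteq> mm b \<ominus>\<^bsub>Z\<^esub> nn b" "\<ominus>\<^bsub>Z\<^esub> mm a \<noteq> nn b"
    "mm a \<oplus>\<^bsub>Z\<^esub> nn a \<noteq> mm b \<ominus>\<^bsub>Z\<^esub> nn b" "nn a \<ominus>\<^bsub>Z\<^esub> mm a \<noteq> mm b \<oplus>\<^bsub>Z\<^esub> nn b" "nn a \<noteq> mm b"
    using b(2) by (auto simp: generic_for_def)
  have ab_c: "tau a \<ominus>\<^bsub>Z\<^esub> tau b \<noteq> \<zero>\<^bsub>Z\<^esub>" "mm a \<ominus>\<^bsub>Z\<^esub> mm b \<noteq> \<zero>\<^bsub>Z\<^esub>" "mm a \<ominus>\<^bsub>Z\<^esub> (mm b \<ominus>\<^bsub>Z\<^esub> nn b) \<noteq> \<zero>\<^bsub>Z\<^esub>"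
    "\<ominus>\<^bsub>Z\<^esub> mm a \<ominus>\<^bsub>Z\<^esub> nn b \<noteq> \<zero>\<^bsub>Z\<^esub>" "(mm a \<oplus>\<^bsub>Z\<^esub> nn a) \<ominus>\<^bsub>Z\<^esub> (mm b \<ominus>\<^bsub>Z\<^esub> nn b) \<noteq> \<zero>\<^bsub>Z\<^esub>"
    "(nn a \<ominus>\<^bsub>Z\<^esub> mm a) \<ominus>\<^bsub>Z\<^esub> (mm b \<oplus>\<^bsub>Z\<^esub> nn b) \<noteq> \<zero>\<^bsub>Z\<^esub>" "nn a \<ominus>\<^bsub>Z\<^esub> mm b \<noteq> \<zero>\<^bsub>Z\<^esub>"
    using gen a(1) b(1) by (intro diff_nonzero; simp)+
  have "\<exists>w1\<in>?J. \<exists>w2\<in>?J. tau w1 \<noteq> \<zero>\<^bsub>Z\<^esub> \<and> (mm w2 \<noteq> \<zero>\<^bsub>Z\<^esub> \<or> nn w2 \<noteq> \<zero>\<^bsub>Z\<^esub>)"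
  proof -
    have square: "(x, h) \<in> S \<Longrightarrow> h \<circ> h = id \<Longrightarrow> x \<otimes>\<^bsub>WN\<^esub> wact h x \<in> ?J" for x h
      using subgroup.m_closed [OF S(1), of "(x, h)" "(x, h)"] subgroup.subset [OF S(1)]
      by (intro wext.translation_part_incl) auto
    have b2: "(b \<otimes>\<^bsub>WN\<^esub> wact rho b, rho2) \<in> S"
      using subgroup.m_closed [OF S(1,3,3)] by simp
    have b3: "(b \<otimes>\<^bsub>WN\<^esub> wact rho b \<otimes>\<^bsub>WN\<^esub> wact rho2 b, rho3) \<in> S"
      using subgroup.m_closed [OF S(1) b2 S(3)] by simp
    have gr: "(a \<otimes>\<^bsub>WN\<^esub> wact g b, g \<circ> rho) \<in> S"
      using subgroup.m_closed [OF S(1,2,3)] by simp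
    have dbl: "x \<oplus>\<^bsub>Z\<^esub> x \<noteq> \<zero>\<^bsub>Z\<^esub>" if "x \<in> carrier Z" "x \<noteq> \<zero>\<^bsub>Z\<^esub>" for x
      using double_eq_zero that by blast
    consider "g = id" | "g = rho" | "g = rho2" | "g = rho3" | "g = swap13" | "g = swap24"
      | "g = flip12" | "g = flip14"
      using a(2) by (auto simp: D4_carrier d4_class_defs)
    then show ?thesis
    proof cases
      case 1
      then have "a \<in> ?J" using S(2) a(1) by (intro wext.translation_part_incl) auto
      then show ?thesis using a(3) 1 by (auto simp: type_A_def)
    next
      case 2
      have "a \<otimes>\<^bsub>WN\<^esub> inv\<^bsub>WN\<^esub> b \<in> ?J"
        using wext.translation_part_diff [OF S(1)] S 2 by blast
      moreover have "tau (a \<otimes>\<^bsub>WN\<^esub> inv\<^bsub>WN\<^esub> b) = tau a \<ominus>\<^bsub>Z\<^esub> tau b" "mm (a \<otimes>\<^bsub>WN\<^esub> inv\<^bsub>WN\<^esub> b) = mm a \<ominus>\<^bsub>Z\<^esub> mm b"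
        by (simp_all add: ab cl a_minus_def R.minus_add R.a_ac)
      ultimately show ?thesis using ab_c by metis
    next
      case 3
      let ?w = "a \<otimes>\<^bsub>WN\<^esub> inv\<^bsub>WN\<^esub> (b \<otimes>\<^bsub>WN\<^esub> wact rho b)"
      have "?w \<in> ?J"
        using wext.translation_part_diff [OF S(1)] S 3 b2 by blast
      moreover have "tau ?w = tau a" "mm ?w = mm a \<ominus>\<^bsub>Z\<^esub> (mm b \<ominus>\<^bsub>Z\<^esub> nn b)"
        by (simp add: ab cl; simp add: cl fun_eq_iff Zp_apply mod_simps del: power_Suc;
            simp add: algebra_simps)+
      moreover have "tau a \<noteq> \<zero>\<^bsub>Z\<^esub>" using a(3) 3 by (simp add: type_A_def d4_class_defs)
      ultimately show ?thesis using ab_c by metis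
    next
      case 4
      let ?w = "a \<otimes>\<^bsub>WN\<^esub> inv\<^bsub>WN\<^esub> (b \<otimes>\<^bsub>WN\<^esub> wact rho b \<otimes>\<^bsub>WN\<^esub> wact rho2 b)"
      have "?w \<in> ?J"
        using wext.translation_part_diff [OF S(1)] S 4 b3 by blast
      moreover have "tau ?w = tau a \<ominus>\<^bsub>Z\<^esub> tau b" "mm ?w = \<ominus>\<^bsub>Z\<^esub> (\<ominus>\<^bsub>Z\<^esub> mm a \<ominus>\<^bsub>Z\<^esub> nn b)"
        by (simp add: ab cl; simp add: cl fun_eq_iff Zp_apply mod_simps del: power_Suc;
            simp add: algebra_simps)+
      moreover have "\<ominus>\<^bsub>Z\<^esub> (\<ominus>\<^bsub>Z\<^esub> mm a \<ominus>\<^bsub>Z\<^esub> nn b) \<noteq> \<zero>\<^bsub>Z\<^esub>"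
        using ab_c(4) a(1) b(1) by (simp add: R.add.inv_eq_1_iff)
      ultimately show ?thesis using ab_c by metis
    next
      \<comment> \<open>The square of (a, g) supplies the alternating sum; the product with (b, rho)
        lies over a flip, and its square supplies the plane component.\<close>
      case 5
      let ?c = "a \<otimes>\<^bsub>WN\<^esub> wact swap13 b"
      have "a \<otimes>\<^bsub>WN\<^esub> wact swap13 a \<in> ?J" "?c \<otimes>\<^bsub>WN\<^esub> wact flip12 ?c \<in> ?J"
        using square [of a swap13] square [of ?c flip12] S gr 5 by auto
      moreover have "tau (a \<otimes>\<^bsub>WN\<^esub> wact swap13 a) = tau a \<oplus>\<^bsub>Z\<^esub> tau a"
        by (simp add: ab cl a_minus_def R.minus_add R.a_ac)
      moreover have "mm (?c \<otimes>\<^bsub>WN\<^esub> wact flip12 ?c) = (mm a \<oplus>\<^bsub>Z\<^esub> nn a) \<ominus>\<^bsub>Z\<^esub> (mm b \<ominus>\<^bsub>Z\<^esub> nn b)"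
        by (simp add: ab cl; simp add: cl fun_eq_iff Zp_apply mod_simps del: power_Suc;
            simp add: algebra_simps)+
      moreover have "tau a \<oplus>\<^bsub>Z\<^esub> tau a \<noteq> \<zero>\<^bsub>Z\<^esub>" using a 5 dbl by (simp add: type_A_def d4_class_defs)
      ultimately show ?thesis using ab_c by metis
    next
      case 6
      let ?c = "a \<otimes>\<^bsub>WN\<^esub> wact swap24 b"
      have "a \<otimes>\<^bsub>WN\<^esub> wact swap24 a \<in> ?J" "?c \<otimes>\<^bsub>WN\<^esub> wact flip14 ?c \<in> ?J"
        using square [of a swap24] square [of ?c flip14] S gr 6 by auto
      moreover have "tau (a \<otimes>\<^bsub>WN\<^esub> wact swap24 a) = tau a \<oplus>\<^bsub>Z\<^esub> tau a"
        by (simp add: ab cl a_minus_def R.minus_add R.a_ac)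
      moreover have "mm (?c \<otimes>\<^bsub>WN\<^esub> wact flip14 ?c) = \<ominus>\<^bsub>Z\<^esub> ((nn a \<ominus>\<^bsub>Z\<^esub> mm a) \<ominus>\<^bsub>Z\<^esub> (mm b \<oplus>\<^bsub>Z\<^esub> nn b))"
        by (simp add: ab cl; simp add: cl fun_eq_iff Zp_apply mod_simps del: power_Suc;
            simp add: algebra_simps)+
      moreover have "\<ominus>\<^bsub>Z\<^esub> ((nn a \<ominus>\<^bsub>Z\<^esub> mm a) \<ominus>\<^bsub>Z\<^esub> (mm b \<oplus>\<^bsub>Z\<^esub> nn b)) \<noteq> \<zero>\<^bsub>Z\<^esub>"
        using ab_c(6) a(1) b(1) by (simp add: R.add.inv_eq_1_iff)
      moreover have "tau a \<oplus>\<^bsub>Z\<^esub> tau a \<noteq> \<zero>\<^bsub>Z\<^esub>" using a 6 dbl by (simp add: type_A_def d4_class_defs)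
      ultimately show ?thesis by metis
    next
      \<comment> \<open>The product with (b, rho) lies over a reflection in a diagonal, and its
        square alone supplies both components.\<close>
      case 7
      let ?c = "a \<otimes>\<^bsub>WN\<^esub> wact flip12 b"
      have "?c \<otimes>\<^bsub>WN\<^esub> wact swap24 ?c \<in> ?J"
        using square [of ?c swap24] S gr 7 by auto
      moreover have "tau (?c \<otimes>\<^bsub>WN\<^esub> wact swap24 ?c) = (tau a \<ominus>\<^bsub>Z\<^esub> tau b) \<oplus>\<^bsub>Z\<^esub> (tau a \<ominus>\<^bsub>Z\<^esub> tau b)"
        "mm (?c \<otimes>\<^bsub>WN\<^esub> wact swap24 ?c) = \<ominus>\<^bsub>Z\<^esub> ((\<ominus>\<^bsub>Z\<^esub> mm a \<ominus>\<^bsub>Z\<^esub> nn b) \<oplus>\<^bsub>Z\<^esub> (\<ominus>\<^bsub>Z\<^esub> mm a \<ominus>\<^bsub>Z\<^esub> nn b))"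
        by (simp add: ab cl; simp add: cl fun_eq_iff Zp_apply mod_simps del: power_Suc;
            simp add: algebra_simps)+
      moreover have "\<ominus>\<^bsub>Z\<^esub> ((\<ominus>\<^bsub>Z\<^esub> mm a \<ominus>\<^bsub>Z\<^esub> nn b) \<oplus>\<^bsub>Z\<^esub> (\<ominus>\<^bsub>Z\<^esub> mm a \<ominus>\<^bsub>Z\<^esub> nn b)) \<noteq> \<zero>\<^bsub>Z\<^esub>"
        using dbl [OF _ ab_c(4)] a(1) b(1) by (simp add: R.add.inv_eq_1_iff)
      moreover have "(tau a \<ominus>\<^bsub>Z\<^esub> tau b) \<oplus>\<^bsub>Z\<^esub> (tau a \<ominus>\<^bsub>Z\<^esub> tau b) \<noteq> \<zero>\<^bsub>Z\<^esub>"
        using dbl [OF _ ab_c(1)] a(1) b(1) by simp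
      ultimately show ?thesis by metis
    next
      case 8
      let ?c = "a \<otimes>\<^bsub>WN\<^esub> wact flip14 b"
      have "?c \<otimes>\<^bsub>WN\<^esub> wact swap13 ?c \<in> ?J"
        using square [of ?c swap13] S gr 8 by auto
      moreover have "tau (?c \<otimes>\<^bsub>WN\<^esub> wact swap13 ?c) = (tau a \<ominus>\<^bsub>Z\<^esub> tau b) \<oplus>\<^bsub>Z\<^esub> (tau a \<ominus>\<^bsub>Z\<^esub> tau b)"
        "nn (?c \<otimes>\<^bsub>WN\<^esub> wact swap13 ?c) = (nn a \<ominus>\<^bsub>Z\<^esub> mm b) \<oplus>\<^bsub>Z\<^esub> (nn a \<ominus>\<^bsub>Z\<^esub> mm b)"
        by (simp add: ab cl; simp add: cl fun_eq_iff Zp_apply mod_simps del: power_Suc;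
            simp add: algebra_simps)+
      moreover have "(tau a \<ominus>\<^bsub>Z\<^esub> tau b) \<oplus>\<^bsub>Z\<^esub> (tau a \<ominus>\<^bsub>Z\<^esub> tau b) \<noteq> \<zero>\<^bsub>Z\<^esub>"
        "(nn a \<ominus>\<^bsub>Z\<^esub> mm b) \<oplus>\<^bsub>Z\<^esub> (nn a \<ominus>\<^bsub>Z\<^esub> mm b) \<noteq> \<zero>\<^bsub>Z\<^esub>"
        using dbl [OF _ ab_c(1)] dbl [OF _ ab_c(7)] a(1) b(1) by simp_all
      ultimately show ?thesis by metis
    qed
  qed
  then show "\<exists>n. \<forall>v\<in>carrier WN. v [^]\<^bsub>WN\<^esub> ((2::nat) ^ n) \<in> ?J"
    using open_if_rotation [OF S(1,3) gen(1)] by blast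
qed (use a b in auto)

lemma form_wact_klein:
  assumes "v \<in> carrier WN" "k = id \<or> k \<in> d4_klein"
  shows "tau (wact k v) = tau v" "pp (wact k v) = pp v" "qq (wact k v) = qq v"
  using assms by (auto elim!: WN_E simp: d4_class_defs a_minus_def R.a_ac)

lemma tau_wact_odd:
  assumes "v \<in> carrier WN" "k \<in> d4_rotations \<union> d4_flips"
  shows "tau (wact k v) = \<ominus>\<^bsub>Z\<^esub> tau v"
  using assms by (auto elim!: WN_E simp: d4_class_defs a_minus_def R.minus_add R.a_ac)

lemma mm_nn_wact:
  assumes "v \<in> carrier WN"
  shows "mm (wact swap24 v) = mm v" "mm (wact rho2 v) = \<ominus>\<^bsub>Z\<^esub> mm v" "mm (wact swap13 v) = \<ominus>\<^bsub>Z\<^esub> mm v"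
    "nn (wact swap13 v) = nn v" "nn (wact rho2 v) = \<ominus>\<^bsub>Z\<^esub> nn v" "nn (wact swap24 v) = \<ominus>\<^bsub>Z\<^esub> nn v"
  using assms by (auto elim!: WN_E simp: a_minus_def R.minus_add R.a_ac)

lemma form_sums:
  assumes "v \<in> carrier WN"
  shows "tau v = pp v \<ominus>\<^bsub>Z\<^esub> qq v" "sig v = pp v \<oplus>\<^bsub>Z\<^esub> qq v"
  using assms by (auto elim!: WN_E simp: a_minus_def R.minus_add R.a_ac)

lemma WN_hom_simps:
  assumes f: "f \<in> hom WN (add_monoid Z)"
  shows "v \<in> carrier WN \<Longrightarrow> f v \<in> carrier Z"
    "v \<in> carrier WN \<Longrightarrow> w \<in> carrier WN \<Longrightarrow> f (v \<otimes>\<^bsub>WN\<^esub> w) = f v \<oplus>\<^bsub>Z\<^esub> f w"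
    "v \<in> carrier WN \<Longrightarrow> f (inv\<^bsub>WN\<^esub> v) = \<ominus>\<^bsub>Z\<^esub> f v"
    "v \<in> carrier WN \<Longrightarrow> f (v [^]\<^bsub>WN\<^esub> (n::nat)) = [n] \<cdot>\<^bsub>Z\<^esub> f v"
    "f \<one>\<^bsub>WN\<^esub> = \<zero>\<^bsub>Z\<^esub>"
proof -
  interpret h: group_hom WN "add_monoid Z" f
    using f R.add.is_group comm_group.axioms(2) [OF WN_comm_group]
    by (intro group_hom.intro group_hom_axioms.intro)
  show "v \<in> carrier WN \<Longrightarrow> f v \<in> carrier Z"
    using h.hom_closed by simp
  show "v \<in> carrier WN \<Longrightarrow> w \<in> carrier WN \<Longrightarrow> f (v \<otimes>\<^bsub>WN\<^esub> w) = f v \<oplus>\<^bsub>Z\<^esub> f w"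
    using h.hom_mult by simp
  show "v \<in> carrier WN \<Longrightarrow> f (inv\<^bsub>WN\<^esub> v) = \<ominus>\<^bsub>Z\<^esub> f v"
    using h.hom_inv by (simp add: a_inv_def)
  show "v \<in> carrier WN \<Longrightarrow> f (v [^]\<^bsub>WN\<^esub> n) = [n] \<cdot>\<^bsub>Z\<^esub> f v"
    using h.hom_nat_pow by (simp add: add_pow_def)
  show "f \<one>\<^bsub>WN\<^esub> = \<zero>\<^bsub>Z\<^esub>"
    using h.hom_one by simp
qed

lemma form_mult:
  assumes "v \<in> carrier WN" "w \<in> carrier WN"
  shows "tau (v \<otimes>\<^bsub>WN\<^esub> w) = tau v \<oplus>\<^bsub>Z\<^esub> tau w" "mm (v \<otimes>\<^bsub>WN\<^esub> w) = mm v \<oplus>\<^bsub>Z\<^esub> mm w"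
    "nn (v \<otimes>\<^bsub>WN\<^esub> w) = nn v \<oplus>\<^bsub>Z\<^esub> nn w" "pp (v \<otimes>\<^bsub>WN\<^esub> w) = pp v \<oplus>\<^bsub>Z\<^esub> pp w"
    "qq (v \<otimes>\<^bsub>WN\<^esub> w) = qq v \<oplus>\<^bsub>Z\<^esub> qq w"
  using assms WN_hom_simps(2) form_hom by blast+

text \<open>The product of the two elements lies over the third element of \<open>d4_klein\<close>,
  and all three squares are translations. As tau a = 0 means pp a = qq a, the determinant from the
  first two squares is 4 pp a (qq b - pp b), and the last factor is -tau b. The square over
  \<open>swap24\<close>, which fixes mm, supplies mm, and that over \<open>swap13\<close> supplies
  nn.\<close>

lemma virt_adj_klein:
  assumes a: "a \<in> carrier WN" "type_B a g"
    and b: "b \<in> carrier WN" "generic_for b a" and h: "h \<in> d4_klein" "h \<noteq> g"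
  shows "virt_adj wext.G wext.T (a, g) (b, h)"
proof (rule wext.virt_adj_if_translation_part)
  show D4: "g \<in> carrier D4" "h \<in> carrier D4" using a h by (auto simp: type_B_def D4_carrier)
  fix S assume S: "subgroup S wext.G" "(a, g) \<in> S" "(b, h) \<in> S"
  let ?J = "wext.translation_part S"
  have g: "g \<in> d4_klein" using a by (simp add: type_B_def)
  have square: "(x, k) \<in> S \<Longrightarrow> k \<in> d4_klein \<Longrightarrow> x \<otimes>\<^bsub>WN\<^esub> wact k x \<in> ?J" for x k
    using subgroup.m_closed [OF S(1), of "(x, k)" "(x, k)"] subgroup.subset [OF S(1)]
    by (intro wext.translation_part_incl) (auto simp: d4_klein_def)
  have dbl: "x \<oplus>\<^bsub>Z\<^esub> x \<noteq> \<zero>\<^bsub>Z\<^esub>" if "x \<in> carrier Z" "x \<noteq> \<zero>\<^bsub>Z\<^esub>" for x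
    using double_eq_zero that by blast
  define c where "c = a \<otimes>\<^bsub>WN\<^esub> wact g b"
  have gh: "(c, g \<circ> h) \<in> S"
    unfolding c_def using subgroup.m_closed [OF S] by simp
  have cases: "g = rho2 \<and> h = swap13 \<and> g \<circ> h = swap24 \<or> g = swap13 \<and> h = rho2 \<and> g \<circ> h = swap24 \<or>
      g = rho2 \<and> h = swap24 \<and> g \<circ> h = swap13 \<or> g = swap24 \<and> h = rho2 \<and> g \<circ> h = swap13 \<or>
      g = swap13 \<and> h = swap24 \<and> g \<circ> h = rho2 \<or> g = swap24 \<and> h = swap13 \<and> g \<circ> h = rho2"
    using g h unfolding d4_klein_def by (elim insertE emptyE) simp_all
  have wc: "wact g a \<in> carrier WN" "wact g b \<in> carrier WN" "wact h b \<in> carrier WN" "c \<in> carrier WN"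
    using D4 a b by (auto simp: c_def)
  have "g \<circ> h \<in> d4_klein" using cases by (elim disjE conjE) (simp_all add: d4_klein_def)
  note w1 = square [OF S(2) g] and w2 = square [OF S(3) h(1)] and w5 = square [OF gh this]
  have pq: "pp a = qq a"
    using a form_sums(1) [of a] R.r_right_minus_eq [of "pp a" "qq a"] by (auto simp: type_B_def)
  have pa: "pp a \<noteq> \<zero>\<^bsub>Z\<^esub>"
    using a form_sums(2) [of a] pq by (auto simp: type_B_def)
  have tb: "pp b \<noteq> qq b"
  proof -
    have "tau b \<noteq> \<zero>\<^bsub>Z\<^esub>" using b(2) unfolding generic_for_def by blast
    then show ?thesis using b(1) form_sums(1) [of b] R.r_right_minus_eq [of "pp b" "qq b"] by simp
  qed
  have det: "pp (a \<otimes>\<^bsub>WN\<^esub> wact g a) \<otimes>\<^bsub>Z\<^esub> qq (b \<otimes>\<^bsub>WN\<^esub> wact h b) \<ominus>\<^bsub>Z\<^esub>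
      qq (a \<otimes>\<^bsub>WN\<^esub> wact g a) \<otimes>\<^bsub>Z\<^esub> pp (b \<otimes>\<^bsub>WN\<^esub> wact h b) \<noteq> \<zero>\<^bsub>Z\<^esub>"
  proof
    assume "pp (a \<otimes>\<^bsub>WN\<^esub> wact g a) \<otimes>\<^bsub>Z\<^esub> qq (b \<otimes>\<^bsub>WN\<^esub> wact h b) \<ominus>\<^bsub>Z\<^esub>
      qq (a \<otimes>\<^bsub>WN\<^esub> wact g a) \<otimes>\<^bsub>Z\<^esub> pp (b \<otimes>\<^bsub>WN\<^esub> wact h b) = \<zero>\<^bsub>Z\<^esub>"
    then have "(pp a \<oplus>\<^bsub>Z\<^esub> pp a) \<otimes>\<^bsub>Z\<^esub> (qq b \<oplus>\<^bsub>Z\<^esub> qq b) = (pp a \<oplus>\<^bsub>Z\<^esub> pp a) \<otimes>\<^bsub>Z\<^esub> (pp b \<oplus>\<^bsub>Z\<^esub> pp b)"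
      using a b wc g h pq by (simp add: form_mult form_wact_klein R.r_right_minus_eq)
    then have eq: "qq b \<oplus>\<^bsub>Z\<^esub> qq b = pp b \<oplus>\<^bsub>Z\<^esub> pp b"
      using dbl [OF _ pa] a b by (subst (asm) R.m_lcancel) auto
    have "(pp b \<ominus>\<^bsub>Z\<^esub> qq b) \<oplus>\<^bsub>Z\<^esub> (pp b \<ominus>\<^bsub>Z\<^esub> qq b) = (pp b \<oplus>\<^bsub>Z\<^esub> pp b) \<ominus>\<^bsub>Z\<^esub> (qq b \<oplus>\<^bsub>Z\<^esub> qq b)"
      using b by (simp add: a_minus_def R.minus_add R.a_ac)
    also have "\<dots> = \<zero>\<^bsub>Z\<^esub>" using eq b by (simp add: R.r_right_minus_eq)
    finally have "pp b \<ominus>\<^bsub>Z\<^esub> qq b = \<zero>\<^bsub>Z\<^esub>" using double_eq_zero [of "pp b \<ominus>\<^bsub>Z\<^esub> qq b"] b by simp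
    then show False using tb b by (simp add: R.r_right_minus_eq)
  qed
  have dbl_diff: "(x \<oplus>\<^bsub>Z\<^esub> \<ominus>\<^bsub>Z\<^esub> y) \<oplus>\<^bsub>Z\<^esub> (x \<oplus>\<^bsub>Z\<^esub> \<ominus>\<^bsub>Z\<^esub> y) \<noteq> \<zero>\<^bsub>Z\<^esub>" if "x \<in> carrier Z" "y \<in> carrier Z" "x \<noteq> y" for x y
    using dbl [of "x \<ominus>\<^bsub>Z\<^esub> y"] R.r_right_minus_eq [of x y] that by (simp add: a_minus_def)
  have gen: "mm b \<noteq> \<zero>\<^bsub>Z\<^esub>" "nn b \<noteq> \<zero>\<^bsub>Z\<^esub>" "mm a \<noteq> mm b" "nn a \<noteq> nn b"
    using b(2) unfolding generic_for_def by blast+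
  have "\<exists>w\<in>?J. mm w \<noteq> \<zero>\<^bsub>Z\<^esub>"
  proof -
    consider "g = swap24" | "h = swap24" | "g \<circ> h = swap24" "g = rho2 \<or> g = swap13"
      using cases by blast
    then show ?thesis
    proof cases
      case 1
      then have "mm (a \<otimes>\<^bsub>WN\<^esub> wact g a) \<noteq> \<zero>\<^bsub>Z\<^esub>"
        using a wc dbl [of "mm a"] by (simp add: form_mult mm_nn_wact type_B_def)
      then show ?thesis using w1 by blast
    next
      case 2
      then have "mm (b \<otimes>\<^bsub>WN\<^esub> wact h b) \<noteq> \<zero>\<^bsub>Z\<^esub>"
        using b wc dbl [of "mm b"] gen by (simp add: form_mult mm_nn_wact)
      then show ?thesis using w2 by blast
    next
      \<comment> \<open>Here g negates mm, so mm c is the difference of mm a and mm b, nonzero by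
        genericity.\<close>
      case 3
      have "mm c = mm a \<oplus>\<^bsub>Z\<^esub> \<ominus>\<^bsub>Z\<^esub> mm b"
        using a b wc 3(2) unfolding c_def by (auto simp: form_mult mm_nn_wact)
      moreover have "mm (c \<otimes>\<^bsub>WN\<^esub> wact (g \<circ> h) c) = mm c \<oplus>\<^bsub>Z\<^esub> mm c"
        using wc 3(1) wext.act_closed [OF _ wc(4), of swap24]
        by (simp add: form_mult mm_nn_wact D4_carrier d4_klein_def)
      ultimately have "mm (c \<otimes>\<^bsub>WN\<^esub> wact (g \<circ> h) c) \<noteq> \<zero>\<^bsub>Z\<^esub>"
        using dbl_diff a b gen by simp
      then show ?thesis using w5 by blast
    qed
  qed
  moreover have "\<exists>w\<in>?J. nn w \<noteq> \<zero>\<^bsub>Z\<^esub>"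
  proof -
    consider "g = swap13" | "h = swap13" | "g \<circ> h = swap13" "g = rho2 \<or> g = swap24"
      using cases by blast
    then show ?thesis
    proof cases
      case 1
      then have "nn (a \<otimes>\<^bsub>WN\<^esub> wact g a) \<noteq> \<zero>\<^bsub>Z\<^esub>"
        using a wc dbl [of "nn a"] by (simp add: form_mult mm_nn_wact type_B_def)
      then show ?thesis using w1 by blast
    next
      case 2
      then have "nn (b \<otimes>\<^bsub>WN\<^esub> wact h b) \<noteq> \<zero>\<^bsub>Z\<^esub>"
        using b wc dbl [of "nn b"] gen by (simp add: form_mult mm_nn_wact)
      then show ?thesis using w2 by blast
    next
      case 3
      have "nn c = nn a \<oplus>\<^bsub>Z\<^esub> \<ominus>\<^bsub>Z\<^esub> nn b"
        using a b wc 3(2) unfolding c_def by (auto simp: form_mult mm_nn_wact)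
      moreover have "nn (c \<otimes>\<^bsub>WN\<^esub> wact (g \<circ> h) c) = nn c \<oplus>\<^bsub>Z\<^esub> nn c"
        using wc 3(1) wext.act_closed [OF _ wc(4), of swap13]
        by (simp add: form_mult mm_nn_wact D4_carrier d4_klein_def)
      ultimately have "nn (c \<otimes>\<^bsub>WN\<^esub> wact (g \<circ> h) c) \<noteq> \<zero>\<^bsub>Z\<^esub>"
        using dbl_diff a b gen by simp
      then show ?thesis using w5 by blast
    qed
  qed
  moreover obtain b1 b2 b3 where "(b1, rho2) \<in> S" "(b2, swap13) \<in> S" "(b3, swap24) \<in> S"
    using cases
  proof (elim disjE conjE)
  qed (use that S(2,3) gh in simp_all)
  ultimately show "\<exists>n. \<forall>v\<in>carrier WN. v [^]\<^bsub>WN\<^esub> ((2::nat) ^ n) \<in> ?J"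
    by (elim bexE) (rule open_if_klein [OF S(1) _ _ _ w1 w2 det])
qed (use a b in auto)

section \<open>Nonadjacency in the wreath product\<close>

text \<open>Modulo the kernel of f the first element acts trivially and the second as the reflection
  x -> f b - x, so b / 2 is a common fixed point.\<close>

lemma not_virt_adj_if_eigenform:
  assumes f: "f \<in> hom WN (add_monoid Z)" and nonzero: "v\<^sub>0 \<in> carrier WN" "f v\<^sub>0 \<noteq> \<zero>\<^bsub>Z\<^esub>"
    and g: "\<And>v. v \<in> carrier WN \<Longrightarrow> f (wact g v) = f v"
    and h: "\<And>v. v \<in> carrier WN \<Longrightarrow> f (wact h v) = \<ominus>\<^bsub>Z\<^esub> f v"
    and a: "f a = \<zero>\<^bsub>Z\<^esub>"
  shows "\<not> virt_adj wext.G wext.T (a, g) (b, h)"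
proof
  assume adj: "virt_adj wext.G wext.T (a, g) (b, h)"
  then have c: "a \<in> carrier WN" "b \<in> carrier WN" "g \<in> carrier D4" "h \<in> carrier D4"
    by (auto simp: virt_adj_def)
  note f_simps = WN_hom_simps [OF f]
  have "\<not> virt_adj wext.G wext.T (a, g) (b, h)"
    by (rule wext.not_virt_adj_if_functionals [OF prime_p, of "{f}" f v\<^sub>0 2 b])
      (use f nonzero c g h a f_simps in
        \<open>simp_all add: R.add.inv_eq_1_iff add_pow_two R.a_assoc R.r_neg R.l_neg R.r_neg2\<close>)
  then show False using adj by blast
qed

text \<open>The combination f' b f - f b f' of two invariant forms kills b as well as a, and the
  origin is fixed modulo its kernel. The vectors v and v' witness that f and f' are independent; if
  both vanish at b, f itself is taken.\<close>

lemma not_virt_adj_if_invariant_forms: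
  assumes f: "f \<in> hom WN (add_monoid Z)" "f' \<in> hom WN (add_monoid Z)"
    and v: "v \<in> carrier WN" "f v \<noteq> \<zero>\<^bsub>Z\<^esub>" "f' v = \<zero>\<^bsub>Z\<^esub>"
    and v': "v' \<in> carrier WN" "f' v' \<noteq> \<zero>\<^bsub>Z\<^esub>" "f v' = \<zero>\<^bsub>Z\<^esub>"
    and g: "\<And>v. v \<in> carrier WN \<Longrightarrow> f (wact g v) = f v \<and> f' (wact g v) = f' v"
    and h: "\<And>v. v \<in> carrier WN \<Longrightarrow> f (wact h v) = f v \<and> f' (wact h v) = f' v"
    and a: "f a = \<zero>\<^bsub>Z\<^esub>" "f' a = \<zero>\<^bsub>Z\<^esub>"
  shows "\<not> virt_adj wext.G wext.T (a, g) (b, h)"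
proof
  assume adj: "virt_adj wext.G wext.T (a, g) (b, h)"
  then have c: "a \<in> carrier WN" "b \<in> carrier WN" "g \<in> carrier D4" "h \<in> carrier D4"
    by (auto simp: virt_adj_def)
  note f_simps = WN_hom_simps [OF f(1)] WN_hom_simps [OF f(2)]
  define F where "F = (if f b = \<zero>\<^bsub>Z\<^esub> \<and> f' b = \<zero>\<^bsub>Z\<^esub> then f else (\<lambda>x. f' b \<otimes>\<^bsub>Z\<^esub> f x \<oplus>\<^bsub>Z\<^esub> \<ominus>\<^bsub>Z\<^esub> (f b) \<otimes>\<^bsub>Z\<^esub> f' x))"
  have F: "F \<in> hom WN (add_monoid Z)"
    using f c f_simps by (auto simp: F_def R.r_distr R.minus_add R.a_ac intro!: homI)
  have "f' b \<otimes>\<^bsub>Z\<^esub> f b \<oplus>\<^bsub>Z\<^esub> \<ominus>\<^bsub>Z\<^esub> (f b) \<otimes>\<^bsub>Z\<^esub> f' b = \<zero>\<^bsub>Z\<^esub>"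
    using c f_simps by (simp add: R.l_minus R.m_comm [of "f' b" "f b"] R.r_neg)
  then have Fb: "F b = \<zero>\<^bsub>Z\<^esub>" and Fa: "F a = \<zero>\<^bsub>Z\<^esub>"
    using c a f_simps by (simp_all add: F_def)
  have "\<exists>x\<in>carrier WN. F x \<noteq> \<zero>\<^bsub>Z\<^esub>"
  proof (cases "f b = \<zero>\<^bsub>Z\<^esub> \<and> f' b = \<zero>\<^bsub>Z\<^esub>")
    case True
    then show ?thesis using v by (auto simp: F_def)
  next
    case False
    then have "F v \<noteq> \<zero>\<^bsub>Z\<^esub> \<or> F v' \<noteq> \<zero>\<^bsub>Z\<^esub>"
      using v v' c f_simps by (cases "f' b = \<zero>\<^bsub>Z\<^esub>") (simp_all add: F_def R.integral_iff R.add.inv_eq_1_iff)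
    then show ?thesis using v v' by blast
  qed
  then obtain x where x: "x \<in> carrier WN" "F x \<noteq> \<zero>\<^bsub>Z\<^esub>" by blast
  have inv: "F (wact g w) = F w" "F (wact h w) = F w" if "w \<in> carrier WN" for w
    using that g h by (simp_all add: F_def)
  note F_simps = WN_hom_simps [OF F]
  have "\<not> virt_adj wext.G wext.T (a, g) (b, h)"
    by (rule wext.not_virt_adj_if_functionals [OF prime_p, of "{F}" F x 1 "\<one>\<^bsub>WN\<^esub>"])
      (use F x c inv Fa Fb F_simps in simp_all)
  then show False using adj by blast
qed

text \<open>Three equations in four unknown coefficients.\<close>

lemma exists_annihilating_hom:
  assumes "x \<in> carrier WN" "y \<in> carrier WN" "z \<in> carrier WN"
  obtains f :: "(nat \<Rightarrow> nat \<Rightarrow> int) \<Rightarrow> nat \<Rightarrow> int" and v where "f \<in> hom WN (add_monoid Z)" "f x = \<zero>\<^bsub>Z\<^esub>" "f y = \<zero>\<^bsub>Z\<^esub>" "f z = \<zero>\<^bsub>Z\<^esub>"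
    "v \<in> carrier WN" "f v \<noteq> \<zero>\<^bsub>Z\<^esub>"
proof -
  have coord: "v j \<in> carrier Z" if "v \<in> carrier WN" "j \<in> {1, 2, 3, 4}" for v j
    using that by (auto elim!: WN_E)
  define A where "A i j = (if i = (0::nat) then x j else if i = 1 then y j else z j)" for i and j :: nat
  have "\<exists>c\<in>{1,2,3,4} \<rightarrow> carrier Z. (\<exists>j\<in>{1,2,3,4::nat}. c j \<noteq> \<zero>\<^bsub>Z\<^esub>) \<and>
      (\<forall>i\<in>{0,1,2}. (\<Oplus>\<^bsub>Z\<^esub>j\<in>{1,2,3,4}. A i j \<otimes>\<^bsub>Z\<^esub> c j) = \<zero>\<^bsub>Z\<^esub>)"
    by (rule R.exists_nontrivial_solution) (use coord assms in \<open>auto simp: A_def\<close>)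
  then obtain c where c: "c \<in> {1,2,3,4} \<rightarrow> carrier Z" "\<exists>j\<in>{1,2,3,4::nat}. c j \<noteq> \<zero>\<^bsub>Z\<^esub>"
      "\<And>i. i \<in> {0,1,2} \<Longrightarrow> (\<Oplus>\<^bsub>Z\<^esub>j\<in>{1,2,3,4}. A i j \<otimes>\<^bsub>Z\<^esub> c j) = \<zero>\<^bsub>Z\<^esub>"
    by blast
  have cc: "c (Suc 0) \<in> carrier Z" "c 2 \<in> carrier Z" "c 3 \<in> carrier Z" "c 4 \<in> carrier Z"
    using c(1) by auto
  define f where "f v = v 1 \<otimes>\<^bsub>Z\<^esub> c 1 \<oplus>\<^bsub>Z\<^esub> (v 2 \<otimes>\<^bsub>Z\<^esub> c 2 \<oplus>\<^bsub>Z\<^esub> (v 3 \<otimes>\<^bsub>Z\<^esub> c 3 \<oplus>\<^bsub>Z\<^esub> v 4 \<otimes>\<^bsub>Z\<^esub> c 4))"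
    for v :: "nat \<Rightarrow> nat \<Rightarrow> int"
  have hom: "f \<in> hom WN (add_monoid Z)"
    using cc by (auto intro!: homI elim!: WN_E simp: f_def R.l_distr R.a_ac)
  have coords: "v (Suc 0) \<in> carrier Z" "v 2 \<in> carrier Z" "v 3 \<in> carrier Z" "v 4 \<in> carrier Z"
    if "v \<in> carrier WN" for v using coord [OF that] by auto
  have "f x = \<zero>\<^bsub>Z\<^esub>" "f y = \<zero>\<^bsub>Z\<^esub>" "f z = \<zero>\<^bsub>Z\<^esub>"
    using c(3) [of 0] c(3) [of 1] c(3) [of 2] cc coords assms by (simp_all add: A_def f_def)
  moreover have "\<exists>v\<in>carrier WN. f v \<noteq> \<zero>\<^bsub>Z\<^esub>"
  proof -
    have "f (vec \<one>\<^bsub>Z\<^esub> \<zero>\<^bsub>Z\<^esub> \<zero>\<^bsub>Z\<^esub> \<zero>\<^bsub>Z\<^esub>) = c 1" "f (vec \<zero>\<^bsub>Z\<^esub> \<one>\<^bsub>Z\<^esub> \<zero>\<^bsub>Z\<^esub> \<zero>\<^bsub>Z\<^esub>) = c 2" "f (vec \<zero>\<^bsub>Z\<^esub> \<zero>\<^bsub>Z\<^esub> \<one>\<^bsub>Z\<^esub> \<zero>\<^bsub>Z\<^esub>) = c 3" "f (vec \<zero>\<^bsub>Z\<^esub> \<zero>\<^bsub>Z\<^esub> \<zero>\<^bsub>Z\<^esub> \<one>\<^bsub>Z\<^esub>) = c 4"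
      using cc by (simp_all add: f_def)
    moreover have "vec \<one>\<^bsub>Z\<^esub> \<zero>\<^bsub>Z\<^esub> \<zero>\<^bsub>Z\<^esub> \<zero>\<^bsub>Z\<^esub> \<in> carrier WN" "vec \<zero>\<^bsub>Z\<^esub> \<one>\<^bsub>Z\<^esub> \<zero>\<^bsub>Z\<^esub> \<zero>\<^bsub>Z\<^esub> \<in> carrier WN"
      "vec \<zero>\<^bsub>Z\<^esub> \<zero>\<^bsub>Z\<^esub> \<one>\<^bsub>Z\<^esub> \<zero>\<^bsub>Z\<^esub> \<in> carrier WN" "vec \<zero>\<^bsub>Z\<^esub> \<zero>\<^bsub>Z\<^esub> \<zero>\<^bsub>Z\<^esub> \<one>\<^bsub>Z\<^esub> \<in> carrier WN" by simp_all
    ultimately show ?thesis using c(2) by (metis insertE singletonD)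
  qed
  ultimately show ?thesis using that hom by blast
qed

text \<open>Modulo the common kernel of f and f h, which is stable under the involution h, the
  translation by a is trivial and h b = -b, so b / 2 is fixed by both elements.\<close>

lemma not_virt_adj_involution:
  assumes hh: "h \<circ> h = id"
  shows "\<not> virt_adj wext.G wext.T (a, id) (b, h)"
proof
  assume adj: "virt_adj wext.G wext.T (a, id) (b, h)"
  then have c: "a \<in> carrier WN" "b \<in> carrier WN" "id \<in> carrier D4" "h \<in> carrier D4"
    by (auto simp: virt_adj_def)
  have hh_act: "wact h (wact h v) = v" if "v \<in> carrier WN" for v
    using wext.act_comp [OF c(4,4) that] wext.act_one [OF that] hh by simp
  obtain f v where f: "f \<in> hom WN (add_monoid Z)" "f a = \<zero>\<^bsub>Z\<^esub>" "f (wact h a) = \<zero>\<^bsub>Z\<^esub>"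
    "f (b \<otimes>\<^bsub>WN\<^esub> wact h b) = \<zero>\<^bsub>Z\<^esub>" and v: "v \<in> carrier WN" "f v \<noteq> \<zero>\<^bsub>Z\<^esub>"
    using exists_annihilating_hom [of a "wact h a" "b \<otimes>\<^bsub>WN\<^esub> wact h b"] c by auto
  note f_simps = WN_hom_simps [OF f(1)]
  let ?f = "\<lambda>v. f (wact h v)"
  have f': "?f \<in> hom WN (add_monoid Z)"
    using f_simps c by (intro homI) (auto simp: wext.act_mult)
  note f'_simps = WN_hom_simps [OF f']
  have act_id: "wact id w = w" if "w \<in> carrier WN" for w
    using wext.act_one [OF that] by simp
  have b: "f b \<oplus>\<^bsub>Z\<^esub> f (wact h b) = \<zero>\<^bsub>Z\<^esub>" using f(4) f_simps c by simp
  have "\<not> virt_adj wext.G wext.T (a, id) (b, h)"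
  proof (rule wext.not_virt_adj_if_functionals [OF prime_p, of "{f, ?f}" f v 2 b])
    show "(\<forall>F\<in>{f, ?f}. F (wact h w) = \<zero>\<^bsub>Z\<^esub>) = (\<forall>F\<in>{f, ?f}. F w = \<zero>\<^bsub>Z\<^esub>)" if "w \<in> carrier WN" for w
      using hh_act [OF that] by auto
  next
    fix F assume "F \<in> {f, ?f}"
    then show "F (a [^]\<^bsub>WN\<^esub> (2::nat) \<otimes>\<^bsub>WN\<^esub> wact id b \<otimes>\<^bsub>WN\<^esub> inv\<^bsub>WN\<^esub> b) = \<zero>\<^bsub>Z\<^esub>"
      using f c act_id f_simps f'_simps
      by (auto simp: add_pow_two R.a_assoc R.r_neg)
  next
    fix F assume "F \<in> {f, ?f}"
    then show "F (b [^]\<^bsub>WN\<^esub> (2::nat) \<otimes>\<^bsub>WN\<^esub> wact h b \<otimes>\<^bsub>WN\<^esub> inv\<^bsub>WN\<^esub> b) = \<zero>\<^bsub>Z\<^esub>"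
      using c f_simps f'_simps hh_act b
      by (auto simp: add_pow_two R.a_ac R.r_neg R.r_neg1 R.r_neg2 R.l_neg)
  qed (use f f' v c act_id in auto)
  then show False using adj by blast
qed

text \<open>Modulo the common kernel of mm and nn the square of h is -1, so x -> b + h x has the
  fixed point (b + h b) / 2, and the translation by a is trivial.\<close>

lemma not_virt_adj_rotation:
  assumes h: "h \<in> d4_rotations" and a: "mm a = \<zero>\<^bsub>Z\<^esub>" "nn a = \<zero>\<^bsub>Z\<^esub>"
  shows "\<not> virt_adj wext.G wext.T (a, id) (b, h)"
proof
  assume adj: "virt_adj wext.G wext.T (a, id) (b, h)"
  then have c: "a \<in> carrier WN" "b \<in> carrier WN" "id \<in> carrier D4" "h \<in> carrier D4"
    by (auto simp: virt_adj_def)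
  define u where "u = b \<otimes>\<^bsub>WN\<^esub> wact h b"
  have uc: "u \<in> carrier WN" using c by (simp add: u_def)
  have act_id: "wact id w = w" if "w \<in> carrier WN" for w
    using wext.act_one [OF that] by simp
  have rot: "(mm (wact h w) = \<zero>\<^bsub>Z\<^esub> \<and> nn (wact h w) = \<zero>\<^bsub>Z\<^esub>) = (mm w = \<zero>\<^bsub>Z\<^esub> \<and> nn w = \<zero>\<^bsub>Z\<^esub>)" if "w \<in> carrier WN" for w
  proof -
    have "mm (wact h w) = nn w \<and> nn (wact h w) = \<ominus>\<^bsub>Z\<^esub> mm w \<or> mm (wact h w) = \<ominus>\<^bsub>Z\<^esub> nn w \<and> nn (wact h w) = mm w"
      using h that by (auto elim!: WN_E simp: d4_rotations_def a_minus_def R.minus_add R.a_ac)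
    then show ?thesis
      by (elim disjE conjE) (simp_all only: R.add.inv_eq_1_iff [simplified] form_closed [OF that] conj_commute)
  qed
  have "\<not> virt_adj wext.G wext.T (a, id) (b, h)"
  proof (rule wext.not_virt_adj_if_functionals
      [OF prime_p, of "{mm, nn}" mm "vec \<one>\<^bsub>Z\<^esub> \<zero>\<^bsub>Z\<^esub> \<zero>\<^bsub>Z\<^esub> \<zero>\<^bsub>Z\<^esub>" 2 u])
    fix f assume f: "f \<in> {mm, nn}"
    obtain b1 b2 b3 b4 where B: "b = vec b1 b2 b3 b4" "b1 \<in> carrier Z" "b2 \<in> carrier Z"
      "b3 \<in> carrier Z" "b4 \<in> carrier Z" using WN_E [OF c(2)] .
    \<comment> \<open>Both elements of \<open>d4_rotations\<close> have the square
      \<open>rho2\<close>, which negates mm and nn.\<close>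
    have "b [^]\<^bsub>WN\<^esub> (2::nat) \<otimes>\<^bsub>WN\<^esub> wact h u \<otimes>\<^bsub>WN\<^esub> inv\<^bsub>WN\<^esub> u = b \<otimes>\<^bsub>WN\<^esub> wact rho2 b"
      using h B(2-5) unfolding d4_rotations_def insert_iff empty_iff u_def B(1)
      by (elim disjE FalseE; simp add: add_pow_two; simp add: fun_eq_iff Zp_apply mod_simps del: power_Suc)
    then show "f (b [^]\<^bsub>WN\<^esub> (2::nat) \<otimes>\<^bsub>WN\<^esub> wact h u \<otimes>\<^bsub>WN\<^esub> inv\<^bsub>WN\<^esub> u) = \<zero>\<^bsub>Z\<^esub>"
      using f B(2-5) by (elim insertE emptyE; simp add: B(1) a_minus_def R.minus_add; simp add: fun_eq_iff Zp_apply mod_simps del: power_Suc)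
  next
    fix f assume f: "f \<in> {mm, nn}"
    then have hom: "f \<in> hom WN (add_monoid Z)" using form_hom by auto
    note f_simps = WN_hom_simps [OF hom]
    show "f (a [^]\<^bsub>WN\<^esub> (2::nat) \<otimes>\<^bsub>WN\<^esub> wact id u \<otimes>\<^bsub>WN\<^esub> inv\<^bsub>WN\<^esub> u) = \<zero>\<^bsub>Z\<^esub>"
      using f a c act_id [OF uc] uc f_simps by (auto simp: add_pow_two R.r_neg)
  qed (use form_hom rot act_id c uc in \<open>simp_all add: a_minus_def\<close>)
  then show False using adj by blast
qed

section \<open>Classification of the nonisolated vertices, and the diameter\<close>

text \<open>Each condition in the types comes from a form that would otherwise obstruct: tau for odd
  neighbours of even elements, the plane forms over the identity, pp and qq inside the four-group,
  and the plane form fixed by g over the two swaps.\<close>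

lemma nonisolated_types:
  assumes adj: "virt_adj wext.G wext.T (a, g) (b, h)"
  shows "type_A a g \<or> type_B a g"
proof -
  have c: "a \<in> carrier WN" "b \<in> carrier WN" "g \<in> carrier D4" "h \<in> carrier D4"
    using adj by (auto simp: virt_adj_def)
  have two: "\<one>\<^bsub>Z\<^esub> \<oplus>\<^bsub>Z\<^esub> \<one>\<^bsub>Z\<^esub> \<noteq> \<zero>\<^bsub>Z\<^esub>" using double_eq_zero [of "\<one>\<^bsub>Z\<^esub>"] by auto
  let ?even = "\<lambda>k. k = id \<or> k \<in> d4_klein"
  let ?odd = "\<lambda>k. k \<in> d4_rotations \<union> d4_flips"
  have tau_odd: "tau a \<noteq> \<zero>\<^bsub>Z\<^esub>" if "?even g" "?odd h"
    using not_virt_adj_if_eigenform [OF form_hom(2), of "vec \<one>\<^bsub>Z\<^esub> \<zero>\<^bsub>Z\<^esub> \<zero>\<^bsub>Z\<^esub> \<zero>\<^bsub>Z\<^esub>" g h a b]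
      form_wact_klein(1) tau_wact_odd that adj by (auto simp: a_minus_def)
  have parity: "?even h \<or> ?odd h" "?even g \<or> ?odd g" using c by (auto simp: D4_carrier)
  have disj: "g \<noteq> id \<and> g \<notin> d4_klein" if "?odd g" using that by (auto simp: d4_class_defs)
  consider "g = id" | "g \<in> d4_klein" | "?odd g" using parity by blast
  then show ?thesis
  proof cases
    case 1
    have "h \<in> d4_rotations"
    proof (rule ccontr)
      assume "h \<notin> d4_rotations"
      then have "h \<circ> h = id" using c(4) by (auto simp: D4_carrier d4_class_defs)
      then show False using not_virt_adj_involution adj 1 by blast
    qed
    then show ?thesis
      using tau_odd 1 not_virt_adj_rotation [of h a b] adj by (auto simp: type_A_def d4_class_defs)
  next
    case 2
    show ?thesis
    proof (cases "tau a = \<zero>\<^bsub>Z\<^esub>")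
      case False
      then show ?thesis using 2 by (auto simp: type_A_def d4_klein_def)
    next
      case True
      then have h: "?even h" using tau_odd parity 2 by blast
      have "sig a \<noteq> \<zero>\<^bsub>Z\<^esub>"
      proof
        assume "sig a = \<zero>\<^bsub>Z\<^esub>"
        moreover have pq: "pp a = qq a"
          using True c form_sums(1) [of a] R.r_right_minus_eq [of "pp a" "qq a"] by auto
        ultimately have "pp a = \<zero>\<^bsub>Z\<^esub>" "qq a = \<zero>\<^bsub>Z\<^esub>"
          using double_eq_zero [of "qq a"] c form_sums(2) [of a] by auto
        then show False
          using not_virt_adj_if_invariant_forms
            [OF form_hom(5,6), of "vec \<one>\<^bsub>Z\<^esub> \<zero>\<^bsub>Z\<^esub> \<zero>\<^bsub>Z\<^esub> \<zero>\<^bsub>Z\<^esub>" "vec \<zero>\<^bsub>Z\<^esub> \<one>\<^bsub>Z\<^esub> \<zero>\<^bsub>Z\<^esub> \<zero>\<^bsub>Z\<^esub>" g h a b]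
            form_wact_klein h 2 adj by auto
      qed
      moreover have "nn a \<noteq> \<zero>\<^bsub>Z\<^esub>" if g: "g = swap13"
      proof
        assume n: "nn a = \<zero>\<^bsub>Z\<^esub>"
        \<comment> \<open>The identity is excluded since g is an involution. For h = g the forms nn
          and tau are both invariant and vanish at a; in the last case g fixes nn and h negates
          it.\<close>
        consider "h = id" | "h = swap13" | "h = rho2 \<or> h = swap24"
          using h by (auto simp: d4_klein_def)
        then show False
        proof cases
          case 1
          then show False
            using not_virt_adj_involution [of g b a] g virt_adj_commute [OF adj] by simp
        next
          case 2
          then show False
            using not_virt_adj_if_invariant_forms
              [OF form_hom(4,2), of "vec \<zero>\<^bsub>Z\<^esub> \<one>\<^bsub>Z\<^esub> \<zero>\<^bsub>Z\<^esub> (\<ominus>\<^bsub>Z\<^esub> \<one>\<^bsub>Z\<^esub>)" "vec \<one>\<^bsub>Z\<^esub> \<zero>\<^bsub>Z\<^esub> \<zero>\<^bsub>Z\<^esub> \<zero>\<^bsub>Z\<^esub>" g h a b]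
              form_wact_klein(1) mm_nn_wact(4) g adj n True two
            by (auto simp: d4_klein_def a_minus_def R.l_neg)
        next
          case 3
          then show False
            using not_virt_adj_if_eigenform [OF form_hom(4), of "vec \<zero>\<^bsub>Z\<^esub> \<one>\<^bsub>Z\<^esub> \<zero>\<^bsub>Z\<^esub> \<zero>\<^bsub>Z\<^esub>" g h a b]
              mm_nn_wact g adj n by (auto simp: a_minus_def)
        qed
      qed
      moreover have "mm a \<noteq> \<zero>\<^bsub>Z\<^esub>" if g: "g = swap24"
      proof
        assume m: "mm a = \<zero>\<^bsub>Z\<^esub>"
        consider "h = id" | "h = swap24" | "h = rho2 \<or> h = swap13"
          using h by (auto simp: d4_klein_def)
        then show False
        proof cases
          case 1
          then show False
            using not_virt_adj_involution [of g b a] g virt_adj_commute [OF adj] by simp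
        next
          case 2
          then show False
            using not_virt_adj_if_invariant_forms
              [OF form_hom(3,2), of "vec \<one>\<^bsub>Z\<^esub> \<zero>\<^bsub>Z\<^esub> (\<ominus>\<^bsub>Z\<^esub> \<one>\<^bsub>Z\<^esub>) \<zero>\<^bsub>Z\<^esub>" "vec \<zero>\<^bsub>Z\<^esub> \<one>\<^bsub>Z\<^esub> \<zero>\<^bsub>Z\<^esub> \<zero>\<^bsub>Z\<^esub>" g h a b]
              form_wact_klein(1) mm_nn_wact(1) g adj m True two
            by (auto simp: d4_klein_def a_minus_def R.r_neg R.add.inv_eq_1_iff)
        next
          case 3
          then show False
            using not_virt_adj_if_eigenform [OF form_hom(3), of "vec \<one>\<^bsub>Z\<^esub> \<zero>\<^bsub>Z\<^esub> \<zero>\<^bsub>Z\<^esub> \<zero>\<^bsub>Z\<^esub>" g h a b]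
              mm_nn_wact g adj m by (auto simp: a_minus_def)
        qed
      qed
      ultimately show ?thesis using True 2 by (simp add: type_B_def)
    qed
  next
    case 3
    then show ?thesis using disj by (simp add: type_A_def)
  qed
qed

lemma diameter_wreath:
  "graph_diameter (proper_virt_gen_graph Z2_wr_D4 Z2_wr_D4_topology) = 3"
  unfolding wreath_eq wreath_topology_eq
proof -
  let ?adj = "virt_adj wext.G wext.T"
  have AA: "\<exists>z. ?adj (a, g) z \<and> ?adj z (a', g')"
    if "a \<in> carrier WN" "g \<in> carrier D4" "type_A a g" "a' \<in> carrier WN" "g' \<in> carrier D4" "type_A a' g'"
    for a g a' g'
  proof -
    obtain b where "b \<in> carrier WN" "generic_for b a" "generic_for b a'"
      using exists_generic by blast
    then show ?thesis
      using virt_adj_rotation [OF that(1-3)] virt_adj_commute [OF virt_adj_rotation [OF that(4-6)]]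
      by blast
  qed
  have BB: "\<exists>b h. ?adj (a, g) (b, h) \<and> ?adj (b, h) (a', g') \<and> type_A b h \<and> b \<in> carrier WN \<and> h \<in> carrier D4"
    if "a \<in> carrier WN" "type_B a g" "a' \<in> carrier WN" "type_B a' g'" for a g a' g'
  proof -
    obtain b where b: "b \<in> carrier WN" "generic_for b a" "generic_for b a'"
      using exists_generic by blast
    \<comment> \<open>Three elements are available and at most two are taken. A generic vector over
      h has nonzero alternating sum, so the common neighbour is of type A.\<close>
    obtain h where h: "h \<in> d4_klein" "h \<noteq> g" "h \<noteq> g'"
    proof -
      have "card {g, g'} \<le> 2" "card d4_klein = 3"
        by (simp_all add: d4_klein_def card_insert_if)
      then have "\<not> d4_klein \<subseteq> {g, g'}"
        using card_mono [of "{g, g'}" d4_klein] by auto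
      then show ?thesis using that by blast
    qed
    have "type_A b h" using b(2) h(1) by (auto simp: type_A_def generic_for_def d4_klein_def)
    moreover have "h \<in> carrier D4" using h(1) by (simp add: D4_carrier)
    ultimately show ?thesis
      using virt_adj_klein [OF that(1,2) b(1,2) h(1,2)] b(1)
        virt_adj_commute [OF virt_adj_klein [OF that(3,4) b(1,3) h(1,3)]] by blast
  qed
  \<comment> \<open>The pair at distance 3: u has tau = mm = 1, hence is of type A over the
    identity, while v has tau = 0 and sum 2, hence is of type B over the half turn.\<close>
  define u where "u = vec \<one>\<^bsub>Z\<^esub> \<zero>\<^bsub>Z\<^esub> \<zero>\<^bsub>Z\<^esub> \<zero>\<^bsub>Z\<^esub>"
  define v where "v = vec \<one>\<^bsub>Z\<^esub> \<one>\<^bsub>Z\<^esub> \<zero>\<^bsub>Z\<^esub> \<zero>\<^bsub>Z\<^esub>"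
  have uv: "u \<in> carrier WN" "v \<in> carrier WN" by (simp_all add: u_def v_def)
  have two: "\<one>\<^bsub>Z\<^esub> \<oplus>\<^bsub>Z\<^esub> \<one>\<^bsub>Z\<^esub> \<noteq> \<zero>\<^bsub>Z\<^esub>" using double_eq_zero [of "\<one>\<^bsub>Z\<^esub>"] by auto
  have u: "type_A u id" by (simp add: type_A_def u_def a_minus_def)
  have tau_v: "tau v = \<zero>\<^bsub>Z\<^esub>" by (simp add: v_def a_minus_def R.r_neg)
  have v: "type_B v rho2"
    using two by (simp add: type_B_def v_def a_minus_def R.r_neg d4_klein_def)
  have id: "id \<in> carrier D4" by (simp add: D4_carrier)
  obtain u' where u': "?adj (u, id) u'" using AA [OF uv(1) id u uv(1) id u] by blast
  obtain v' where v': "?adj (v, rho2) v'" using BB [OF uv(2) v uv(2) v] by blast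
  show "graph_diameter (proper_virt_gen_graph wext.G wext.T) = 3"
  proof (rule virt_diameter_eq_3)
    fix x y x' y' assume adj: "?adj x x'" "?adj y y'"
    obtain a g a' g' where xy: "x = (a, g)" "y = (a', g')" by (cases x; cases y)
    have c: "a \<in> carrier WN" "g \<in> carrier D4" "a' \<in> carrier WN" "g' \<in> carrier D4"
      using adj xy by (auto simp: virt_adj_def)
    have "type_A a g \<or> type_B a g" "type_A a' g' \<or> type_B a' g'"
      using nonisolated_types adj xy by (metis surj_pair)+
    then consider "type_A a g" "type_A a' g'" | "type_B a g" "type_B a' g'"
      | "type_B a g" "type_A a' g'" | "type_A a g" "type_B a' g'" by blast
    then show "(\<exists>z. ?adj x z \<and> ?adj z y) \<or> (\<exists>z w. ?adj x z \<and> ?adj z w \<and> ?adj w y)"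
    proof cases
      case 1
      then show ?thesis using AA c unfolding xy by blast
    next
      case 2
      then show ?thesis using BB c unfolding xy by blast
    next
      case 3
      \<comment> \<open>Applying \<open>BB\<close> to a vertex and itself yields a neighbour of type
        A, from which \<open>AA\<close> continues.\<close>
      obtain b h where b: "?adj (a, g) (b, h)" "type_A b h" "b \<in> carrier WN" "h \<in> carrier D4"
        using BB [OF c(1) 3(1) c(1) 3(1)] by blast
      then show ?thesis using AA [OF b(3,4,2) c(3,4) 3(2)] unfolding xy by blast
    next
      case 4
      obtain b h where b: "?adj (b, h) (a', g')" "type_A b h" "b \<in> carrier WN" "h \<in> carrier D4"
        using BB [OF c(3) 4(2) c(3) 4(2)] by blast
      then show ?thesis using AA [OF c(1,2) 4(1) b(3,4,2)] unfolding xy by blast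
    qed
  next
    show "?adj (u, id) u'" by (rule u')
    show "?adj (v, rho2) v'" by (rule v')
    show "(u, id) \<noteq> (v, rho2)" by (simp add: u_def v_def)
    show "\<not> ?adj (u, id) (v, rho2)" using not_virt_adj_involution by simp
    fix z
    show "\<not> (?adj (u, id) z \<and> ?adj z (v, rho2))"
    proof
      assume adj: "?adj (u, id) z \<and> ?adj z (v, rho2)"
      obtain b h where z: "z = (b, h)" by (cases z)
      have "h \<in> carrier D4" using adj z by (auto simp: virt_adj_def)
      moreover have "h \<circ> h \<noteq> id" using not_virt_adj_involution adj z by blast
      ultimately have "h \<in> d4_rotations" by (auto simp: D4_carrier d4_class_defs)
      then have "\<not> ?adj (v, rho2) (b, h)"
        using not_virt_adj_if_eigenform [OF form_hom(2), of u rho2 h v b]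
          form_wact_klein(1) tau_wact_odd tau_v uv
        by (auto simp: u_def a_minus_def d4_klein_def)
      then show False using adj z virt_adj_commute [of _ _ z "(v, rho2)"] by blast
    qed
  qed
qed

end

theorem proposition3:
  fixes p :: nat
  assumes "Factorial_Ring.prime p"
  shows "(\<forall>(L :: 'a ring) \<phi> \<zeta>.
            field L \<and> \<phi> \<in> ring_hom (Zp p) L \<and> inj_on \<phi> (carrier (Zp p)) \<and>
            \<zeta> \<in> Units L \<and> group.ord (units_of L) \<zeta> = p \<longrightarrow>
            graph_diameter (proper_virt_gen_graph (max_class_group p L \<phi> \<zeta>)
              (max_class_topology p L \<phi> \<zeta>)) = 2) \<and>
         graph_diameter (proper_virt_gen_graph (quat_group p) (quat_topology p)) = 2 \<and>
         graph_diameter (proper_virt_gen_graph Z2_wr_D4 Z2_wr_D4_topology) = 3"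
proof (intro conjI allI impI; (elim conjE)?)
  have padic: "padic p" using assms by unfold_locales
  fix L :: "'a ring" and \<phi> \<zeta>
  assume "field L" "\<phi> \<in> ring_hom (Zp p) L" "inj_on \<phi> (carrier (Zp p))"
    "\<zeta> \<in> Units L" "group.ord (units_of L) \<zeta> = p"
  then have "max_class p L \<phi> \<zeta>"
    using padic by (intro max_class.intro max_class_axioms.intro)
  then show "graph_diameter (proper_virt_gen_graph (max_class_group p L \<phi> \<zeta>)
      (max_class_topology p L \<phi> \<zeta>)) = 2"
    by (rule max_class.diameter_max_class)
next
  have "padic p" using assms by unfold_locales
  then show "graph_diameter (proper_virt_gen_graph (quat_group p) (quat_topology p)) = 2"
    by (rule padic.diameter_quat_group)
next
  have "padic_two"
    by (intro padic_two.intro padic.intro two_is_prime_nat)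
  then show "graph_diameter (proper_virt_gen_graph Z2_wr_D4 Z2_wr_D4_topology) = 3"
    by (rule padic_two.diameter_wreath)
qed

end
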